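(* Let $N\ge1$, $\alpha\in(0,2]$ and $1<p<p_{\alpha,Q}$. Then there exists $\gamma_C>0$ such that, if $\mu$ is a nonnegative Radon measure on $\mathbb H^N$ satisfying $$\sup_{\eta\in\mathbb H^N}\mu(B(\eta,T^{1/\alpha}))\le\gamma_CT^{\frac Q\alpha-\frac1{p-1}}\quad\text{for some }T>0,$$ then the problem $\partial_tu+(-\Delta_{\mathbb H})^{\alpha/2}u=u^p$, $u(\cdot,0)=\mu$ possesses a solution in $\mathbb H^N\times[0,T)$.
   Context: Heisenberg group: for $N\ge1$, $\mathbb H^N=\mathbb R^{2N+1}$ with points $\eta=(x,y,\tau)$, $x,y\in\mathbb R^N$, $\tau\in\mathbb R$, and group law $\eta\circ\eta'=(x+x',y+y',\tau+\tau'+2(x\cdot y'-x'\cdot y))$; the identity is $0$ and $\eta^{-1}=-\eta$. The Haar measure is Lebesgue measure on $\mathbb R^{2N+1}$; $|A|$ denotes the measure of $A$. The homogeneous norm is $|\eta|_{\mathbb H^N}=((|x|^2+|y|^2)^2+\tau^2)^{1/4}$, the distance is $d_{\mathbb H}(\eta,\zeta)=|\zeta^{-1}\circ\eta|_{\mathbb H^N}$, $B(\eta,r)=\{\zeta:d_{\mathbb H}(\eta,\zeta)<r\}$, and $Q=2N+2$ is the homogeneous dimension. With $X_i=\partial_{x_i}-2y_i\partial_\tau$, $Y_i=\partial_{y_i}+2x_i\partial_\tau$ ($i=1,\dots,N$), the sub-Laplacian is $\Delta_{\mathbb H}=\sum_{i=1}^N(X_i^2+Y_i^2)$. Fractional sub-Laplacian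 and kernel: for $\alpha\in(0,2)$, $(-\Delta_{\mathbb H})^{\alpha/2}f=\frac{1}{\Gamma(1-\alpha/2)}\int_0^\infty t^{-\alpha/2}(-\Delta_{\mathbb H})e^{t\Delta_{\mathbb H}}f\,dt$ (limit in $L^2$), where $e^{t\Delta_{\mathbb H}}$ is the heat semigroup of $\Delta_{\mathbb H}$. For $\alpha\in(0,2]$ put $\Lambda_\alpha=-(-\Delta_{\mathbb H})^{\alpha/2}$ (so $\Lambda_2=\Delta_{\mathbb H}$). $G_\alpha(\eta,t)$ denotes the fundamental solution of $\partial_tu-\Lambda_\alpha u=0$ on $\mathbb H^N\times(0,\infty)$, so that $[e^{t\Lambda_\alpha}f](\eta)=\int_{\mathbb H^N}G_\alpha(\zeta^{-1}\circ\eta,t)f(\zeta)\,d\zeta$; for a nonnegative Radon measure $\mu$, $[e^{t\Lambda_\alpha}\mu](\eta)=\int_{\mathbb H^N}G_\alpha(\zeta^{-1}\circ\eta,t)\,d\mu(\zeta)$. $G_\alpha$ is smooth, nonnegative, $G_\alpha(\eta^{-1},t)=G_\alpha(\eta,t)$, $\int G_\alpha(\eta,t)d\eta=1$, and $G_\alpha(\eta,t)=\int G_\alpha(\zeta^{-1}\circ\eta,t-s)G_\alpha(\zeta,s)d\zeta$ for $0<s<t$. Solutions: $p_{\alpha,d}:=1+\alpha/d$. Let $T\in(0,\infty]$ and $u\ge0$ measurable on $\mathbb H^N\times(0,T)$. (a) $u$ is a solution of $\partial_tu+(-\Delta_{\mathbb H})^{\alpha/2}u=u^p$ in $\mathbb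 H^N\times(0,T)$ if $\infty>u(\eta,t)=[e^{(t-\tau)\Lambda_\alpha}u(\tau)](\eta)+\int_\tau^t[e^{(t-s)\Lambda_\alpha}u(s)^p](\eta)\,ds$ for a.a. $\eta$ and all $0<\tau<t<T$. (b) Given a nonnegative Radon measure $\mu$ on $\mathbb H^N$, $u$ is a solution of the problem with initial data $\mu$ (i.e. of $\partial_tu+(-\Delta_{\mathbb H})^{\alpha/2}u=u^p$, $u(\cdot,0)=\mu$) in $\mathbb H^N\times[0,T)$ if $\infty>u(\eta,t)=[e^{t\Lambda_\alpha}\mu](\eta)+\int_0^t[e^{(t-s)\Lambda_\alpha}u(s)^p](\eta)\,ds$ for a.a. $\eta$ and $0<t<T$; a supersolution if "$=$" is replaced by "$\ge$". (c) A solution as in (b) is minimal if $u\le v$ a.e. for every solution $v$ as in (b). *)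

theory Defs
  imports "HOL-Analysis.Analysis"
begin

type_synonym 'n heis = "(real^'n) \<times> (real^'n) \<times> real"

definition hmult :: "'n::finite heis \<Rightarrow> 'n heis \<Rightarrow> 'n heis" where
  "hmult a b = (case a of (x, y, \<tau>) \<Rightarrow> case b of (x', y', \<tau>') \<Rightarrow>
      (x + x', y + y', \<tau> + \<tau>' + 2 * (x \<bullet> y' - x' \<bullet> y)))"

definition hinv :: "'n::finite heis \<Rightarrow> 'n heis" where
  "hinv a = - a"

definition hnorm :: "'n::finite heis \<Rightarrow> real" where
  "hnorm a = (case a of (x, y, \<tau>) \<Rightarrow> ((norm x ^ 2 + norm y ^ 2) ^ 2 + \<tau> ^ 2) powr (1/4))"

definition hdist :: "'n::finite heis \<Rightarrow> 'n heis \<Rightarrow> real" where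
  "hdist \<eta> \<zeta> = hnorm (hmult (hinv \<zeta>) \<eta>)"

definition hball :: "'n::finite heis \<Rightarrow> real \<Rightarrow> 'n heis set" where
  "hball \<eta> r = {\<zeta>. hdist \<eta> \<zeta> < r}"

definition hdim :: "'n::finite itself \<Rightarrow> real" where
  "hdim _ = 2 * real CARD('n) + 2"

text \<open>Heat kernel G_2(eta,t) of the sub-Laplacian (kernel of e^{t Delta_H}),
  obtained by Fourier transform in tau (Mehler / Gaveau--Hulanicki formula):
  G_2((x,y,tau),t) = 1/(2 pi) int_R cos(l tau) (l/(pi sinh(4 l t)))^N exp(-l coth(4 l t)(|x|^2+|y|^2)) dl.\<close>
definition heat_kernel :: "'n::finite heis \<Rightarrow> real \<Rightarrow> real" where
  "heat_kernel \<eta> t = (case \<eta> of (x, y, \<tau>) \<Rightarrow>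
     (1 / (2 * pi)) * (LINT l|lborel. cos (l * \<tau>) * (l / (pi * sinh (4 * l * t))) ^ CARD('n)
        * exp (- (l * cosh (4 * l * t) / sinh (4 * l * t)) * (norm x ^ 2 + norm y ^ 2))))"

text \<open>Density of the one-sided sigma-stable subordinator (0 < sigma < 1) at time t:
  the function f with int_0^infty exp(-lambda s) f(s) ds = exp(-t lambda^sigma) (Pollard's formula).\<close>
definition stable_density :: "real \<Rightarrow> real \<Rightarrow> real \<Rightarrow> real" where
  "stable_density \<sigma> t s = (1 / pi) * (LINT u:{0<..}|lborel.
      exp (- s * u) * exp (- t * u powr \<sigma> * cos (pi * \<sigma>)) * sin (t * u powr \<sigma> * sin (pi * \<sigma>)))"

text \<open>Fundamental solution G_alpha of partial_t u - Lambda_alpha u = 0, Lambda_alpha = -(-Delta_H)^(alpha/2);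
  for alpha < 2 obtained from the heat kernel by Bochner subordination.\<close>
definition G :: "real \<Rightarrow> 'n::finite heis \<Rightarrow> real \<Rightarrow> real" where
  "G \<alpha> \<eta> t = (if \<alpha> = 2 then heat_kernel \<eta> t
      else LINT s:{0<..}|lborel. stable_density (\<alpha> / 2) t s * heat_kernel \<eta> s)"

definition radon_measure :: "'n::finite heis measure \<Rightarrow> bool" where
  "radon_measure \<mu> \<longleftrightarrow> sets \<mu> = sets borel \<and> (\<forall>K. compact K \<longrightarrow> emeasure \<mu> K < \<infinity>)"

definition is_solution_init ::
  "real \<Rightarrow> real \<Rightarrow> 'n::finite heis measure \<Rightarrow> real \<Rightarrow> ('n heis \<Rightarrow> real \<Rightarrow> real) \<Rightarrow> bool" where
  "is_solution_init \<alpha> p \<mu> T u \<longleftrightarrow>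
     (\<lambda>z. u (fst z) (snd z)) \<in> borel_measurable (restrict_space lebesgue (UNIV \<times> {0<..<T})) \<and>
     (\<forall>\<eta>. \<forall>t\<in>{0<..<T}. 0 \<le> u \<eta> t) \<and>
     (\<forall>t\<in>{0<..<T}. AE \<eta> in lborel.
        ennreal (u \<eta> t) =
          (\<integral>\<^sup>+ \<zeta>. ennreal (G \<alpha> (hmult (hinv \<zeta>) \<eta>) t) \<partial>\<mu>)
          + (\<integral>\<^sup>+ s\<in>{0<..<t}. (\<integral>\<^sup>+ \<zeta>. ennreal (G \<alpha> (hmult (hinv \<zeta>) \<eta>) (t - s) * u \<zeta> s powr p) \<partial>lborel) \<partial>lborel))"

end

(* The kernel enters only through an upper bound.
   Shifting the frequency integral of the Mehler formula into the complex plane gives a Gaussian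
   bound for the heat kernel in the homogeneous norm. Deforming the Hankel contour in Pollard's formula
   gives two-sided decay of the stable density, and subordination then bounds G by
   C t^(-Q/alpha) min (1, (|eta| / t^(1/alpha))^(-Q - alpha/2)). This profile is a sum over dyadic balls,
   so potentials of a measure are controlled by its masses on balls of radius T^(1/alpha).
   The Picard iterates of the Duhamel formula are increasing; with M the bound on these masses, the iterates
   stay in the set of functions that are at most 2 C M t^(-Q/alpha) and have mass at most 2 C M on such
   balls, because near s = 0 the source u^p is estimated by its local mass and
   Q (p - 1) / alpha < 1 makes the time integral converge. *)
theory Submission
  imports Defs "HOL-Complex_Analysis.Complex_Analysis" "HOL-Real_Asymp.Real_Asymp"
begin

section \<open>Gaussian bound for the heat kernel\<close>

text \<open>The kernels are given as explicit integrals, and what is extracted from them are upper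
  bounds of absolute values. Coercion to \<open>ennreal\<close> turns the kernel into its positive
  part, so the Duhamel operator is monotone by construction, and monotone convergence makes the
  supremum of the iterates a fixed point. The exponent -Q - alpha/2 is a compromise: for alpha < 2
  the stable density decays like s^(-1 - alpha/2), its moment of order alpha/2 diverges, and half of
  that order is taken. Any exponent beyond -Q in decay keeps the dyadic sum convergent. No single
  estimate covers the whole Duhamel integral over (0,t): the sup bound of u^p is of order
  s^(-Qp/alpha), not integrable at 0, and the smoothing factor (t - s)^(-Q/alpha) is not integrable
  at t, since Q/alpha is at least 2. The integral is therefore cut at t/2. The power of T in the
  smallness hypothesis is the one that cancels T^(1 - Q(p-1)/alpha), so the threshold depends on the
  constants of the two kernel estimates only.\<close>

lemma sinh_Complex: "sinh (Complex v y) = Complex (sinh v * cos y) (cosh v * sin y)"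
  by (simp add: sinh_def cosh_def complex_eq_iff Re_exp Im_exp field_simps)

lemma cosh_Complex: "cosh (Complex v y) = Complex (cosh v * cos y) (sinh v * sin y)"
  by (simp add: sinh_def cosh_def complex_eq_iff Re_exp Im_exp field_simps)

lemma sinh_complex_of_real: "sinh (complex_of_real x) = of_real (sinh x)"
  by (simp add: complex_of_real_def sinh_Complex)

lemma cosh_complex_of_real: "cosh (complex_of_real x) = of_real (cosh x)"
  by (simp add: complex_of_real_def cosh_Complex)

lemma borel_measurable_sinh [measurable]: "(sinh :: real \<Rightarrow> real) \<in> borel_measurable borel"
  and borel_measurable_cosh [measurable]: "(cosh :: real \<Rightarrow> real) \<in> borel_measurable borel"
  by (auto intro!: borel_measurable_continuous_onI continuous_intros)

lemma cmod_sinh_Complex: "(cmod (sinh (Complex v y)))\<^sup>2 = (sinh v)\<^sup>2 + (sin y)\<^sup>2"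
proof -
  have "(cmod (sinh (Complex v y)))\<^sup>2 = (sinh v)\<^sup>2 * (cos y)\<^sup>2 + (cosh v)\<^sup>2 * (sin y)\<^sup>2"
    by (simp add: sinh_Complex cmod_power2 power_mult_distrib)
  then show ?thesis
    by (simp add: cosh_square_eq cos_squared_eq algebra_simps)
qed

text \<open>The denominator is |sinh w|^2, and the mixed terms of the numerator recombine so that it
  separates into a part in v and a part in y. This allows a comparison term by term.\<close>

lemma Re_coth_Complex:
  "Re (Complex v y * cosh (Complex v y) / sinh (Complex v y)) =
     (v * sinh v * cosh v + y * sin y * cos y) / ((sinh v)\<^sup>2 + (sin y)\<^sup>2)"
proof -
  define D where "D = (sinh v)\<^sup>2 + (sin y)\<^sup>2"
  have a: "(sinh v * cos y)\<^sup>2 + (cosh v * sin y)\<^sup>2 = D"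
    using cmod_sinh_Complex[of v y] by (simp add: sinh_Complex cmod_power2 D_def)
  have c: "(cos y)^2 = 1 - (sin y)^2" by (simp add: cos_squared_eq)
  have h: "(cosh v)^2 = 1 + (sinh v)^2" by (simp add: cosh_square_eq)
  have b: "(v * (cosh v * cos y) - y * (sinh v * sin y)) * (sinh v * cos y)
      + (v * (sinh v * sin y) + y * (cosh v * cos y)) * (cosh v * sin y)
      = v * sinh v * cosh v + y * sin y * cos y"
    using c h by algebra
  show ?thesis
    by (simp only: Re_divide sinh_Complex cosh_Complex complex.sel complex_mult a b D_def[symmetric])
qed

lemma sinh_Complex_nonzero:
  assumes "\<bar>Im w\<bar> < 2" "w \<noteq> 0"
  shows "sinh w \<noteq> 0"
proof
  assume "sinh w = 0"
  then have "(sinh (Re w))\<^sup>2 + (sin (Im w))\<^sup>2 = 0"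
    using cmod_sinh_Complex[of "Re w" "Im w"] by simp
  then have "sinh (Re w) = 0" "sin (Im w) = 0" by (auto simp: add_nonneg_eq_0_iff)
  then have "Re w = 0" "Im w = 0"
    using sin_eq_0_pi[of "Im w"] assms pi_gt3 by auto
  then show False using assms by (simp add: complex_eq_iff)
qed

lemma sinh_le_times_cosh: "0 \<le> (x::real) \<Longrightarrow> sinh x \<le> x * cosh x"
proof -
  assume x: "0 \<le> x"
  have "0 * cosh 0 - sinh 0 \<le> x * cosh x - sinh x"
    by (rule DERIV_nonneg_imp_nondecreasing[OF x, where f="\<lambda>x. x * cosh x - sinh x"])
       (use x in \<open>force intro!: derivative_eq_intros\<close>)
  then show ?thesis by simp
qed

lemma sinh_square_le: "(sinh v)\<^sup>2 \<le> v * sinh v * cosh (v::real)"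
proof (cases "0 \<le> v")
  case True
  then show ?thesis using mult_right_mono[OF sinh_le_times_cosh[OF True], of "sinh v"]
    by (simp add: power2_eq_square algebra_simps)
next
  case False
  then have v: "0 \<le> - v" by simp
  then show ?thesis using mult_right_mono[OF sinh_le_times_cosh[OF v], of "sinh (- v)"]
    by (simp add: power2_eq_square algebra_simps)
qed

text \<open>Each numerator term of \<open>Re_coth_Complex\<close> dominates half of the matching
  denominator term: 1 < pi/3 gives cos y \<ge> 1/2, and sin y \<le> y. This keeps half of the
  Gaussian exponent when the contour is moved to Im w = 1.\<close>

lemma Re_coth_ge:
  assumes "0 \<le> y" "y \<le> 1" "Complex v y \<noteq> 0"
  shows "1/2 \<le> Re (Complex v y * cosh (Complex v y) / sinh (Complex v y))"
proof -
  have D: "0 < (sinh v)\<^sup>2 + (sin y)\<^sup>2"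
    using sinh_Complex_nonzero[of "Complex v y"] assms by (simp flip: cmod_sinh_Complex)
  have s: "0 \<le> sin y" using assms pi_gt3 by (intro sin_ge_zero) auto
  have "cos (pi/3) \<le> cos y" using assms pi_gt3 by (intro cos_monotone_0_pi_le) auto
  then have c: "1/2 \<le> cos y" by (simp add: cos_60)
  have sy: "sin y \<le> y" using assms by (simp add: sin_x_le_x)
  have "(sin y)\<^sup>2 / 2 \<le> y * sin y * cos y"
  proof -
    have "sin y * sin y \<le> y * sin y" using s sy by (simp add: mult_right_mono)
    moreover have "y * sin y * (1/2) \<le> y * sin y * cos y"
      using c s assms by (intro mult_left_mono) auto
    ultimately show ?thesis by (simp add: power2_eq_square)
  qed
  moreover have "(sinh v)\<^sup>2 / 2 \<le> v * sinh v * cosh v"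
    using sinh_square_le[of v] zero_le_power2[of "sinh v"] by linarith
  ultimately have "1/2 * ((sinh v)\<^sup>2 + (sin y)\<^sup>2) \<le> v * sinh v * cosh v + y * sin y * cos y"
    by simp
  then show ?thesis unfolding Re_coth_Complex using D by (simp only: pos_le_divide_eq)
qed

section \<open>Holomorphy and decay of w / sinh w\<close>

lemma sinh_holomorphic: "(sinh :: complex \<Rightarrow> complex) holomorphic_on S"
  unfolding holomorphic_on_def field_differentiable_def by (auto intro!: exI derivative_eq_intros)

lemma cosh_holomorphic: "(cosh :: complex \<Rightarrow> complex) holomorphic_on S"
  unfolding holomorphic_on_def field_differentiable_def by (auto intro!: exI derivative_eq_intros)

text \<open>This is w times the usual hyperbolic cosecant, with the removable singularity at 0
  filled. Both non-oscillating factors of the Mehler integrand are built from it, as w coth w is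
  \<open>cosech w * cosh w\<close>.\<close>

definition cosech :: "complex \<Rightarrow> complex" where
  "cosech w = (if w = 0 then 1 else w / sinh w)"

text \<open>The half-width 2 stays below pi, so that 0 is the only zero of sinh inside, and leaves
  the line Im w = 1 in the interior.\<close>

definition strip :: "complex set" where "strip = {w. \<bar>Im w\<bar> < 2}"

lemma open_strip: "open strip" and convex_strip: "convex strip"
proof -
  have *: "strip = {w. Im w < 2} \<inter> {w. Im w > -2}" by (auto simp: strip_def)
  show "open strip" unfolding * by (intro open_Int open_halfspace_Im_lt open_halfspace_Im_gt)
  show "convex strip" unfolding * by (intro convex_Int convex_halfspace_Im_lt convex_halfspace_Im_gt)
qed

text \<open>Riemann's theorem on removable singularities; the limit at 0 is the derivative of sinh
  there, inverted.\<close>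

lemma cosech_holomorphic: "cosech holomorphic_on strip"
proof (rule no_isolated_singularity'[where K = "{0}"])
  have "(sinh has_field_derivative 1) (at (0::complex))"
    by (auto intro!: derivative_eq_intros)
  then have "((\<lambda>w::complex. sinh w / w) \<longlongrightarrow> 1) (at 0)"
    by (simp add: has_field_derivative_iff)
  then have lim: "((\<lambda>w::complex. inverse (sinh w / w)) \<longlongrightarrow> inverse 1) (at 0)"
    by (intro tendsto_inverse) auto
  have "eventually (\<lambda>w. inverse (sinh w / w) = cosech w) (at 0)"
    by (auto simp: eventually_at_filter cosech_def)
  from Lim_transform_eventually[OF lim this] have "(cosech \<longlongrightarrow> 1) (at 0)"
    by simp
  then show "(cosech \<longlongrightarrow> cosech z) (at z within strip)" if "z \<in> {0}" for z
    using that by (auto simp: cosech_def intro: tendsto_within_subset)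
  have "(\<lambda>w. w / sinh w) holomorphic_on strip - {0}"
    by (intro holomorphic_intros sinh_holomorphic) (auto simp: strip_def sinh_Complex_nonzero)
  then show "cosech holomorphic_on strip - {0}"
    by (rule holomorphic_transform) (auto simp: cosech_def)
qed (auto simp: open_strip)

text \<open>From exp a \<ge> (1 + a/3)^3. The factor 1 + |x| will pay for |w| in w / sinh w, and 1 +
  x^2 for an integrable weight on the shifted line.\<close>

lemma cubic_le_cosh: "(1 + x\<^sup>2) * (1 + \<bar>x\<bar>) \<le> 54 * cosh (x::real)"
proof -
  define a where "a = \<bar>x\<bar>"
  have a0: "0 \<le> a" by (simp add: a_def)
  have "(1 + a/3)^3 \<le> exp (a/3) ^ 3" using a0 exp_ge_add_one_self[of "a/3"] by (intro power_mono) auto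
  also have "exp (a/3) ^ 3 = exp a" by (simp flip: exp_of_nat_mult)
  finally have e: "1 + a + a^2/3 + a^3/27 \<le> exp a"
    by (simp add: power2_eq_square power3_eq_cube field_simps)
  have "exp a \<le> 2 * cosh a" by (simp add: cosh_def)
  also have "cosh a = cosh x" by (simp add: a_def)
  finally have "27 + 27 * a + 9 * a^2 + a^3 \<le> 54 * cosh x" using e by simp
  moreover have "(1 + x\<^sup>2) * (1 + \<bar>x\<bar>) = 1 + a + a^2 + a^3"
    by (simp add: a_def power2_eq_square power3_eq_cube algebra_simps)
  moreover have "0 \<le> a^2" by simp
  ultimately show ?thesis using a0 by linarith
qed

text \<open>Since sin 1 \<ge> sin (pi/6) = 1/2, |sinh w| is at least cosh v / 2 on this line; 108 is
  twice the constant of \<open>cubic_le_cosh\<close>.\<close>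

lemma norm_cosech_shifted: "cmod (cosech (Complex v 1)) \<le> 108 / (1 + v\<^sup>2)"
proof -
  have ne: "Complex v 1 \<noteq> 0" by (simp add: complex_eq_iff)
  have "pi/6 \<le> 1" using pi_less_4 by simp
  then have "sin (pi/6) \<le> sin 1" using pi_gt3 by (intro sin_monotone_2pi_le) auto
  then have s: "1/2 \<le> sin (1::real)" by (simp add: sin_30)
  have "(cosh v / 2)\<^sup>2 \<le> (sinh v)\<^sup>2 + (sin 1)\<^sup>2"
  proof -
    have "(1/2)^2 \<le> (sin (1::real))^2" using s by (intro power_mono) auto
    then show ?thesis
      using zero_le_power2[of "sinh v"] unfolding power_divide cosh_square_eq
      by (simp add: power2_eq_square del: zero_le_square zero_le_mult_iff)
  qed
  then have "(cosh v / 2)\<^sup>2 \<le> (cmod (sinh (Complex v 1)))\<^sup>2" by (simp add: cmod_sinh_Complex)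
  then have sh: "cosh v / 2 \<le> cmod (sinh (Complex v 1))" by (rule power2_le_imp_le) simp
  have w: "cmod (Complex v 1) \<le> 1 + \<bar>v\<bar>"
    using cmod_le[of "Complex v 1"] by simp
  have "cmod (cosech (Complex v 1)) \<le> (1 + \<bar>v\<bar>) / (cosh v / 2)"
    unfolding cosech_def if_not_P[OF ne] norm_divide using sh w by (intro frac_le) auto
  also have "\<dots> \<le> 108 / (1 + v\<^sup>2)"
  proof -
    have p: "0 < 1 + v\<^sup>2" by (simp add: add_pos_nonneg)
    show ?thesis using cubic_le_cosh[of v] p
      by (simp add: field_simps)
  qed
  finally show ?thesis .
qed

text \<open>Passes from truncated to full integrals without an integrability proof: if the integrand
  is not integrable, its Bochner integral is 0 by convention and \<open>0 \<le> B\<close> gives the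
  bound.\<close>

lemma abs_set_lebesgue_integral_le_limit:
  fixes g :: "real \<Rightarrow> real"
  assumes A: "\<And>n. A n \<in> sets lborel" "incseq A"
    and I: "\<And>n. \<bar>LINT x:A n|lborel. g x\<bar> \<le> B + e n" and e: "e \<longlonglongrightarrow> 0" and B: "0 \<le> B"
  shows "\<bar>LINT x:(\<Union>n. A n)|lborel. g x\<bar> \<le> B"
proof (cases "set_integrable lborel (\<Union>n. A n) g")
  case True
  have "(\<lambda>n. LINT x:A n|lborel. g x) \<longlonglongrightarrow> (LINT x:(\<Union>n. A n)|lborel. g x)"
    by (rule set_integral_cont_up[OF A True])
  then have "(\<lambda>n. \<bar>LINT x:A n|lborel. g x\<bar>) \<longlonglongrightarrow> \<bar>LINT x:(\<Union>n. A n)|lborel. g x\<bar>"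
    by (rule tendsto_rabs)
  moreover have "(\<lambda>n. B + e n) \<longlonglongrightarrow> B + 0" by (intro tendsto_intros e)
  ultimately show ?thesis using I by (intro LIMSEQ_le[of _ _ _ B]) auto
next
  case False
  then show ?thesis using B
    by (simp add: set_lebesgue_integral_def set_integrable_def not_integrable_integral_eq)
qed

text \<open>The Mehler integrand after the substitution v = 4 l t, with \<open>\<rho>\<close> =
  (|x|^2 + |y|^2) / (4 t) and \<open>\<theta>\<close> = |tau| / (4 t). The cosine is replaced by an
  exponential because the latter shrinks to size exp(-\<open>\<theta>\<close>) at height 1; the real
  part recovers the cosine on the real axis.\<close>

definition heat_integrand :: "nat \<Rightarrow> real \<Rightarrow> real \<Rightarrow> complex \<Rightarrow> complex" where
  "heat_integrand N \<rho> \<theta> w =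
     exp (\<i> * of_real \<theta> * w) * cosech w ^ N * exp (- of_real \<rho> * (cosech w * cosh w))"

lemma norm_heat_integrand_le:
  assumes "0 \<le> \<rho>" "0 \<le> y" "y \<le> 1" "Complex v y \<noteq> 0"
  shows "cmod (heat_integrand N \<rho> \<theta> (Complex v y)) \<le> exp (- \<theta> * y - \<rho> / 2) * cmod (cosech (Complex v y)) ^ N"
proof -
  let ?w = "Complex v y"
  have "1/2 \<le> Re (cosech ?w * cosh ?w)"
    using Re_coth_ge[of y v] assms by (simp add: cosech_def)
  then have "exp (- \<rho> * Re (cosech ?w * cosh ?w)) \<le> exp (- \<rho> / 2)"
    using mult_left_mono[of "1/2" "Re (cosech ?w * cosh ?w)" \<rho>] assms by simp
  moreover have "cmod (heat_integrand N \<rho> \<theta> ?w) =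
      exp (- \<theta> * y) * cmod (cosech ?w) ^ N * exp (- \<rho> * Re (cosech ?w * cosh ?w))"
    unfolding heat_integrand_def norm_mult norm_power norm_exp_eq_Re by simp
  moreover have "exp (- \<theta> * y - \<rho> / 2) = exp (- \<theta> * y) * exp (- \<rho> / 2)"
    by (simp flip: exp_add)
  ultimately show ?thesis
    by (simp add: mult_left_mono mult_ac)
qed

text \<open>The vertical sides of the rectangle vanish in the limit. Once |w / sinh w| \<le> 1, one
  of the N factors is kept and the others are dropped.\<close>

lemma norm_heat_integrand_side:
  assumes "0 \<le> \<rho>" "0 \<le> \<theta>" "0 \<le> y" "y \<le> 1" "\<bar>v\<bar> = a" "0 < a" "1 \<le> N" "(a + 1) / sinh a \<le> 1"
  shows "cmod (heat_integrand N \<rho> \<theta> (Complex v y)) \<le> (a + 1) / sinh a"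
proof -
  have ne: "Complex v y \<noteq> 0" using assms by (auto simp: complex_eq_iff)
  have "(sinh v)\<^sup>2 = (sinh a)\<^sup>2" using assms by (auto simp: abs_if split: if_splits)
  then have "(sinh a)\<^sup>2 \<le> (cmod (sinh (Complex v y)))\<^sup>2" by (simp add: cmod_sinh_Complex)
  then have s: "sinh a \<le> cmod (sinh (Complex v y))" by (rule power2_le_imp_le) simp
  have w: "cmod (Complex v y) \<le> a + 1" using cmod_le[of "Complex v y"] assms by simp
  have c: "cmod (cosech (Complex v y)) \<le> (a + 1) / sinh a"
    using ne s w assms by (auto simp: cosech_def norm_divide intro!: frac_le)
  have "cmod (heat_integrand N \<rho> \<theta> (Complex v y)) \<le> exp (- \<theta> * y - \<rho> / 2) * cmod (cosech (Complex v y)) ^ N"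
    by (rule norm_heat_integrand_le) (use assms ne in auto)
  also have "\<dots> \<le> 1 * cmod (cosech (Complex v y)) ^ 1"
  proof (intro mult_mono power_decreasing)
    have "0 \<le> \<theta> * y" using assms by simp
    then have "- \<theta> * y - \<rho> / 2 \<le> 0" using assms(1) unfolding mult_minus_left by linarith
    then show "exp (- \<theta> * y - \<rho> / 2) \<le> 1" by simp
    show "cmod (cosech (Complex v y)) \<le> 1" using c assms(8) by linarith
  qed (use assms in auto)
  finally show ?thesis using c by simp
qed

lemma heat_integrand_holomorphic: "heat_integrand N \<rho> \<theta> holomorphic_on strip"
  unfolding heat_integrand_def by (intro holomorphic_intros cosech_holomorphic cosh_holomorphic)

text \<open>Moving the line of integration up to Im w = 1 gains exp(-\<open>\<theta>\<close>), the
  decay in tau that is hidden by oscillation on the real axis. The constant pi is the integral of 1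
  / (1 + v^2).\<close>

lemma heat_integral_bound:
  fixes \<rho> \<theta> :: real
  assumes "0 \<le> \<rho>" "0 \<le> \<theta>" "1 \<le> N"
  shows "\<bar>LINT v|lborel. cos (v * \<theta>) * (v / sinh v) ^ N * exp (- \<rho> * (v * cosh v / sinh v))\<bar>
           \<le> 108 ^ N * pi * exp (- \<theta> - \<rho> / 2)"
proof -
  let ?f = "heat_integrand N \<rho> \<theta>"
  define g where "g v = Re (?f (of_real v))" for v
  define B where "B = 108 ^ N * pi * exp (- \<theta> - \<rho> / 2)"
  define e where "e a = 2 * ((a + 1) / sinh a)" for a :: real
  \<comment> \<open>A primitive on the convex strip plays the role of Cauchy's theorem for the
    rectangle: each edge integral is a difference of values of \<open>F\<close> at two
    corners.\<close>
  obtain F where F: "\<And>w. w \<in> strip \<Longrightarrow> (F has_field_derivative ?f w) (at w)"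
    using holomorphic_convex_primitive'[OF convex_strip open_strip heat_integrand_holomorphic, of N \<rho> \<theta>]
    by (metis at_within_open open_strip)
  have side: "cmod (F (Complex v 1) - F (Complex v 0)) \<le> (a + 1) / sinh a"
    if "\<bar>v\<bar> = a" "0 < a" "(a + 1) / sinh a \<le> 1" for v a
  proof -
    let ?S = "closed_segment (Complex v 0) (Complex v 1)"
    have S: "\<exists>y. w = Complex v y \<and> 0 \<le> y \<and> y \<le> 1" if "w \<in> ?S" for w
      using that by (auto simp: closed_segment_def complex_eq_iff algebra_simps intro!: exI[of _ "Im w"])
    have "cmod (F (Complex v 1) - F (Complex v 0)) \<le> (a + 1) / sinh a * cmod (Complex v 1 - Complex v 0)"
    proof (rule field_differentiable_bound[where S = ?S and f' = ?f])
      fix w assume "w \<in> ?S"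
      then obtain y where y: "w = Complex v y" "0 \<le> y" "y \<le> 1" using S by blast
      show "(F has_field_derivative ?f w) (at w within ?S)"
        by (rule has_field_derivative_at_within[OF F]) (use y in \<open>auto simp: strip_def\<close>)
      show "cmod (?f w) \<le> (a + 1) / sinh a"
        unfolding y by (rule norm_heat_integrand_side) (use y that assms in auto)
    qed auto
    also have "cmod (Complex v 1 - Complex v 0) = 1" by (simp add: cmod_def)
    finally show ?thesis by simp
  qed
  have top: "cmod (F (Complex a 1) - F (Complex (- a) 1)) \<le> B" if a: "0 < a" for a
  proof -
    let ?K = "108 ^ N * exp (- \<theta> - \<rho> / 2)"
    have der: "((\<lambda>v. F (Complex v 1)) has_vector_derivative ?f (Complex v 1)) (at v)" for v
    proof -
      have "((\<lambda>v. Complex v 1) has_vector_derivative 1) (at v)"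
        unfolding Complex_eq by (auto intro!: derivative_eq_intros)
      from field_vector_diff_chain_at[OF this F[of "Complex v 1"]] show ?thesis
        by (simp add: strip_def o_def)
    qed
    \<comment> \<open>The difference along the top edge is compared with a primitive of the
      majorant, which is a multiple of arctan, so the bound is uniform in \<open>a\<close>.\<close>
    have "cmod (F (Complex a 1) - F (Complex (- a) 1)) \<le> ?K * arctan a - ?K * arctan (- a)"
    proof (rule differentiable_bound_general[where f' = "\<lambda>v. ?f (Complex v 1)" and \<phi>' = "\<lambda>v. ?K * inverse (1 + v\<^sup>2)"])
      show "continuous_on {- a..a} (\<lambda>v. F (Complex v 1))"
        by (intro continuous_at_imp_continuous_on ballI has_vector_derivative_continuous[OF der])
      show "((\<lambda>v. ?K * arctan v) has_vector_derivative ?K * inverse (1 + v\<^sup>2)) (at v)" for v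
        by (rule has_real_derivative_iff_has_vector_derivative[THEN iffD1])
           (auto intro!: derivative_eq_intros)
      show "cmod (?f (Complex v 1)) \<le> ?K * inverse (1 + v\<^sup>2)" for v
      proof -
        have "cmod (?f (Complex v 1)) \<le> exp (- \<theta> * 1 - \<rho> / 2) * cmod (cosech (Complex v 1)) ^ N"
          by (rule norm_heat_integrand_le) (use assms in \<open>auto simp: complex_eq_iff\<close>)
        also have "cmod (cosech (Complex v 1)) ^ N \<le> (108 / (1 + v\<^sup>2)) ^ N"
          by (intro power_mono norm_cosech_shifted) auto
        also have "\<dots> \<le> 108 ^ N / (1 + v\<^sup>2)"
          unfolding power_divide using assms power_increasing[of 1 N "1 + v\<^sup>2"]
          by (intro divide_left_mono mult_pos_pos zero_less_power add_pos_nonneg) auto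
        finally show ?thesis by (simp add: field_simps)
      qed
    qed (use a der in \<open>auto intro!: continuous_intros\<close>)
    also have "\<dots> = ?K * (2 * arctan a)" by (simp add: arctan_minus)
    also have "\<dots> \<le> ?K * pi" using arctan_ubound[of a] by (intro mult_left_mono) auto
    finally show ?thesis by (simp add: B_def mult_ac)
  qed
  have fin: "\<bar>LINT v:{- a..a}|lborel. g v\<bar> \<le> B + e a" if a: "0 < a" "(a + 1) / sinh a \<le> 1" for a
  proof -
    have der: "((\<lambda>v. Re (F (of_real v))) has_vector_derivative g v) (at v within X)" for v X
    proof -
      have "((\<lambda>v. of_real v :: complex) has_vector_derivative 1) (at v)"
        by (auto intro!: derivative_eq_intros)
      from field_vector_diff_chain_at[OF this F[of "of_real v"]]
      have "((\<lambda>v. F (of_real v)) has_vector_derivative ?f (of_real v)) (at v)"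
        by (simp add: strip_def o_def)
      from bounded_linear.has_vector_derivative[OF bounded_linear_Re this]
      show ?thesis unfolding g_def by (rule has_vector_derivative_at_within)
    qed
    have "continuous_on UNIV (\<lambda>v. ?f (of_real v))"
      by (rule continuous_on_compose2[OF holomorphic_on_imp_continuous_on[OF heat_integrand_holomorphic]])
         (auto simp: strip_def intro!: continuous_intros)
    then have cont: "continuous_on {- a..a} g"
      unfolding g_def by (intro continuous_intros) (rule continuous_on_subset, auto)
    have "(LINT v:{- a..a}|lborel. g v) = Re (F (of_real a)) - Re (F (of_real (- a)))"
      unfolding set_lebesgue_integral_def
      by (rule integral_FTC_atLeastAtMost) (use a der cont in auto)
    also have "\<dots> = Re (F (Complex a 0) - F (Complex (- a) 0))"
      by (simp add: complex_of_real_def)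
    also have "\<bar>\<dots>\<bar> \<le> cmod (F (Complex a 0) - F (Complex (- a) 0))" by (rule abs_Re_le_cmod)
    \<comment> \<open>The bottom edge is replaced by the other three edges.\<close>
    also have "\<dots> = cmod ((F (Complex a 1) - F (Complex (- a) 1)) - (F (Complex a 1) - F (Complex a 0))
        + (F (Complex (- a) 1) - F (Complex (- a) 0)))"
      by (simp add: algebra_simps)
    also have "\<dots> \<le> B + (a + 1) / sinh a + (a + 1) / sinh a"
      using top[of a] side[of a a] side[of "- a" a] a
        norm_triangle_ineq4[of "F (Complex a 1) - F (Complex (- a) 1)" "F (Complex a 1) - F (Complex a 0)"]
      by (intro norm_triangle_le add_mono) auto
    finally show ?thesis by (simp add: e_def)
  qed
  have "((\<lambda>a::real. (a + 1) / sinh a) \<longlongrightarrow> 0) at_top" by real_asymp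
  then have lim: "((\<lambda>n. (real n + 1) / sinh (real n)) \<longlonglongrightarrow> 0)"
    by (rule filterlim_compose[OF _ filterlim_real_sequentially])
  then have "eventually (\<lambda>n. (real n + 1) / sinh (real n) < 1) sequentially"
    by (rule order_tendstoD) simp
  then obtain n0 where n0: "\<And>n. n \<ge> n0 \<Longrightarrow> (real n + 1) / sinh (real n) < 1"
    by (auto simp: eventually_sequentially)
  let ?A = "\<lambda>n. {- real (Suc (n + n0))..real (Suc (n + n0))}"
  have "\<bar>LINT v:(\<Union>n. ?A n)|lborel. g v\<bar> \<le> B"
  proof (rule abs_set_lebesgue_integral_le_limit[where e = "\<lambda>n. e (real (Suc (n + n0)))"])
    show "\<bar>LINT v:?A n|lborel. g v\<bar> \<le> B + e (real (Suc (n + n0)))" for n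
      by (rule fin) (use n0[of "Suc (n + n0)"] in auto)
    have "(\<lambda>n. 2 * ((real (n + Suc n0) + 1) / sinh (real (n + Suc n0)))) \<longlonglongrightarrow> 2 * 0"
      by (intro tendsto_mult tendsto_const LIMSEQ_ignore_initial_segment[OF lim])
    then show "(\<lambda>n. e (real (Suc (n + n0)))) \<longlonglongrightarrow> 0" by (simp add: e_def)
  qed (auto simp: incseq_def B_def)
  moreover have "(\<Union>n. ?A n) = UNIV"
  proof (intro set_eqI iffI UNIV_I)
    fix x :: real
    obtain n where "\<bar>x\<bar> \<le> real n" using real_arch_simple by blast
    then show "x \<in> (\<Union>n. ?A n)" by (intro UN_I[of n]) auto
  qed
  moreover have "(LINT v|lborel. cos (v * \<theta>) * (v / sinh v) ^ N * exp (- \<rho> * (v * cosh v / sinh v)))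
      = (LINT v|lborel. g v)"
  proof (rule integral_cong_AE)
    have "continuous_on UNIV (\<lambda>v. ?f (of_real v))"
      by (rule continuous_on_compose2[OF holomorphic_on_imp_continuous_on[OF heat_integrand_holomorphic]])
         (auto simp: strip_def intro!: continuous_intros)
    then have "continuous_on UNIV g" unfolding g_def by (intro continuous_intros)
    then show "g \<in> borel_measurable lborel" using borel_measurable_continuous_onI by simp
    \<comment> \<open>At v = 0 the formula reads 0/0 = 0, whereas \<open>cosech 0\<close> is 1; the
      integrands agree off this null set.\<close>
    have "AE v in lborel. v \<noteq> (0::real)" by (rule AE_lborel_singleton)
    then show "AE v in lborel. cos (v * \<theta>) * (v / sinh v) ^ N * exp (- \<rho> * (v * cosh v / sinh v)) = g v"
    proof (rule AE_mp, intro AE_I2 impI)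
      fix v :: real assume "v \<noteq> 0"
      then have c: "cosech (of_real v) = of_real (v / sinh v)"
        by (simp add: cosech_def sinh_complex_of_real)
      have "?f (of_real v) = exp (\<i> * of_real (\<theta> * v)) * of_real ((v / sinh v) ^ N * exp (- \<rho> * (v * cosh v / sinh v)))"
        unfolding heat_integrand_def c
        by (simp add: cosh_complex_of_real mult.assoc flip: exp_of_real)
      then show "cos (v * \<theta>) * (v / sinh v) ^ N * exp (- \<rho> * (v * cosh v / sinh v)) = g v"
        unfolding g_def by (simp add: Re_exp mult_ac)
    qed
  qed (measurable)
  ultimately show ?thesis unfolding B_def set_lebesgue_integral_def by simp
qed

lemma hnorm_square_le: "(hnorm (x, y, \<tau>))\<^sup>2 \<le> (norm x)\<^sup>2 + (norm y)\<^sup>2 + \<bar>\<tau>\<bar>"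
proof -
  let ?Z = "(norm x)\<^sup>2 + (norm y)\<^sup>2"
  have "(hnorm (x, y, \<tau>))\<^sup>2 = (?Z\<^sup>2 + \<tau>\<^sup>2) powr (1/2)"
    by (simp add: hnorm_def powr_powr flip: powr_numeral)
  also have "\<dots> = sqrt (?Z\<^sup>2 + \<tau>\<^sup>2)" by (intro powr_half_sqrt) simp
  also have "\<dots> \<le> \<bar>?Z\<bar> + \<bar>\<tau>\<bar>" by (rule sqrt_sum_squares_le_sum_abs)
  finally show ?thesis by simp
qed

text \<open>Rescaling l = v / (4 t) contributes one factor 1/t from the measure and N from the
  integrand, together t^(-(N+1)) = t^(-Q/2).\<close>

lemma heat_kernel_bound:
  obtains C where "0 < C"
    "\<And>(\<eta> :: 'n::finite heis) t. 0 < t \<Longrightarrow>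
       \<bar>heat_kernel \<eta> t\<bar> \<le> C * t powr (- (hdim TYPE('n) / 2)) * exp (- (hnorm \<eta>)\<^sup>2 / (8 * t))"
proof -
  define N where "N = CARD('n)"
  have N: "1 \<le> N" by (simp add: N_def Suc_leI)
  define C where "C = 1 / (2 * pi) * (1/4) * (1 / (4 * pi)) ^ N * (108 ^ N * pi)"
  show thesis
  proof (rule that[of C])
    show "0 < C" by (simp add: C_def)
    fix \<eta> :: "'n heis" and t :: real assume t: "0 < t"
    obtain x y \<tau> where \<eta>: "\<eta> = (x, y, \<tau>)" by (cases \<eta>) auto
    define Z where "Z = (norm x)\<^sup>2 + (norm y)\<^sup>2"
    have Z: "0 \<le> Z" by (simp add: Z_def)
    define \<rho> \<theta> where "\<rho> = Z / (4 * t)" and "\<theta> = \<bar>\<tau>\<bar> / (4 * t)"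
    define P where "P = 1 / (2 * pi) * (1 / (4 * t)) * (1 / (4 * pi * t)) ^ N"
    have P: "0 \<le> P" using t by (simp add: P_def)
    let ?h = "\<lambda>l. cos (l * \<tau>) * (l / (pi * sinh (4 * l * t))) ^ N
        * exp (- (l * cosh (4 * l * t) / sinh (4 * l * t)) * Z)"
    let ?g = "\<lambda>v. cos (v * \<theta>) * (v / sinh v) ^ N * exp (- \<rho> * (v * cosh v / sinh v))"
    have "?h (0 + (1 / (4 * t)) * v) = (1 / (4 * pi * t)) ^ N * ?g v" for v
    proof -
      have 1: "4 * (1 / (4 * t) * v) * t = v" using t by simp
      have 2: "cos (1 / (4 * t) * v * \<tau>) = cos (v * \<theta>)"
        by (cases "0 \<le> \<tau>") (auto simp: \<theta>_def mult_ac)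
      have 3: "1 / (4 * t) * v / (pi * sinh v) = 1 / (4 * pi * t) * (v / sinh v)"
        by (simp add: mult_ac)
      have 4: "- (1 / (4 * t) * v * cosh v / sinh v) * Z = - \<rho> * (v * cosh v / sinh v)"
        by (simp add: \<rho>_def mult_ac)
      show ?thesis
        unfolding add_0 1 2 3 4 power_mult_distrib by (simp only: mult.assoc mult.left_commute)
    qed
    then have "(LINT l|lborel. ?h l) = 1 / (4 * t) * (LINT v|lborel. (1 / (4 * pi * t)) ^ N * ?g v)"
      using lborel_integral_real_affine[of "1 / (4 * t)" ?h 0] t by simp
    also have "\<dots> = 1 / (4 * t) * ((1 / (4 * pi * t)) ^ N * (LINT v|lborel. ?g v))" by simp
    finally have "heat_kernel \<eta> t = P * (LINT v|lborel. ?g v)"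
      unfolding heat_kernel_def \<eta> prod.case N_def[symmetric] Z_def[symmetric] P_def by (simp only: mult.assoc)
    then have "\<bar>heat_kernel \<eta> t\<bar> = P * \<bar>LINT v|lborel. ?g v\<bar>"
      using P by (simp only: abs_mult abs_of_nonneg)
    also have "\<dots> \<le> P * (108 ^ N * pi * exp (- \<theta> - \<rho> / 2))"
      using t Z N P by (intro mult_left_mono heat_integral_bound) (auto simp: \<rho>_def \<theta>_def)
    also have "\<dots> = C * (1 / t) ^ (N + 1) * exp (- \<theta> - \<rho> / 2)"
    proof -
      have 1: "(1 / (4 * pi * t)) ^ N = (1 / (4 * pi)) ^ N * (1 / t) ^ N"
        by (simp flip: power_mult_distrib)
      have 2: "1 / (4 * t) = 1 / 4 * (1 / t)" by simp
      show ?thesis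
        unfolding C_def P_def 1 2 power_add power_one_right by (simp only: mult.assoc mult.left_commute mult.commute)
    qed
    also have "(1 / t) ^ (N + 1) = t powr (- (hdim TYPE('n) / 2))"
    proof -
      have "hdim TYPE('n) / 2 = real (N + 1)" by (simp add: hdim_def N_def)
      then show ?thesis
        by (simp only: powr_minus powr_realpow[OF t] power_divide power_one inverse_eq_divide)
    qed
    \<comment> \<open>Here \<open>\<theta>\<close> + \<open>\<rho>\<close>/2 = (|x|^2 + |y|^2 + 2
      |tau|) / (8 t), which is the origin of the 8 in the Gaussian.\<close>
    also have "exp (- \<theta> - \<rho> / 2) \<le> exp (- (hnorm \<eta>)\<^sup>2 / (8 * t))"
    proof -
      have "(hnorm \<eta>)\<^sup>2 \<le> Z + \<bar>\<tau>\<bar>" using hnorm_square_le[of x y \<tau>] by (simp add: \<eta> Z_def)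
      then have "(hnorm \<eta>)\<^sup>2 / (8 * t) \<le> (Z + 2 * \<bar>\<tau>\<bar>) / (8 * t)"
        using t by (intro divide_right_mono) auto
      also have "\<dots> = \<theta> + \<rho> / 2" using t by (simp add: \<rho>_def \<theta>_def field_simps)
      finally show ?thesis by simp
    qed
    finally show "\<bar>heat_kernel \<eta> t\<bar> \<le> C * t powr (- (hdim TYPE('n) / 2)) * exp (- (hnorm \<eta>)\<^sup>2 / (8 * t))"
      using \<open>0 < C\<close> by (simp add: mult_left_mono)
  qed
qed

section \<open>Decay of the stable density\<close>

text \<open>The inverse Laplace integrand exp(s z - t z^sigma) dz in the coordinate z = exp v; the
  summand v in the exponent is the Jacobian. In this coordinate z^sigma has no branch cut and the
  integrand is entire.\<close>

definition hankel_integrand :: "real \<Rightarrow> real \<Rightarrow> real \<Rightarrow> complex \<Rightarrow> complex" where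
  "hankel_integrand \<sigma> t s v = exp (of_real s * exp v - of_real t * exp (of_real \<sigma> * v) + v)"

lemma norm_hankel_integrand:
  "cmod (hankel_integrand \<sigma> t s (Complex x y)) = exp (s * exp x * cos y - t * exp (\<sigma> * x) * cos (\<sigma> * y) + x)"
  unfolding hankel_integrand_def norm_exp_eq_Re by (simp add: Re_exp)

lemma norm_hankel_integrand_ln:
  assumes "0 < r"
  shows "cmod (hankel_integrand \<sigma> t s (Complex (ln r) y)) = r * exp (s * r * cos y - t * r powr \<sigma> * cos (\<sigma> * y))"
  using assms unfolding norm_hankel_integrand by (simp add: powr_def exp_add)

text \<open>On Im v = pi one has z = -u, the upper side of the cut, and the imaginary part is
  Pollard's integrand. Division by u converts dv into du.\<close>

lemma Im_hankel_integrand_top: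
  assumes "0 < u"
  shows "Im (hankel_integrand \<sigma> t s (Complex (ln u) pi)) / u =
     exp (- s * u) * exp (- t * u powr \<sigma> * cos (pi * \<sigma>)) * sin (t * u powr \<sigma> * sin (pi * \<sigma>))"
proof -
  have "Im (hankel_integrand \<sigma> t s (Complex (ln u) pi))
     = exp (- (s * u) - t * u powr \<sigma> * cos (pi * \<sigma>) + ln u) * sin (pi - t * u powr \<sigma> * sin (pi * \<sigma>))"
    using assms unfolding hankel_integrand_def
    by (simp add: Im_exp Re_exp powr_def mult_ac add_ac del: sin_pi_minus)
  also have "\<dots> = u * (exp (- (s * u)) * exp (- (t * u powr \<sigma> * cos (pi * \<sigma>)))) * sin (t * u powr \<sigma> * sin (pi * \<sigma>))"
    using assms by (simp add: exp_add exp_diff exp_minus divide_inverse)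
  finally show ?thesis using assms by simp
qed

lemma hankel_integrand_holomorphic: "hankel_integrand \<sigma> t s holomorphic_on S"
  unfolding hankel_integrand_def by (intro holomorphic_intros)

text \<open>The angle is chosen so that \<open>\<sigma> * \<theta>\<close> = pi -
  \<open>\<theta>\<close>. Then exp(s z) and exp(-t z^sigma) both decay along the ray, with the same
  constant -cos \<open>\<theta>\<close>.\<close>

lemma cos_hankel_angle:
  assumes "0 < \<sigma>" "\<sigma> < 1"
  defines "\<theta> \<equiv> pi / (1 + \<sigma>)"
  shows "0 < - cos \<theta>" "cos (\<sigma> * \<theta>) = - cos \<theta>" "pi/2 < \<theta>" "\<theta> < pi"
proof -
  show 1: "pi/2 < \<theta>" "\<theta> < pi" using assms by (simp_all add: \<theta>_def field_simps)
  have "\<sigma> * \<theta> = pi - \<theta>" using assms by (simp add: \<theta>_def field_simps)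
  then show 2: "cos (\<sigma> * \<theta>) = - cos \<theta>" by (simp add: cos_pi_minus)
  have "0 < cos (pi - \<theta>)" using 1 by (intro cos_gt_zero) auto
  then show "0 < - cos \<theta>" by (simp add: cos_pi_minus)
qed

lemma has_vector_derivative_along_log:
  assumes "(F has_field_derivative D) (at (Complex (ln r) y))" "0 < r"
  shows "((\<lambda>r. F (Complex (ln r) y)) has_vector_derivative D / of_real r) (at r)"
proof -
  have "((\<lambda>r. Complex (ln r) y) has_vector_derivative of_real (1 / r)) (at r)"
    unfolding Complex_eq has_vector_derivative_def using assms(2)
    by (auto intro!: derivative_eq_intros simp: scaleR_conv_of_real divide_inverse)
  from field_vector_diff_chain_at[OF this assms(1)] show ?thesis
    by (simp add: o_def)
qed

text \<open>The contour of Pollard's formula is the upper side of the negative half-axis. In the logarithmic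
  coordinate it is the line Im v = pi, which is deformed to the real line up to ln (1/s), where
  the integrand is real and so does not contribute, then the arc of radius 1/s, and then the ray of
  angle pi/(1 + sigma), on which both exponents are decreasing.\<close>
lemma stable_density_decay:
  assumes "0 < \<sigma>" "\<sigma> < 1" "0 < t" "0 < s"
  defines "\<kappa> \<equiv> - cos (pi / (1 + \<sigma>))"
  shows "\<bar>stable_density \<sigma> t s\<bar> \<le> (1 / \<kappa> + exp 1 * pi) / pi * (exp (- \<kappa> * t * s powr (- \<sigma>)) / s)"
proof -
  define \<theta> where "\<theta> = pi / (1 + \<sigma>)"
  note ang = cos_hankel_angle[OF assms(1,2), folded \<theta>_def]
  have \<kappa>: "0 < \<kappa>" "cos \<theta> = - \<kappa>" "cos (\<sigma> * \<theta>) = \<kappa>" using ang by (auto simp: \<kappa>_def \<theta>_def)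
  let ?E = "hankel_integrand \<sigma> t s"
  define a where "a = 1 / s"
  have a: "0 < a" "s * a = 1" using assms by (auto simp: a_def)
  have as: "a powr \<sigma> = s powr (- \<sigma>)" using assms by (simp add: a_def powr_divide powr_minus inverse_eq_divide)
  define P where "P = exp (- \<kappa> * t * s powr (- \<sigma>))"
  define B where "B = (1 / \<kappa> + exp 1 * pi) * (P / s)"
  define e where "e m = pi * (m * exp (t * m powr \<sigma> - \<kappa> * s * m)) + pi * (exp (s + t) * (1 / m))" for m
  obtain F where F: "\<And>w. (F has_field_derivative ?E w) (at w)"
    using holomorphic_convex_primitive'[OF convex_UNIV open_UNIV hankel_integrand_holomorphic, of \<sigma> t s] by auto
  have vert: "cmod (F (Complex x y2) - F (Complex x y1)) \<le> K * pi"
    if "0 \<le> y1" "y1 \<le> y2" "y2 \<le> pi" "\<And>y. y1 \<le> y \<Longrightarrow> y \<le> y2 \<Longrightarrow> cmod (?E (Complex x y)) \<le> K" for x y1 y2 K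
  proof -
    let ?S = "closed_segment (Complex x y1) (Complex x y2)"
    have K: "0 \<le> K" using that(4)[of y1] that(2) norm_ge_zero order_trans by blast
    have S: "\<exists>y. w = Complex x y \<and> y1 \<le> y \<and> y \<le> y2" if "w \<in> ?S" for w
    proof -
      from that obtain u where u: "0 \<le> u" "u \<le> 1" "w = (1 - u) *\<^sub>R Complex x y1 + u *\<^sub>R Complex x y2"
        by (auto simp: closed_segment_def)
      then have "w = Complex x (y1 + u * (y2 - y1))"
        by (simp add: complex_eq_iff algebra_simps)
      moreover have "u * (y2 - y1) \<le> 1 * (y2 - y1)" using u \<open>y1 \<le> y2\<close> by (intro mult_right_mono) auto
      ultimately show ?thesis using u \<open>y1 \<le> y2\<close> by (intro exI[of _ "y1 + u * (y2 - y1)"]) auto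
    qed
    have "cmod (F (Complex x y2) - F (Complex x y1)) \<le> K * cmod (Complex x y2 - Complex x y1)"
    proof (rule field_differentiable_bound[where S = ?S and f' = ?E])
      fix w assume "w \<in> ?S"
      then obtain y where y: "w = Complex x y" "y1 \<le> y" "y \<le> y2" using S by blast
      then show "cmod (?E w) \<le> K" using that by auto
      show "(F has_field_derivative ?E w) (at w within ?S)"
        by (rule has_field_derivative_at_within[OF F])
    qed auto
    also have "cmod (Complex x y2 - Complex x y1) = y2 - y1" using that by (simp add: cmod_def)
    also have "K * (y2 - y1) \<le> K * pi" using K that by (intro mult_left_mono) auto
    finally show ?thesis .
  qed
  \<comment> \<open>This arc joins the ray back to the cut at the large radius m. There
    exp(-\<open>\<kappa>\<close> s m) beats exp(t m^sigma) because sigma < 1, so it disappears as m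
    grows.\<close>
  have right: "cmod (F (Complex (ln m) pi) - F (Complex (ln m) \<theta>)) \<le> m * exp (t * m powr \<sigma> - \<kappa> * s * m) * pi"
    if m: "0 < m" for m
  proof (rule vert)
    fix y assume y: "\<theta> \<le> y" "y \<le> pi"
    have "cos y \<le> cos \<theta>" using y ang pi_gt3 by (intro cos_monotone_0_pi_le) auto
    then have "s * m * cos y \<le> s * m * (- \<kappa>)" using m assms \<kappa> by (intro mult_left_mono) auto
    moreover have "t * m powr \<sigma> * (- 1) \<le> t * m powr \<sigma> * cos (\<sigma> * y)"
      using assms by (intro mult_left_mono) auto
    ultimately have "s * m * cos y - t * m powr \<sigma> * cos (\<sigma> * y) \<le> t * m powr \<sigma> - \<kappa> * s * m"
      by (simp add: algebra_simps)
    then show "cmod (?E (Complex (ln m) y)) \<le> m * exp (t * m powr \<sigma> - \<kappa> * s * m)"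
      using m by (simp add: norm_hankel_integrand_ln)
  qed (use ang pi_gt3 in auto)
  have left: "cmod (F (Complex (ln (1 / m)) pi) - F (Complex (ln (1 / m)) 0)) \<le> exp (s + t) * (1 / m) * pi"
    if m: "1 \<le> m" for m
  proof (rule vert)
    fix y assume y: "0 \<le> y" "y \<le> pi"
    have m1: "1 / m \<le> 1" "0 < 1 / m" using m by auto
    then have mp: "(1 / m) powr \<sigma> \<le> 1" using assms by (intro powr_le1) auto
    have "s * (1 / m) * cos y \<le> s * 1 * 1"
    proof -
      have "s * (1 / m) * cos y \<le> s * (1 / m) * 1"
        using assms m1 by (intro mult_left_mono) auto
      also have "\<dots> \<le> s * 1 * 1" using m1 assms by (intro mult_mono) auto
      finally show ?thesis .
    qed
    moreover have "t * (1 / m) powr \<sigma> * (- cos (\<sigma> * y)) \<le> t * 1 * 1"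
    proof -
      have "t * (1 / m) powr \<sigma> * (- cos (\<sigma> * y)) \<le> t * (1 / m) powr \<sigma> * 1"
        using assms cos_ge_minus_one[of "\<sigma> * y"] by (intro mult_left_mono) (linarith, simp)
      also have "\<dots> \<le> t * 1 * 1" using mp assms by simp
      finally show ?thesis .
    qed
    ultimately have "s * (1 / m) * cos y - t * (1 / m) powr \<sigma> * cos (\<sigma> * y) \<le> s + t" by linarith
    then show "cmod (?E (Complex (ln (1 / m)) y)) \<le> exp (s + t) * (1 / m)"
      unfolding norm_hankel_integrand_ln[OF m1(2)] using m1(2) by (simp add: divide_right_mono)
  qed auto
  \<comment> \<open>At radius 1/s the first exponential is at most e, while the cosine of sigma y
    stays above its value \<open>\<kappa>\<close> at the end of the arc; this produces the factor
    \<open>P\<close>.\<close>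
  have arc: "cmod (F (Complex (ln a) \<theta>) - F (Complex (ln a) 0)) \<le> exp 1 * P / s * pi"
  proof (rule vert)
    fix y assume y: "0 \<le> y" "y \<le> \<theta>"
    have "\<sigma> * y \<le> \<sigma> * \<theta>" "0 \<le> \<sigma> * y" using y assms by (auto intro!: mult_left_mono)
    moreover have "\<sigma> * \<theta> \<le> 1 * \<theta>" using y assms by (intro mult_right_mono) auto
    ultimately have "\<sigma> * y \<le> \<sigma> * \<theta>" "\<sigma> * \<theta> \<le> pi" "0 \<le> \<sigma> * y"
      using ang(4) unfolding mult_1 by linarith+
    then have "cos (\<sigma> * \<theta>) \<le> cos (\<sigma> * y)" by (intro cos_monotone_0_pi_le) auto
    then have "t * a powr \<sigma> * \<kappa> \<le> t * a powr \<sigma> * cos (\<sigma> * y)"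
      using assms \<kappa> by (intro mult_left_mono) auto
    moreover have "s * a * cos y \<le> 1" using a by simp
    ultimately have "s * a * cos y - t * a powr \<sigma> * cos (\<sigma> * y) \<le> 1 + - \<kappa> * t * s powr (- \<sigma>)"
      by (simp add: as algebra_simps)
    then have "exp (s * a * cos y - t * a powr \<sigma> * cos (\<sigma> * y)) \<le> exp 1 * P"
      unfolding P_def exp_add[symmetric] by simp
    then show "cmod (?E (Complex (ln a) y)) \<le> exp 1 * P / s"
      unfolding norm_hankel_integrand_ln[OF a(1)] using assms by (simp add: a_def divide_right_mono)
  qed (use ang pi_gt3 in auto)
  \<comment> \<open>Along the ray r^sigma \<ge> a^sigma lets \<open>P\<close> be pulled out, and
    what remains, exp(-\<open>\<kappa>\<close> s r), integrates to at most 1 /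
    (\<open>\<kappa>\<close> s).\<close>
  have ray: "cmod (F (Complex (ln m) \<theta>) - F (Complex (ln a) \<theta>)) \<le> P / s / \<kappa>" if m: "a < m" for m
  proof -
    let ?\<phi> = "\<lambda>r. - (P / (\<kappa> * s) * exp (- \<kappa> * s * r))"
    have "cmod (F (Complex (ln m) \<theta>) - F (Complex (ln a) \<theta>)) \<le> ?\<phi> m - ?\<phi> a"
    proof (rule differentiable_bound_general[OF m, where f' = "\<lambda>r. ?E (Complex (ln r) \<theta>) / of_real r"
          and \<phi>' = "\<lambda>r. P * exp (- \<kappa> * s * r)"])
      show "continuous_on {a..m} (\<lambda>r. F (Complex (ln r) \<theta>))"
        using a by (intro continuous_at_imp_continuous_on ballI
            has_vector_derivative_continuous[OF has_vector_derivative_along_log[OF F]]) auto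
      show "continuous_on {a..m} ?\<phi>" by (intro continuous_intros)
      fix r assume r: "a < r" "r < m"
      then have r0: "0 < r" using a by simp
      show "((\<lambda>r. F (Complex (ln r) \<theta>)) has_vector_derivative ?E (Complex (ln r) \<theta>) / of_real r) (at r)"
        by (rule has_vector_derivative_along_log[OF F r0])
      show "(?\<phi> has_vector_derivative P * exp (- \<kappa> * s * r)) (at r)"
        using \<kappa> assms by (intro has_real_derivative_iff_has_vector_derivative[THEN iffD1])
          (auto intro!: derivative_eq_intros)
      have "a powr \<sigma> \<le> r powr \<sigma>" using r a assms by (intro powr_mono2) auto
      moreover have "0 \<le> t * \<kappa>" using mult_nonneg_nonneg[of t \<kappa>] \<kappa>(1) assms(3) by linarith
      ultimately have "t * \<kappa> * a powr \<sigma> \<le> t * \<kappa> * r powr \<sigma>" by (rule mult_left_mono)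
      then have "exp (s * r * cos \<theta> - t * r powr \<sigma> * cos (\<sigma> * \<theta>)) \<le> P * exp (- \<kappa> * s * r)"
        unfolding P_def exp_add[symmetric] \<kappa>(2,3) as by (simp add: algebra_simps)
      then show "cmod (?E (Complex (ln r) \<theta>) / of_real r) \<le> P * exp (- \<kappa> * s * r)"
        using r0 by (simp add: norm_divide norm_hankel_integrand_ln)
    qed
    also have "\<dots> \<le> P / (\<kappa> * s) * 1"
    proof -
      have P: "0 \<le> P / (\<kappa> * s)" using \<kappa>(1) assms(4) by (simp add: P_def del: times_divide_eq_right)
      have "exp (- \<kappa> * s * a) - exp (- \<kappa> * s * m) \<le> 1"
      proof -
        have "exp (- \<kappa> * s * a) \<le> 1"
          using mult_pos_pos[OF mult_pos_pos[OF \<kappa>(1) assms(4)] a(1)] by simp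
        then show ?thesis using exp_ge_zero[of "- \<kappa> * s * m"] by linarith
      qed
      from mult_left_mono[OF this P] show ?thesis by (simp add: right_diff_distrib)
    qed
    finally show ?thesis by (simp add: mult.commute)
  qed
  have real: "Im (F (Complex x 0)) = Im (F (Complex x' 0))" for x x'
  proof -
    have "((\<lambda>x. Im (F (of_real x))) has_vector_derivative 0) (at x)" for x
    proof -
      have "((\<lambda>v. of_real v :: complex) has_vector_derivative 1) (at x)"
        by (auto intro!: derivative_eq_intros)
      from bounded_linear.has_vector_derivative[OF bounded_linear_Im field_vector_diff_chain_at[OF this F]]
      have "((\<lambda>x. Im (F (of_real x))) has_vector_derivative Im (?E (of_real x))) (at x)"
        by (simp add: o_def)
      moreover have "?E (of_real x) = of_real (exp (s * exp x - t * exp (\<sigma> * x) + x))"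
        unfolding hankel_integrand_def by (simp flip: exp_of_real)
      ultimately show ?thesis by simp
    qed
    then have "((\<lambda>x. Im (F (of_real x))) has_derivative (\<lambda>h. 0)) (at x within UNIV)" for x
      by (simp add: has_vector_derivative_def)
    from has_derivative_zero_constant[OF convex_UNIV this] show ?thesis
      unfolding complex_of_real_def by (metis UNIV_I)
  qed
  let ?h = "\<lambda>u. exp (- s * u) * exp (- t * u powr \<sigma> * cos (pi * \<sigma>)) * sin (t * u powr \<sigma> * sin (pi * \<sigma>))"
  have fin: "\<bar>LINT u:{1/m..m}|lborel. ?h u\<bar> \<le> B + e m" if m: "1 \<le> m" "a < m" for m
  proof -
    have "(LINT u:{1/m..m}|lborel. ?h u) = Im (F (Complex (ln m) pi)) - Im (F (Complex (ln (1 / m)) pi))"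
      unfolding set_lebesgue_integral_def
    proof (rule integral_FTC_atLeastAtMost)
      show "1 / m \<le> m" using m(1) order_trans[of "1 / m" 1 m] by simp
      have m0: "0 < 1 / m" using m by simp
      fix u assume "1 / m \<le> u" "u \<le> m"
      then have u: "0 < u" using m0 by linarith
      have eq: "?h u = Im (?E (Complex (ln u) pi) / of_real u)"
        using Im_hankel_integrand_top[OF u, of \<sigma> t s] by (simp only: Im_divide_of_real)
      have "((\<lambda>u. Im (F (Complex (ln u) pi))) has_vector_derivative ?h u) (at u)"
        unfolding eq by (rule bounded_linear.has_vector_derivative[OF bounded_linear_Im has_vector_derivative_along_log[OF F u]])
      then show "((\<lambda>u. Im (F (Complex (ln u) pi))) has_vector_derivative ?h u) (at u within {1/m..m})"
        by (rule has_vector_derivative_at_within)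
    next
      have m0: "0 < 1 / m" using m by simp
      show "continuous_on {1 / m..m} ?h" using m0 by (intro continuous_intros) auto
    qed
    also have "\<dots> = Im (F (Complex (ln m) pi) - F (Complex (ln m) \<theta>) + (F (Complex (ln m) \<theta>) - F (Complex (ln a) \<theta>))
        + (F (Complex (ln a) \<theta>) - F (Complex (ln a) 0)) - (F (Complex (ln (1 / m)) pi) - F (Complex (ln (1 / m)) 0)))"
      using real[of "ln a" "ln (1/m)"] by simp
    also have "\<bar>\<dots>\<bar> \<le> cmod (F (Complex (ln m) pi) - F (Complex (ln m) \<theta>) + (F (Complex (ln m) \<theta>) - F (Complex (ln a) \<theta>))
        + (F (Complex (ln a) \<theta>) - F (Complex (ln a) 0)) - (F (Complex (ln (1 / m)) pi) - F (Complex (ln (1 / m)) 0)))"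
      by (rule abs_Im_le_cmod)
    also have "\<dots> \<le> m * exp (t * m powr \<sigma> - \<kappa> * s * m) * pi + P / s / \<kappa> + exp 1 * P / s * pi + exp (s + t) * (1 / m) * pi"
      using m by (intro norm_triangle_le norm_triangle_le_diff add_mono right ray arc left) auto
    also have "\<dots> = B + e m" by (simp add: B_def e_def algebra_simps)
    finally show ?thesis .
  qed
  have elim: "(e \<longlongrightarrow> 0) at_top"
  proof -
    have "((\<lambda>m. m * exp (t * m powr \<sigma> - \<kappa> * s * m)) \<longlongrightarrow> 0) at_top"
      using assms(1-4) \<kappa>(1) by real_asymp
    moreover have "((\<lambda>m::real. 1 / m) \<longlongrightarrow> 0) at_top" by real_asymp
    ultimately have "((\<lambda>m. pi * (m * exp (t * m powr \<sigma> - \<kappa> * s * m)) + pi * (exp (s + t) * (1 / m))) \<longlongrightarrow> pi * 0 + pi * (exp (s + t) * 0)) at_top"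
      by (intro tendsto_intros)
    then show ?thesis by (simp only: e_def[abs_def] mult_zero_right add_0_right)
  qed
  \<comment> \<open>The shift by \<open>n0\<close> puts every truncation radius beyond 1/s, as the
    ray must start at 1/s.\<close>
  obtain n0 :: nat where n0: "a < real n0" using reals_Archimedean2 by blast
  let ?m = "\<lambda>n. real (Suc (n + n0))"
  have "\<bar>LINT u:(\<Union>n. {1 / ?m n..?m n})|lborel. ?h u\<bar> \<le> B"
  proof (rule abs_set_lebesgue_integral_le_limit[where e = "\<lambda>n. e (?m n)"])
    show "\<bar>LINT u:{1 / ?m n..?m n}|lborel. ?h u\<bar> \<le> B + e (?m n)" for n
      by (rule fin) (use n0 in auto)
    have "filterlim ?m at_top sequentially"
      using filterlim_compose[OF filterlim_real_sequentially filterlim_add_const_nat_at_top[of "Suc n0"]] by simp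
    from filterlim_compose[OF elim this] show "(\<lambda>n. e (?m n)) \<longlonglongrightarrow> 0" .
    show "incseq (\<lambda>n. {1 / ?m n..?m n})"
    proof (rule incseq_SucI)
      fix n
      have "1 / ?m (Suc n) \<le> 1 / ?m n" by (intro divide_left_mono) auto
      then show "{1 / ?m n..?m n} \<subseteq> {1 / ?m (Suc n)..?m (Suc n)}" by auto
    qed
    show "0 \<le> B"
      unfolding B_def P_def using \<kappa>(1) \<open>0 < s\<close>
      by (intro mult_nonneg_nonneg add_nonneg_nonneg divide_nonneg_pos) auto
  qed auto
  moreover have "(\<Union>n. {1 / ?m n..?m n}) = {0<..}"
  proof (intro set_eqI iffI)
    fix x assume "x \<in> (\<Union>n. {1 / ?m n..?m n})"
    then obtain n where "1 / ?m n \<le> x" by auto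
    moreover have "0 < 1 / ?m n" by simp
    ultimately have "0 < x" by linarith
    then show "x \<in> {0<..}" by simp
  next
    fix x :: real assume "x \<in> {0<..}"
    then have x: "0 < x" by simp
    obtain n where n: "max x (1 / x) < real n" using reals_Archimedean2 by blast
    then have "max x (1 / x) \<le> ?m n" by simp
    then have "x \<le> ?m n" "1 / ?m n \<le> x" using x by (auto simp: field_simps)
    then show "x \<in> (\<Union>n. {1 / ?m n..?m n})" by (intro UN_I[of n]) auto
  qed
  ultimately have "\<bar>LINT u:{0<..}|lborel. ?h u\<bar> \<le> B" by simp
  then have "1 / pi * \<bar>LINT u:{0<..}|lborel. ?h u\<bar> \<le> 1 / pi * B" by (intro mult_left_mono) auto
  then show ?thesis
    unfolding stable_density_def abs_mult by (simp add: B_def P_def)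
qed

section \<open>Power bounds for the stable density\<close>

lemma abs_set_lebesgue_integral_le_nn_integral:
  fixes f :: "'a \<Rightarrow> real"
  shows "ennreal \<bar>LINT x:A|M. f x\<bar> \<le> (\<integral>\<^sup>+x\<in>A. ennreal \<bar>f x\<bar> \<partial>M)"
proof (cases "set_integrable M A f")
  case True
  have "ennreal \<bar>LINT x:A|M. f x\<bar> \<le> (\<integral>\<^sup>+x. ennreal (norm (indicator A x *\<^sub>R f x)) \<partial>M)"
    using integral_norm_bound_ennreal[OF True[unfolded set_integrable_def]]
    by (simp add: set_lebesgue_integral_def)
  also have "\<dots> = (\<integral>\<^sup>+x\<in>A. ennreal \<bar>f x\<bar> \<partial>M)"
    by (intro nn_integral_cong) (auto split: split_indicator)
  finally show ?thesis .
qed (simp add: set_lebesgue_integral_def set_integrable_def not_integrable_integral_eq)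

text \<open>For large s \<open>stable_density_decay\<close> gives only 1/s, which is not integrable.
  Here |sin x| \<le> |x| extracts the missing factor t s^(-sigma), and the possible growth of exp(-t
  u^sigma cos(pi sigma)) is absorbed by exp(-s u).\<close>

lemma stable_density_tail:
  assumes "0 < \<sigma>" "\<sigma> < 1" "0 < t" "0 < s" "t \<le> s powr \<sigma>"
  defines "K \<equiv> (2 powr (1 / (1 - \<sigma>))) powr \<sigma>"
  shows "\<bar>stable_density \<sigma> t s\<bar> \<le> 16 * exp K / pi * (t * s powr (- \<sigma>) / s)"
proof -
  \<comment> \<open>The threshold 2^(1/(1 - sigma)) is where x^sigma equals x/2; below it x^sigma is
    at most \<open>K\<close>.\<close>
  have sub: "x powr \<sigma> \<le> x / 2 + K" if x: "0 < x" for x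
  proof (cases "x \<le> 2 powr (1 / (1 - \<sigma>))")
    case True
    then have "x powr \<sigma> \<le> K" unfolding K_def using assms x by (intro powr_mono2) auto
    then show ?thesis using x by simp
  next
    case False
    then have "(2 powr (1 / (1 - \<sigma>))) powr (1 - \<sigma>) \<le> x powr (1 - \<sigma>)"
      using assms by (intro powr_mono2) auto
    then have "2 \<le> x powr (1 - \<sigma>)" using assms by (simp add: powr_powr)
    then have "2 * x powr \<sigma> \<le> x powr (1 - \<sigma>) * x powr \<sigma>" by (intro mult_right_mono) auto
    also have "\<dots> = x" using x by (simp flip: powr_add)
    finally show ?thesis using powr_ge_zero[of "2 powr (1 / (1 - \<sigma>))" \<sigma>] unfolding K_def by linarith
  qed
  have lin: "x powr \<sigma> \<le> 4 * exp (x / 4)" if x: "0 < x" for x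
  proof -
    have "x powr \<sigma> \<le> 1 + x"
    proof (cases "x \<le> 1")
      case True
      then have "x powr \<sigma> \<le> 1" using assms x by (intro powr_le1) auto
      then show ?thesis using x by simp
    next
      case False
      then have "x powr \<sigma> \<le> x powr 1" using assms by (intro powr_mono) auto
      then show ?thesis using x by simp
    qed
    also have "\<dots> \<le> 4 * (1 + x / 4)" by simp
    also have "\<dots> \<le> 4 * exp (x / 4)" by (intro mult_left_mono exp_ge_add_one_self) auto
    finally show ?thesis .
  qed
  define D where "D = t * s powr (- \<sigma>)"
  have D: "0 < D" "D \<le> 1" using assms by (auto simp: D_def powr_minus field_simps)
  let ?h = "\<lambda>u. exp (- s * u) * exp (- t * u powr \<sigma> * cos (pi * \<sigma>)) * sin (t * u powr \<sigma> * sin (pi * \<sigma>))"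
  have h: "\<bar>?h u\<bar> \<le> 4 * exp K * D * exp (- (s / 4) * u)" if u: "0 < u" for u
  proof -
    let ?x = "s * u"
    have x: "0 < ?x" using u assms by simp
    have tu: "t * u powr \<sigma> = D * ?x powr \<sigma>"
      using u assms by (simp add: D_def powr_mult powr_minus field_simps)
    have xs: "0 \<le> ?x powr \<sigma>" by simp
    have "\<bar>sin (t * u powr \<sigma> * sin (pi * \<sigma>))\<bar> \<le> \<bar>t * u powr \<sigma> * sin (pi * \<sigma>)\<bar>" by (rule abs_sin_x_le_abs_x)
    also have "\<dots> \<le> t * u powr \<sigma> * 1"
      unfolding abs_mult using assms by (intro mult_mono) auto
    also have "\<dots> \<le> D * (4 * exp (?x / 4))" unfolding mult_1_right tu using D lin[OF x] by (intro mult_left_mono) auto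
    finally have 1: "\<bar>sin (t * u powr \<sigma> * sin (pi * \<sigma>))\<bar> \<le> D * (4 * exp (?x / 4))" .
    have "- t * u powr \<sigma> * cos (pi * \<sigma>) \<le> ?x / 2 + K"
    proof -
      have "- t * u powr \<sigma> * cos (pi * \<sigma>) = t * u powr \<sigma> * (- cos (pi * \<sigma>))" by simp
      also have "\<dots> \<le> t * u powr \<sigma> * 1"
        using assms cos_ge_minus_one[of "pi * \<sigma>"] by (intro mult_left_mono) (linarith, simp)
      also have "\<dots> \<le> 1 * ?x powr \<sigma>" unfolding mult_1_right tu using D xs by (intro mult_right_mono) auto
      also have "\<dots> \<le> ?x / 2 + K" using sub[OF x] by simp
      finally show ?thesis .
    qed
    then have 2: "exp (- t * u powr \<sigma> * cos (pi * \<sigma>)) \<le> exp (?x / 2 + K)" by simp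
    have "\<bar>?h u\<bar> \<le> exp (- s * u) * exp (?x / 2 + K) * (D * (4 * exp (?x / 4)))"
      unfolding abs_mult abs_exp_cancel by (intro mult_mono 1 2) auto
    also have "\<dots> = 4 * exp K * D * exp (- s * u + ?x / 2 + ?x / 4)"
      unfolding exp_add by (simp only: mult_ac)
    \<comment> \<open>Of the decay in x = s u, one half pays for the growing exponential and one
      quarter for x^sigma; one quarter is left for integration.\<close>
    also have "- s * u + ?x / 2 + ?x / 4 = - (s / 4) * u" by (simp add: field_simps)
    finally show ?thesis .
  qed
  have s4: "0 < s / 4" using assms by simp
  have "ennreal \<bar>LINT u:{0<..}|lborel. ?h u\<bar> \<le> (\<integral>\<^sup>+u\<in>{0<..}. ennreal \<bar>?h u\<bar> \<partial>lborel)"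
    by (rule abs_set_lebesgue_integral_le_nn_integral)
  also have "\<dots> \<le> (\<integral>\<^sup>+u\<in>{0..}. ennreal (4 * exp K * D * exp (- (s / 4) * u)) \<partial>lborel)"
    using h by (intro nn_integral_mono) (auto split: split_indicator intro!: ennreal_leI)
  also have "\<dots> = ennreal (4 * exp K * D * (exp (- (s / 4) * 0) / (s / 4)))"
    using D by (intro nn_integral_has_integral_lebesgue' has_integral_mult_right
        has_integral_exp_minus_to_infinity[OF s4]) auto
  finally have "\<bar>LINT u:{0<..}|lborel. ?h u\<bar> \<le> 16 * exp K * (D / s)"
    using D assms by (subst (asm) ennreal_le_iff) auto
  then have "1 / pi * \<bar>LINT u:{0<..}|lborel. ?h u\<bar> \<le> 1 / pi * (16 * exp K * (D / s))" by (intro mult_left_mono) auto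
  then show ?thesis
    unfolding stable_density_def abs_mult by (simp add: D_def)
qed

text \<open>The inequality y \<le> exp y at y = x/k, raised to the power k.\<close>

lemma exp_minus_le_powr:
  assumes "0 < k" "0 < (x::real)"
  shows "exp (- x) \<le> k powr k * x powr (- k)"
proof -
  have "x / k \<le> exp (x / k)" using exp_ge_add_one_self[of "x / k"] by linarith
  then have "(x / k) powr k \<le> exp (x / k) powr k" using assms by (intro powr_mono2) auto
  also have "\<dots> = exp x" using assms by (simp add: exp_powr_real)
  finally have "exp (- x) \<le> inverse ((x / k) powr k)"
    using assms unfolding exp_minus by (intro le_imp_inverse_le) auto
  also have "\<dots> = k powr k * x powr (- k)"
    using assms by (simp add: powr_divide powr_minus field_simps)
  finally show ?thesis .
qed

text \<open>In terms of D = t s^(-sigma), the first bound serves small s, where D is large and any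
  negative power is available, and the second serves large s. Where D \<ge> 1 the second follows
  from the exponential decay.\<close>

lemma stable_density_bounds:
  assumes "0 < \<sigma>" "\<sigma> < 1" "0 < k"
  obtains C where "0 < C"
    "\<And>t s. 0 < t \<Longrightarrow> 0 < s \<Longrightarrow> \<bar>stable_density \<sigma> t s\<bar> \<le> C * ((t * s powr (- \<sigma>)) powr (- k) / s)"
    "\<And>t s. 0 < t \<Longrightarrow> 0 < s \<Longrightarrow> \<bar>stable_density \<sigma> t s\<bar> \<le> C * (t * s powr (- \<sigma>) / s)"
proof -
  define \<kappa> where "\<kappa> = - cos (pi / (1 + \<sigma>))"
  have \<kappa>: "0 < \<kappa>" using cos_hankel_angle[OF assms(1,2)] by (simp add: \<kappa>_def)
  define A where "A = (1 / \<kappa> + exp 1 * pi) / pi"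
  define A' where "A' = 16 * exp ((2 powr (1 / (1 - \<sigma>))) powr \<sigma>) / pi"
  have A: "0 < A" "0 < A'" using \<kappa> by (auto simp: A_def A'_def intro!: divide_pos_pos add_pos_pos)
  define C1 where "C1 = A * (k powr k * \<kappa> powr (- k))"
  have C1: "0 < C1" using A \<kappa> assms by (simp add: C1_def)
  have decay: "\<bar>stable_density \<sigma> t s\<bar> \<le> A * (exp (- (\<kappa> * (t * s powr (- \<sigma>)))) / s)" if "0 < t" "0 < s" for t s
    using stable_density_decay[OF assms(1,2) that] by (simp add: A_def \<kappa>_def mult_ac)
  show thesis
  proof (rule that[of "C1 + A + A'"])
    fix t s :: real assume ts: "0 < t" "0 < s"
    let ?D = "t * s powr (- \<sigma>)"
    have D: "0 < ?D" using ts by simp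
    have "A * (exp (- (\<kappa> * ?D)) / s) \<le> A * (k powr k * (\<kappa> * ?D) powr (- k) / s)"
      using ts A D \<kappa> assms by (intro mult_left_mono divide_right_mono exp_minus_le_powr) auto
    also have "\<dots> = C1 * (?D powr (- k) / s)"
      using \<kappa> D by (simp add: C1_def powr_mult)
    also have "\<dots> \<le> (C1 + A + A') * (?D powr (- k) / s)"
      using ts A by (intro mult_right_mono) auto
    finally show "\<bar>stable_density \<sigma> t s\<bar> \<le> (C1 + A + A') * (?D powr (- k) / s)"
      using decay[OF ts] by simp
    show "\<bar>stable_density \<sigma> t s\<bar> \<le> (C1 + A + A') * (?D / s)"
    proof (cases "t \<le> s powr \<sigma>")
      case True
      have "\<bar>stable_density \<sigma> t s\<bar> \<le> A' * (?D / s)"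
        using stable_density_tail[OF assms(1,2) ts True] by (simp add: A'_def)
      also have "\<dots> \<le> (C1 + A + A') * (?D / s)" using ts A C1 by (intro mult_right_mono) auto
      finally show ?thesis .
    next
      case False
      then have D1: "1 \<le> ?D" using ts by (simp add: powr_minus field_simps)
      have "\<bar>stable_density \<sigma> t s\<bar> \<le> A * (exp (- (\<kappa> * ?D)) / s)" by (rule decay[OF ts])
      also have "\<dots> \<le> A * (?D / s)"
      proof (intro mult_left_mono divide_right_mono)
        have "exp (- (\<kappa> * ?D)) \<le> 1" using \<kappa> D by simp
        then show "exp (- (\<kappa> * ?D)) \<le> ?D" using D1 by linarith
      qed (use ts A in auto)
      also have "\<dots> \<le> (C1 + A + A') * (?D / s)" using ts A C1 by (intro mult_right_mono) auto
      finally show ?thesis .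
    qed
  qed (use A C1 in auto)
qed

section \<open>Bound for the fractional kernel by subordination\<close>

text \<open>The integral is split at the natural scale s0 = t^(1/sigma), where both parts give the
  same power of t. At infinity the integrand is s^(-1 - sigma - q), which is why q must exceed
  -sigma.\<close>

lemma stable_density_moment:
  assumes "0 < \<sigma>" "\<sigma> < 1" "- \<sigma> < q"
  obtains C where "0 < C"
    "\<And>t. 0 < t \<Longrightarrow> (\<integral>\<^sup>+s\<in>{0<..}. ennreal (\<bar>stable_density \<sigma> t s\<bar> * s powr (- q)) \<partial>lborel) \<le> ennreal (C * t powr (- q / \<sigma>))"
proof -
  \<comment> \<open>With this k the majorant near 0 is a multiple of s^(sigma - 1), whatever q
    is.\<close>
  define k where "k = (q + \<sigma>) / \<sigma>"
  have k: "0 < k" "\<sigma> * k = q + \<sigma>" using assms by (auto simp: k_def)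
  from stable_density_bounds[OF assms(1,2) k(1)] obtain C where C: "0 < C"
    and b1: "\<And>t s. 0 < t \<Longrightarrow> 0 < s \<Longrightarrow> \<bar>stable_density \<sigma> t s\<bar> \<le> C * ((t * s powr (- \<sigma>)) powr (- k) / s)"
    and b2: "\<And>t s. 0 < t \<Longrightarrow> 0 < s \<Longrightarrow> \<bar>stable_density \<sigma> t s\<bar> \<le> C * (t * s powr (- \<sigma>) / s)"
    by blast
  show thesis
  proof (rule that[of "C / \<sigma> + C / (\<sigma> + q)"])
    show "0 < C / \<sigma> + C / (\<sigma> + q)"
      using add_pos_pos[OF divide_pos_pos[OF C assms(1)] divide_pos_pos[OF C, of "\<sigma> + q"]] assms by simp
    fix t :: real assume t: "0 < t"
    define s0 where "s0 = t powr (1 / \<sigma>)"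
    have s0: "0 < s0" using t by (simp add: s0_def)
    let ?g1 = "\<lambda>s. C * t powr (- k) * s powr (\<sigma> - 1)"
    let ?g2 = "\<lambda>s. C * t * s powr (- \<sigma> - 1 - q)"
    have 1: "\<bar>stable_density \<sigma> t s\<bar> * s powr (- q) \<le> ?g1 s" if s: "0 < s" for s
    proof -
      have "\<bar>stable_density \<sigma> t s\<bar> * s powr (- q) \<le> C * ((t * s powr (- \<sigma>)) powr (- k) / s) * s powr (- q)"
        using b1[OF t s] by (intro mult_right_mono) auto
      also have "(t * s powr (- \<sigma>)) powr (- k) = t powr (- k) * s powr (q + \<sigma>)"
        using s t k by (simp add: powr_mult powr_powr add.commute)
      also have "C * (t powr (- k) * s powr (q + \<sigma>) / s) * s powr (- q) = C * t powr (- k) * (s powr (q + \<sigma>) * s powr (- 1) * s powr (- q))"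
        using s by (simp add: powr_minus_divide)
      also have "s powr (q + \<sigma>) * s powr (- 1) * s powr (- q) = s powr (\<sigma> - 1)"
        unfolding powr_add[symmetric] by simp
      finally show ?thesis .
    qed
    have 2: "\<bar>stable_density \<sigma> t s\<bar> * s powr (- q) \<le> ?g2 s" if s: "0 < s" for s
    proof -
      have "\<bar>stable_density \<sigma> t s\<bar> * s powr (- q) \<le> C * (t * s powr (- \<sigma>) / s) * s powr (- q)"
        using b2[OF t s] by (intro mult_right_mono) auto
      also have "\<dots> = C * t * (s powr (- \<sigma>) * s powr (- 1) * s powr (- q))"
        using s by (simp add: powr_minus_divide)
      also have "s powr (- \<sigma>) * s powr (- 1) * s powr (- q) = s powr (- \<sigma> - 1 - q)"
        unfolding powr_add[symmetric] by simp
      finally show ?thesis .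
    qed
    have I1: "(\<integral>\<^sup>+s\<in>{0..s0}. ennreal (?g1 s) \<partial>lborel) = ennreal (C / \<sigma> * t powr (- q / \<sigma>))"
    proof -
      have "(\<integral>\<^sup>+s\<in>{0..s0}. ennreal (?g1 s) \<partial>lborel) = ennreal (C * t powr (- k) * (s0 powr (\<sigma> - 1 + 1) / (\<sigma> - 1 + 1)))"
        using C s0 assms by (intro nn_integral_has_integral_lebesgue' has_integral_mult_right has_integral_powr_from_0) auto
      also have "s0 powr (\<sigma> - 1 + 1) = t powr 1" using assms by (simp add: s0_def powr_powr)
      also have "C * t powr (- k) * (t powr 1 / (\<sigma> - 1 + 1)) = C / \<sigma> * (t powr (- k) * t powr 1)" by simp
      also have "t powr (- k) * t powr 1 = t powr (- q / \<sigma>)"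
        unfolding powr_add[symmetric] using assms by (simp add: k_def field_simps)
      finally show ?thesis .
    qed
    have I2: "(\<integral>\<^sup>+s\<in>{s0..}. ennreal (?g2 s) \<partial>lborel) = ennreal (C / (\<sigma> + q) * t powr (- q / \<sigma>))"
    proof -
      have "(\<integral>\<^sup>+s\<in>{s0..}. ennreal (?g2 s) \<partial>lborel) = ennreal (C * t * (- (s0 powr (- \<sigma> - 1 - q + 1)) / (- \<sigma> - 1 - q + 1)))"
        using C s0 t assms by (intro nn_integral_has_integral_lebesgue' has_integral_mult_right has_integral_powr_to_inf) auto
      also have "- \<sigma> - 1 - q + 1 = - (\<sigma> + q)" by simp
      also have "- (s0 powr - (\<sigma> + q)) / - (\<sigma> + q) = s0 powr (- (\<sigma> + q)) / (\<sigma> + q)"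
        by (rule minus_divide_divide)
      also have "s0 powr (- (\<sigma> + q)) = t powr (- 1 + - q / \<sigma>)"
        using assms by (simp add: s0_def powr_powr field_simps)
      also have "\<dots> = t powr (- 1) * t powr (- q / \<sigma>)" by (rule powr_add)
      also have "C * t * (t powr (- 1) * t powr (- q / \<sigma>) / (\<sigma> + q)) = C / (\<sigma> + q) * t powr (- q / \<sigma>)"
        using t by (simp add: powr_minus_divide)
      finally show ?thesis .
    qed
    have "(\<integral>\<^sup>+s\<in>{0<..}. ennreal (\<bar>stable_density \<sigma> t s\<bar> * s powr (- q)) \<partial>lborel)
       \<le> (\<integral>\<^sup>+s. ennreal (?g1 s) * indicator {0..s0} s + ennreal (?g2 s) * indicator {s0..} s \<partial>lborel)"
      using 1 2 by (intro nn_integral_mono) (auto split: split_indicator intro!: ennreal_leI add_increasing2 add_increasing)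
    also have "\<dots> = (\<integral>\<^sup>+s\<in>{0..s0}. ennreal (?g1 s) \<partial>lborel) + (\<integral>\<^sup>+s\<in>{s0..}. ennreal (?g2 s) \<partial>lborel)"
      by (rule nn_integral_add) measurable
    also have "\<dots> = ennreal ((C / \<sigma> + C / (\<sigma> + q)) * t powr (- q / \<sigma>))"
      unfolding I1 I2 using C assms by (subst ennreal_plus[symmetric]) (auto simp: algebra_simps)
    finally show "(\<integral>\<^sup>+s\<in>{0<..}. ennreal (\<bar>stable_density \<sigma> t s\<bar> * s powr (- q)) \<partial>lborel)
       \<le> ennreal ((C / \<sigma> + C / (\<sigma> + q)) * t powr (- q / \<sigma>))" .
  qed
qed

text \<open>Subordination integrates powers of s, so the Gaussian is traded for a power of hnorm^2 /
  t; the order Q/2 + b leaves exactly t^b.\<close>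

lemma heat_kernel_polynomial_bound:
  assumes "0 \<le> b"
  obtains C where "0 < C"
    "\<And>(\<eta> :: 'n::finite heis) t. 0 < t \<Longrightarrow> \<bar>heat_kernel \<eta> t\<bar> \<le> C * t powr (- (hdim TYPE('n) / 2))"
    "\<And>(\<eta> :: 'n::finite heis) t. 0 < t \<Longrightarrow> 0 < hnorm \<eta> \<Longrightarrow>
        \<bar>heat_kernel \<eta> t\<bar> \<le> C * hnorm \<eta> powr (- (hdim TYPE('n) + 2 * b)) * t powr b"
proof -
  let ?Q = "hdim TYPE('n)"
  obtain C where C: "0 < C" and bd: "\<And>(\<eta> :: 'n heis) t. 0 < t \<Longrightarrow>
       \<bar>heat_kernel \<eta> t\<bar> \<le> C * t powr (- (?Q / 2)) * exp (- (hnorm \<eta>)\<^sup>2 / (8 * t))"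
    using heat_kernel_bound by blast
  define k where "k = ?Q / 2 + b"
  have k: "0 < k" using assms by (simp add: k_def hdim_def add_pos_nonneg)
  define D where "D = k powr k * (1/8) powr (- k)"
  have D: "0 < D" using k by (simp add: D_def)
  show thesis
  proof (rule that[of "C + C * D"])
    fix \<eta> :: "'n heis" and t :: real assume t: "0 < t"
    have "C * t powr (- (?Q / 2)) * exp (- (hnorm \<eta>)\<^sup>2 / (8 * t)) \<le> C * t powr (- (?Q / 2)) * 1"
      using C t by (intro mult_left_mono) auto
    also have "\<dots> \<le> (C + C * D) * t powr (- (?Q / 2))"
      unfolding mult_1_right using C D by (intro mult_right_mono) auto
    finally show "\<bar>heat_kernel \<eta> t\<bar> \<le> (C + C * D) * t powr (- (?Q / 2))"
      using bd[OF t, of \<eta>] by linarith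
    assume r: "0 < hnorm \<eta>"
    let ?r = "hnorm \<eta>"
    have "exp (- ?r\<^sup>2 / (8 * t)) \<le> k powr k * (?r\<^sup>2 / (8 * t)) powr (- k)"
      using exp_minus_le_powr[of k "?r\<^sup>2 / (8 * t)"] k t r by simp
    also have "(?r\<^sup>2 / (8 * t)) powr (- k) = (1/8) powr (- k) * (?r powr (- (2 * k)) * t powr k)"
    proof -
      have "?r\<^sup>2 / (8 * t) = (1/8) * (?r powr 2 * t powr (- 1))"
        using r t by (simp add: powr_minus_divide)
      then show ?thesis using r t by (simp only: powr_mult powr_powr) simp
    qed
    finally have "exp (- ?r\<^sup>2 / (8 * t)) \<le> D * (?r powr (- (2 * k)) * t powr k)"
      by (simp add: D_def mult_ac)
    then have "C * t powr (- (?Q / 2)) * exp (- ?r\<^sup>2 / (8 * t)) \<le> C * t powr (- (?Q / 2)) * (D * (?r powr (- (2 * k)) * t powr k))"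
      using C t by (intro mult_left_mono) auto
    also have "\<dots> = C * D * ?r powr (- (2 * k)) * (t powr (- (?Q / 2)) * t powr k)" by (simp only: mult_ac)
    also have "t powr (- (?Q / 2)) * t powr k = t powr b" unfolding powr_add[symmetric] by (simp add: k_def)
    also have "- (2 * k) = - (?Q + 2 * b)" by (simp add: k_def)
    also have "C * D * ?r powr (- (?Q + 2 * b)) * t powr b \<le> (C + C * D) * ?r powr (- (?Q + 2 * b)) * t powr b"
      using C by (intro mult_right_mono) auto
    finally show "\<bar>heat_kernel \<eta> t\<bar> \<le> (C + C * D) * ?r powr (- (?Q + 2 * b)) * t powr b"
      using bd[OF t, of \<eta>] by linarith
  qed (use C D in \<open>auto intro!: add_pos_pos\<close>)
qed

text \<open>The estimate passes through the nonnegative integral of the absolute value and so also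
  covers a subordination integral that is 0 by the convention for non-integrable functions.\<close>

lemma subordination_bound:
  assumes "0 < \<sigma>" "\<sigma> < 1" "- \<sigma> < q"
  obtains C where "0 < C"
    "\<And>t K h. 0 < t \<Longrightarrow> 0 \<le> K \<Longrightarrow> (\<And>s. 0 < s \<Longrightarrow> \<bar>h s\<bar> \<le> K * s powr (- q)) \<Longrightarrow>
       \<bar>LINT s:{0<..}|lborel. stable_density \<sigma> t s * h s\<bar> \<le> C * K * t powr (- q / \<sigma>)"
proof -
  from stable_density_moment[OF assms] obtain C where C: "0 < C" and
    m: "\<And>t. 0 < t \<Longrightarrow> (\<integral>\<^sup>+s\<in>{0<..}. ennreal (\<bar>stable_density \<sigma> t s\<bar> * s powr (- q)) \<partial>lborel) \<le> ennreal (C * t powr (- q / \<sigma>))"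
    by blast
  show thesis
  proof (rule that[OF C])
    fix t K :: real and h :: "real \<Rightarrow> real"
    assume t: "0 < t" and K: "0 \<le> K" and h: "\<And>s. 0 < s \<Longrightarrow> \<bar>h s\<bar> \<le> K * s powr (- q)"
    have "ennreal \<bar>LINT s:{0<..}|lborel. stable_density \<sigma> t s * h s\<bar>
        \<le> (\<integral>\<^sup>+s\<in>{0<..}. ennreal \<bar>stable_density \<sigma> t s * h s\<bar> \<partial>lborel)"
      by (rule abs_set_lebesgue_integral_le_nn_integral)
    also have "\<dots> \<le> (\<integral>\<^sup>+s. ennreal K * (ennreal (\<bar>stable_density \<sigma> t s\<bar> * s powr (- q)) * indicator {0<..} s) \<partial>lborel)"
    proof (intro nn_integral_mono)
      fix s
      have "ennreal \<bar>stable_density \<sigma> t s * h s\<bar> \<le> ennreal K * ennreal (\<bar>stable_density \<sigma> t s\<bar> * s powr (- q))" if "0 < s"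
        using mult_left_mono[OF h[OF that], of "\<bar>stable_density \<sigma> t s\<bar>"] K
        by (subst ennreal_mult'[symmetric]) (auto simp: abs_mult mult_ac intro!: ennreal_leI)
      then show "ennreal \<bar>stable_density \<sigma> t s * h s\<bar> * indicator {0<..} s
          \<le> ennreal K * (ennreal (\<bar>stable_density \<sigma> t s\<bar> * s powr (- q)) * indicator {0<..} s)"
        by (auto split: split_indicator)
    qed
    also have "\<dots> \<le> ennreal K * (\<integral>\<^sup>+s\<in>{0<..}. ennreal (\<bar>stable_density \<sigma> t s\<bar> * s powr (- q)) \<partial>lborel)"
      unfolding stable_density_def set_lebesgue_integral_def by (subst nn_integral_cmult) auto
    also have "\<dots> \<le> ennreal K * ennreal (C * t powr (- q / \<sigma>))"
      by (intro mult_left_mono m t) auto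
    also have "\<dots> = ennreal (C * K * t powr (- q / \<sigma>))"
      using K C by (simp add: ennreal_mult'[symmetric] mult_ac)
    finally show "\<bar>LINT s:{0<..}|lborel. stable_density \<sigma> t s * h s\<bar> \<le> C * K * t powr (- q / \<sigma>)"
      using K C by (subst (asm) ennreal_le_iff) auto
  qed
qed

text \<open>The far bound uses the heat kernel with t^(alpha/4), that is, the moment q = -sigma/2,
  halfway to the forbidden value -sigma. For alpha = 2 the exponent alpha/4 is already 1/2, so both
  cases share one statement.\<close>

lemma G_bound:
  assumes "0 < \<alpha>" "\<alpha> \<le> 2"
  obtains C where "0 < C"
    "\<And>(\<eta> :: 'n::finite heis) t. 0 < t \<Longrightarrow> \<bar>G \<alpha> \<eta> t\<bar> \<le> C * t powr (- (hdim TYPE('n) / \<alpha>))"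
    "\<And>(\<eta> :: 'n::finite heis) t. 0 < t \<Longrightarrow> 0 < hnorm \<eta> \<Longrightarrow>
        \<bar>G \<alpha> \<eta> t\<bar> \<le> C * hnorm \<eta> powr (- (hdim TYPE('n) + \<alpha> / 2)) * t powr (1 / 2)"
proof -
  let ?Q = "hdim TYPE('n)"
  have Q: "0 < ?Q" by (simp add: hdim_def add_pos_nonneg)
  have "0 \<le> \<alpha> / 4" using assms by simp
  then obtain C where C: "0 < C"
    and h1: "\<And>(\<eta> :: 'n heis) t. 0 < t \<Longrightarrow> \<bar>heat_kernel \<eta> t\<bar> \<le> C * t powr (- (?Q / 2))"
    and h2: "\<And>(\<eta> :: 'n heis) t. 0 < t \<Longrightarrow> 0 < hnorm \<eta> \<Longrightarrow>
        \<bar>heat_kernel \<eta> t\<bar> \<le> C * hnorm \<eta> powr (- (?Q + 2 * (\<alpha> / 4))) * t powr (\<alpha> / 4)"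
    using heat_kernel_polynomial_bound by blast
  show thesis
  proof (cases "\<alpha> = 2")
    case True
    then show thesis using that[of C] C h1 h2 by (simp add: G_def)
  next
    case False
    define \<sigma> where "\<sigma> = \<alpha> / 2"
    have \<sigma>: "0 < \<sigma>" "\<sigma> < 1" using assms False by (auto simp: \<sigma>_def)
    have q: "- \<sigma> < ?Q / 2" "- \<sigma> < - (\<sigma> / 2)" using \<sigma> Q by auto
    from subordination_bound[OF \<sigma> q(1)] obtain C1 where C1: "0 < C1" and
      b1: "\<And>t K h. 0 < t \<Longrightarrow> 0 \<le> K \<Longrightarrow> (\<And>s. 0 < s \<Longrightarrow> \<bar>h s\<bar> \<le> K * s powr (- (?Q / 2))) \<Longrightarrow>
       \<bar>LINT s:{0<..}|lborel. stable_density \<sigma> t s * h s\<bar> \<le> C1 * K * t powr (- (?Q / 2) / \<sigma>)"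
      by blast
    from subordination_bound[OF \<sigma> q(2)] obtain C2 where C2: "0 < C2" and
      b2: "\<And>t K h. 0 < t \<Longrightarrow> 0 \<le> K \<Longrightarrow> (\<And>s. 0 < s \<Longrightarrow> \<bar>h s\<bar> \<le> K * s powr (- (- (\<sigma> / 2)))) \<Longrightarrow>
       \<bar>LINT s:{0<..}|lborel. stable_density \<sigma> t s * h s\<bar> \<le> C2 * K * t powr (- (- (\<sigma> / 2)) / \<sigma>)"
      by blast
    have G: "G \<alpha> \<eta> t = (LINT s:{0<..}|lborel. stable_density \<sigma> t s * heat_kernel \<eta> s)" for \<eta> :: "'n heis" and t
      using False by (simp add: G_def \<sigma>_def)
    show thesis
    proof (rule that[of "C1 * C + C2 * C"])
      fix \<eta> :: "'n heis" and t :: real assume t: "0 < t"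
      have "\<bar>G \<alpha> \<eta> t\<bar> \<le> C1 * C * t powr (- (?Q / 2) / \<sigma>)"
        unfolding G by (rule b1) (use t C h1 in auto)
      also have "- (?Q / 2) / \<sigma> = - (?Q / \<alpha>)" by (simp add: \<sigma>_def)
      also have "C1 * C * t powr (- (?Q / \<alpha>)) \<le> (C1 * C + C2 * C) * t powr (- (?Q / \<alpha>))"
        using C C2 by (intro mult_right_mono) auto
      finally show "\<bar>G \<alpha> \<eta> t\<bar> \<le> (C1 * C + C2 * C) * t powr (- (?Q / \<alpha>))" .
      assume r: "0 < hnorm \<eta>"
      let ?R = "hnorm \<eta> powr (- (?Q + \<alpha> / 2))"
      have "\<bar>G \<alpha> \<eta> t\<bar> \<le> C2 * (C * ?R) * t powr (- (- (\<sigma> / 2)) / \<sigma>)"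
        unfolding G by (rule b2) (use t C h2[OF _ r] in \<open>auto simp: \<sigma>_def\<close>)
      also have "- (- (\<sigma> / 2)) / \<sigma> = 1 / 2" using \<sigma> by simp
      also have "C2 * (C * ?R) * t powr (1 / 2) \<le> (C1 * C + C2 * C) * ?R * t powr (1 / 2)"
        unfolding mult.assoc[symmetric] using C C1 by (intro mult_right_mono) auto
      finally show "\<bar>G \<alpha> \<eta> t\<bar> \<le> (C1 * C + C2 * C) * ?R * t powr (1 / 2)" .
    qed (use C C1 C2 in \<open>auto intro!: add_pos_pos\<close>)
  qed
qed

section \<open>Homogeneous balls in the Heisenberg group\<close>

lemma hmult_hinv: "hmult (hinv (x', y', \<tau>')) (x, y, \<tau>) = (x - x', y - y', \<tau> - (\<tau>' + 2 * (x' \<bullet> y - x \<bullet> y')))"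
  by (simp add: hmult_def hinv_def algebra_simps)

lemma hnorm_less_iff:
  assumes "0 < r"
  shows "hnorm (x, y, \<tau>) < r \<longleftrightarrow> ((norm x)\<^sup>2 + (norm y)\<^sup>2)\<^sup>2 + \<tau>\<^sup>2 < r ^ 4"
proof -
  let ?a = "((norm x)\<^sup>2 + (norm y)\<^sup>2)\<^sup>2 + \<tau>\<^sup>2"
  have "r ^ 4 = r powr 4" using assms by simp
  moreover have "(r powr 4) powr (1/4) = r" by (subst powr_powr) (use assms in simp)
  ultimately have "(r ^ 4) powr (1/4) = r" by (simp only:)
  then have "hnorm (x, y, \<tau>) < r \<longleftrightarrow> ?a powr (1/4) < (r ^ 4) powr (1/4)" by (simp add: hnorm_def)
  also have "\<dots> \<longleftrightarrow> ?a < r ^ 4"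
  proof
    assume "?a < r ^ 4"
    then show "?a powr (1/4) < (r ^ 4) powr (1/4)" by (intro powr_less_mono2) auto
  next
    assume *: "?a powr (1/4) < (r ^ 4) powr (1/4)"
    show "?a < r ^ 4"
    proof (rule ccontr)
      assume "\<not> ?a < r ^ 4"
      then have "(r ^ 4) powr (1/4) \<le> ?a powr (1/4)" using assms by (intro powr_mono2) auto
      then show False using * by simp
    qed
  qed
  finally show ?thesis .
qed

lemma hnorm_lessD:
  assumes "hnorm (x, y, \<tau>) < r"
  shows "norm x < r" "norm y < r" "\<bar>\<tau>\<bar> < r\<^sup>2"
proof -
  have r: "0 < r" using assms powr_ge_zero[of "((norm x)\<^sup>2 + (norm y)\<^sup>2)\<^sup>2 + \<tau>\<^sup>2" "1/4"]
    unfolding hnorm_def prod.case by linarith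
  have *: "((norm x)\<^sup>2 + (norm y)\<^sup>2)\<^sup>2 + \<tau>\<^sup>2 < (r\<^sup>2)\<^sup>2"
    using assms unfolding hnorm_less_iff[OF r] by simp
  then have "((norm x)\<^sup>2 + (norm y)\<^sup>2)\<^sup>2 < (r\<^sup>2)\<^sup>2" using zero_le_power2[of \<tau>] by linarith
  then have z: "(norm x)\<^sup>2 + (norm y)\<^sup>2 < r\<^sup>2" by (rule power2_less_imp_less) simp
  then have "(norm x)\<^sup>2 < r\<^sup>2" "(norm y)\<^sup>2 < r\<^sup>2"
    using zero_le_power2[of "norm x"] zero_le_power2[of "norm y"] by linarith+
  then show "norm x < r" "norm y < r" using r by (auto intro: power2_less_imp_less)
  have "\<bar>\<tau>\<bar>\<^sup>2 < (r\<^sup>2)\<^sup>2"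
    using * zero_le_power2[of "(norm x)\<^sup>2 + (norm y)\<^sup>2"] unfolding power2_abs by linarith
  then show "\<bar>\<tau>\<bar> < r\<^sup>2" by (rule power2_less_imp_less) simp
qed

lemma hnorm_lessI:
  assumes "0 < r" "(norm x)\<^sup>2 + (norm y)\<^sup>2 \<le> r\<^sup>2 / 2" "\<bar>\<tau>\<bar> < r\<^sup>2 / 2"
  shows "hnorm (x, y, \<tau>) < r"
proof -
  have "((norm x)\<^sup>2 + (norm y)\<^sup>2)\<^sup>2 \<le> (r\<^sup>2 / 2)\<^sup>2" using assms by (intro power_mono) auto
  moreover have "\<bar>\<tau>\<bar>\<^sup>2 < (r\<^sup>2 / 2)\<^sup>2" using assms by (intro power_strict_mono) auto
  moreover have "0 < r ^ 4" using assms by simp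
  moreover have "(r\<^sup>2 / 2)\<^sup>2 = r ^ 4 / 4" by (simp add: power_divide flip: power_mult)
  ultimately have "((norm x)\<^sup>2 + (norm y)\<^sup>2)\<^sup>2 + \<tau>\<^sup>2 < r ^ 4"
    unfolding power2_abs by linarith
  then show ?thesis using hnorm_less_iff assms by blast
qed

lemma hnorm_uminus: "hnorm (- a) = hnorm a"
  by (cases a) (simp add: hnorm_def)

text \<open>A quasi-triangle inequality from componentwise bounds, with Cauchy-Schwarz for the twist
  term; the factor 4 affects constants only.\<close>

lemma hnorm_hmult_less:
  assumes "hnorm a < r" "hnorm b < s"
  shows "hnorm (hmult a b) < 4 * (r + s)"
proof -
  obtain x y \<tau> x' y' \<tau>' where ab: "a = (x, y, \<tau>)" "b = (x', y', \<tau>')" by (cases a; cases b) auto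
  note A = hnorm_lessD[OF assms(1)[unfolded ab]] and B = hnorm_lessD[OF assms(2)[unfolded ab]]
  let ?R = "r + s"
  have r: "0 < r" "0 < s" using A(1) B(1) norm_ge_zero order_le_less_trans by blast+
  have xx: "norm (x + x') \<le> ?R" "norm (y + y') \<le> ?R"
    using norm_triangle_ineq[of x x'] norm_triangle_ineq[of y y'] A B by linarith+
  have 1: "(norm (x + x'))\<^sup>2 + (norm (y + y'))\<^sup>2 \<le> (4 * ?R)\<^sup>2 / 2"
  proof -
    have "(4 * ?R)\<^sup>2 / 2 = 8 * ?R\<^sup>2" unfolding power_mult_distrib by simp
    moreover have "(norm (x + x'))\<^sup>2 \<le> ?R\<^sup>2" "(norm (y + y'))\<^sup>2 \<le> ?R\<^sup>2"
      using xx by (auto intro!: power_mono)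
    ultimately show ?thesis using zero_le_power2[of ?R] by linarith
  qed
  have "\<bar>x \<bullet> y'\<bar> \<le> r * s" "\<bar>x' \<bullet> y\<bar> \<le> r * s"
  proof -
    have "\<bar>x \<bullet> y'\<bar> \<le> norm x * norm y'" by (rule Cauchy_Schwarz_ineq2)
    also have "\<dots> \<le> r * s" using A B r by (intro mult_mono) auto
    finally show "\<bar>x \<bullet> y'\<bar> \<le> r * s" .
    have "\<bar>x' \<bullet> y\<bar> \<le> norm x' * norm y" by (rule Cauchy_Schwarz_ineq2)
    also have "\<dots> \<le> s * r" using A B r by (intro mult_mono) auto
    finally show "\<bar>x' \<bullet> y\<bar> \<le> r * s" by (simp add: mult.commute)
  qed
  then have "\<bar>\<tau> + \<tau>' + 2 * (x \<bullet> y' - x' \<bullet> y)\<bar> < r\<^sup>2 + s\<^sup>2 + 4 * (r * s)"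
  proof -
    have "\<bar>a + b + 2 * (e - f)\<bar> < c + d + 4 * g"
      if "\<bar>a\<bar> < c" "\<bar>b\<bar> < d" "\<bar>e\<bar> \<le> g" "\<bar>f\<bar> \<le> g" for a b c d e f g :: real
    proof -
      have "\<bar>a + b\<bar> < c + d" using that(1,2) abs_triangle_ineq[of a b] by linarith
      moreover have "\<bar>2 * (e - f)\<bar> \<le> 4 * g"
        using that(3,4) abs_triangle_ineq4[of e f] unfolding abs_mult by simp
      ultimately show ?thesis using abs_triangle_ineq[of "a + b" "2 * (e - f)"] by linarith
    qed
    from this[OF A(3) B(3)] show "\<bar>x \<bullet> y'\<bar> \<le> r * s \<Longrightarrow> \<bar>x' \<bullet> y\<bar> \<le> r * s \<Longrightarrow> ?thesis" .
  qed
  also have "\<dots> \<le> (4 * ?R)\<^sup>2 / 2"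
    using mult_pos_pos[OF r] zero_le_power2[of r] zero_le_power2[of s]
    by (simp add: power2_eq_square algebra_simps)
  finally show ?thesis
    unfolding ab hmult_def prod.case using 1 r by (intro hnorm_lessI) auto
qed

text \<open>Inserting an intermediate point turns \<open>hnorm_hmult_less\<close> into a triangle
  inequality for balls.\<close>

lemma hmult_hinv_chain: "hmult (hmult (hinv \<zeta>) \<xi>) (hmult (hinv \<xi>) \<eta>) = hmult (hinv \<zeta>) \<eta>"
  by (cases \<zeta>; cases \<xi>; cases \<eta>)
     (simp add: hmult_def hinv_def algebra_simps inner_commute)

lemma hball_sym: "\<zeta> \<in> hball \<eta> r \<longleftrightarrow> \<eta> \<in> hball \<zeta> r"
proof -
  have "hmult (hinv \<eta>) \<zeta> = - hmult (hinv \<zeta>) \<eta>"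
    by (cases \<zeta>; cases \<eta>) (simp add: hmult_def hinv_def algebra_simps inner_commute)
  then show ?thesis by (simp add: hball_def hdist_def hnorm_uminus)
qed

lemma hball_triangle:
  assumes "\<xi> \<in> hball \<eta> r" "\<zeta> \<in> hball \<xi> s"
  shows "\<zeta> \<in> hball \<eta> (4 * (r + s))"
  using hnorm_hmult_less[of "hmult (hinv \<zeta>) \<xi>" s "hmult (hinv \<xi>) \<eta>" r] assms
  by (simp add: hball_def hdist_def hmult_hinv_chain add.commute)

lemma hball_mono: "r \<le> s \<Longrightarrow> hball \<eta> r \<subseteq> hball \<eta> s"
  by (auto simp: hball_def)

section \<open>Measurability of the group operations and of balls\<close>

lemma hmult_hinv_measurable [measurable]:
  assumes "f \<in> borel_measurable M" "g \<in> borel_measurable M"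
  shows "(\<lambda>x. hmult (hinv (f x)) (g x) :: 'n::finite heis) \<in> borel_measurable M"
proof -
  have "(\<lambda>z :: 'n heis \<times> 'n heis. hmult (hinv (fst z)) (snd z)) =
      (\<lambda>z. (fst (snd z) - fst (fst z), fst (snd (snd z)) - fst (snd (fst z)),
        snd (snd (snd z)) - (snd (snd (fst z)) + 2 * (fst (fst z) \<bullet> fst (snd (snd z)) - fst (snd z) \<bullet> fst (snd (fst z))))))"
    by (auto simp: fun_eq_iff hmult_hinv)
  then have "continuous_on UNIV (\<lambda>z :: 'n heis \<times> 'n heis. hmult (hinv (fst z)) (snd z))"
    by (simp only:) (intro continuous_intros)
  then have "(\<lambda>z :: 'n heis \<times> 'n heis. hmult (hinv (fst z)) (snd z)) \<in> borel_measurable borel"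
    by (rule borel_measurable_continuous_onI)
  from measurable_compose[OF borel_measurable_Pair[OF assms] this] show ?thesis by simp
qed

lemma hnorm_measurable [measurable]: "hnorm \<in> borel_measurable (borel :: 'n::finite heis measure)"
proof -
  have eq: "hnorm = (\<lambda>a :: 'n heis. ((norm (fst a) ^ 2 + norm (fst (snd a)) ^ 2) ^ 2 + snd (snd a) ^ 2) powr (1/4))"
    by (auto simp: fun_eq_iff hnorm_def)
  have "continuous_on UNIV (hnorm :: 'n heis \<Rightarrow> real)"
    unfolding eq by (intro continuous_on_powr' continuous_intros) auto
  then show ?thesis by (rule borel_measurable_continuous_onI)
qed

lemma sets_hball [measurable]: "hball \<eta> r \<in> sets borel"
proof -
  have "hball \<eta> r = {\<zeta> \<in> space borel. hnorm (hmult (hinv \<zeta>) \<eta>) < r}"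
    by (auto simp: hball_def hdist_def)
  also have "\<dots> \<in> sets borel" by measurable
  finally show ?thesis .
qed

lemma hball_pred_measurable [measurable]:
  assumes "f \<in> borel_measurable M" "g \<in> borel_measurable M"
  shows "Measurable.pred M (\<lambda>x. f x \<in> hball (g x) r)"
proof -
  have "Measurable.pred M (\<lambda>x. hnorm (hmult (hinv (f x)) (g x)) < r)"
    using assms by measurable
  then show ?thesis by (simp add: hball_def hdist_def)
qed

section \<open>Volume of homogeneous balls\<close>

lemma nn_integral_lborel_Pair:
  fixes f :: "'a::euclidean_space \<times> 'b::euclidean_space \<Rightarrow> ennreal"
  assumes [measurable]: "f \<in> borel_measurable borel"
  shows "integral\<^sup>N lborel f = (\<integral>\<^sup>+x. \<integral>\<^sup>+y. f (x, y) \<partial>lborel \<partial>lborel)"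
proof -
  have "(\<integral>\<^sup>+x. \<integral>\<^sup>+y. f (x, y) \<partial>lborel \<partial>lborel) = integral\<^sup>N (lborel \<Otimes>\<^sub>M lborel) f"
    by (rule lborel.nn_integral_fst) (simp add: lborel_prod)
  then show ?thesis by (simp add: lborel_prod)
qed

text \<open>A left-translated box. The group law shears it in the last coordinate, but every slice
  in that coordinate is an interval of length 2 b, so its volume is that of the untranslated
  box.\<close>

definition slab :: "'n::finite heis \<Rightarrow> real \<Rightarrow> real \<Rightarrow> 'n heis set" where
  "slab \<eta> a b = (case \<eta> of (x, y, \<tau>) \<Rightarrow>
     {(x', y', \<tau>'). x' \<in> ball x a \<and> y' \<in> ball y a \<and> \<bar>\<tau> - (\<tau>' + 2 * (x' \<bullet> y - x \<bullet> y'))\<bar> < b})"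

lemma emeasure_slab:
  assumes "0 \<le> a" "0 \<le> b"
  shows "slab (\<eta> :: 'n::finite heis) a b \<in> sets borel"
    "emeasure lborel (slab \<eta> a b) = ennreal ((unit_ball_vol CARD('n) * a ^ CARD('n))\<^sup>2 * (2 * b))"
proof -
  obtain x y \<tau> where \<eta>: "\<eta> = (x, y, \<tau>)" by (cases \<eta>) auto
  let ?c = "\<lambda>x' y'. \<tau> - 2 * (x' \<bullet> y - x \<bullet> y')"
  have "slab \<eta> a b = {z. x \<in> ball (fst z) a} \<inter> {z. y \<in> ball (fst (snd z)) a}
      \<inter> {z. \<bar>\<tau> - (snd (snd z) + 2 * (fst z \<bullet> y - x \<bullet> fst (snd z)))\<bar> < b}"
    by (auto simp: slab_def \<eta> dist_commute)
  moreover have "open \<dots>"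
    unfolding mem_ball by (intro open_Int open_Collect_less continuous_intros)
  ultimately show S: "slab \<eta> a b \<in> sets borel" by auto
  have ind: "indicator (slab \<eta> a b) (x', y', \<tau>') = (indicator (ball x a) x' * indicator (ball y a) y' :: ennreal)
      * indicator {?c x' y' - b<..<?c x' y' + b} \<tau>'" for x' y' \<tau>'
    by (auto simp: slab_def \<eta> abs_less_iff split: split_indicator)
  have "emeasure lborel (slab \<eta> a b) = (\<integral>\<^sup>+z. indicator (slab \<eta> a b) z \<partial>lborel)" using S by simp
  also have "\<dots> = (\<integral>\<^sup>+x'. \<integral>\<^sup>+z. indicator (slab \<eta> a b) (x', z) \<partial>lborel \<partial>lborel)"
    using S by (intro nn_integral_lborel_Pair) auto
  also have "\<dots> = (\<integral>\<^sup>+x'. \<integral>\<^sup>+y'. \<integral>\<^sup>+\<tau>'. indicator (slab \<eta> a b) (x', y', \<tau>') \<partial>lborel \<partial>lborel \<partial>lborel)"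
    by (intro nn_integral_cong nn_integral_lborel_Pair measurable_compose[OF _ borel_measurable_indicator[OF S]]
        borel_measurable_continuous_onI continuous_intros)
  also have "\<dots> = (\<integral>\<^sup>+x'. \<integral>\<^sup>+y'. indicator (ball x a) x' * (indicator (ball y a) y' * ennreal (2 * b)) \<partial>lborel \<partial>lborel)"
  proof (intro nn_integral_cong)
    fix x' y'
    have "emeasure lborel {?c x' y' - b<..<?c x' y' + b} = ennreal (2 * b)" using assms by simp
    then show "(\<integral>\<^sup>+\<tau>'. indicator (slab \<eta> a b) (x', y', \<tau>') \<partial>lborel)
        = indicator (ball x a) x' * (indicator (ball y a) y' * ennreal (2 * b))"
      unfolding ind by (subst nn_integral_cmult_indicator) (auto simp: mult.assoc)
  qed
  also have "\<dots> = (\<integral>\<^sup>+x'. indicator (ball x a) x' * (emeasure lborel (ball y a) * ennreal (2 * b)) \<partial>lborel)"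
  proof (intro nn_integral_cong)
    fix x'
    have "(\<integral>\<^sup>+y'. indicator (ball x a) x' * (indicator (ball y a) y' * ennreal (2 * b)) \<partial>lborel)
       = (\<integral>\<^sup>+y'. (indicator (ball x a) x' * ennreal (2 * b)) * indicator (ball y a) y' \<partial>lborel)"
      by (simp only: mult_ac)
    also have "\<dots> = (indicator (ball x a) x' * ennreal (2 * b)) * emeasure lborel (ball y a)"
      by (rule nn_integral_cmult_indicator) simp
    finally show "(\<integral>\<^sup>+y'. indicator (ball x a) x' * (indicator (ball y a) y' * ennreal (2 * b)) \<partial>lborel)
       = indicator (ball x a) x' * (emeasure lborel (ball y a) * ennreal (2 * b))" by (simp only: mult_ac)
  qed
  also have "\<dots> = emeasure lborel (ball y a) * ennreal (2 * b) * emeasure lborel (ball x a)"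
    by (subst mult.commute, rule nn_integral_cmult_indicator) simp
  also have "\<dots> = ennreal ((unit_ball_vol CARD('n) * a ^ CARD('n))\<^sup>2 * (2 * b))"
    using assms by (simp add: emeasure_ball power2_eq_square mult_ac flip: ennreal_mult'')
  finally show "emeasure lborel (slab \<eta> a b) = ennreal ((unit_ball_vol CARD('n) * a ^ CARD('n))\<^sup>2 * (2 * b))" .
qed

text \<open>The ball lies between the slabs of parameters (r/2, (r/2)^2) and (r, r^2); the parabolic
  scaling of the last coordinate yields the exponent 2N + 2.\<close>

lemma hball_volume:
  obtains v1 v2 where "0 < v1" "0 < v2"
    "\<And>(\<eta> :: 'n::finite heis) r. 0 < r \<Longrightarrow> ennreal (v1 * r powr hdim TYPE('n)) \<le> emeasure lborel (hball \<eta> r)"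
    "\<And>(\<eta> :: 'n::finite heis) r. 0 < r \<Longrightarrow> emeasure lborel (hball \<eta> r) \<le> ennreal (v2 * r powr hdim TYPE('n))"
proof -
  let ?N = "CARD('n)"
  define v where "v = 2 * (unit_ball_vol ?N)\<^sup>2"
  have v: "0 < v" unfolding v_def by (intro mult_pos_pos zero_less_power unit_ball_vol_pos) auto
  have pw: "(unit_ball_vol ?N * r ^ ?N)\<^sup>2 * (2 * r\<^sup>2) = v * r powr hdim TYPE('n)" if "0 < r" for r
  proof -
    have "r powr hdim TYPE('n) = r powr real (2 * ?N + 2)" by (simp add: hdim_def add.commute)
    also have "\<dots> = r ^ (2 * ?N + 2)" by (rule powr_realpow[OF that])
    also have "\<dots> = (r ^ ?N)\<^sup>2 * r\<^sup>2" unfolding power_add power_even_eq ..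
    finally show ?thesis by (simp only: v_def power_mult_distrib mult_ac)
  qed
  show thesis
  proof (rule that[of "v * (1/2) powr hdim TYPE('n)" v])
    fix \<eta> :: "'n heis" and r :: real assume r: "0 < r"
    obtain x y \<tau> where \<eta>: "\<eta> = (x, y, \<tau>)" by (cases \<eta>) auto
    have "hball \<eta> r \<subseteq> slab \<eta> r (r\<^sup>2)"
    proof
      fix \<zeta> assume z: "\<zeta> \<in> hball \<eta> r"
      obtain x' y' \<tau>' where \<zeta>: "\<zeta> = (x', y', \<tau>')" by (cases \<zeta>) auto
      have "hnorm (x - x', y - y', \<tau> - (\<tau>' + 2 * (x' \<bullet> y - x \<bullet> y'))) < r"
        using z by (simp add: hball_def hdist_def \<eta> \<zeta> hmult_hinv)
      from hnorm_lessD[OF this] show "\<zeta> \<in> slab \<eta> r (r\<^sup>2)"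
        by (simp add: slab_def \<eta> \<zeta> dist_norm)
    qed
    then have "emeasure lborel (hball \<eta> r) \<le> emeasure lborel (slab \<eta> r (r\<^sup>2))"
      using emeasure_slab(1)[of r "r\<^sup>2" \<eta>] r by (intro emeasure_mono) auto
    also have "\<dots> = ennreal (v * r powr hdim TYPE('n))"
      using emeasure_slab(2)[of r "r\<^sup>2" \<eta>] r pw[OF r] by simp
    finally show "emeasure lborel (hball \<eta> r) \<le> ennreal (v * r powr hdim TYPE('n))" .
    have r2: "0 < r / 2" using r by simp
    have "slab \<eta> (r / 2) ((r / 2)\<^sup>2) \<subseteq> hball \<eta> r"
    proof
      fix \<zeta> assume z: "\<zeta> \<in> slab \<eta> (r / 2) ((r / 2)\<^sup>2)"
      obtain x' y' \<tau>' where \<zeta>: "\<zeta> = (x', y', \<tau>')" by (cases \<zeta>) auto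
      have xy: "norm (x - x') \<le> r / 2" "norm (y - y') \<le> r / 2"
        and t: "\<bar>\<tau> - (\<tau>' + 2 * (x' \<bullet> y - x \<bullet> y'))\<bar> < (r / 2)\<^sup>2"
        using z by (auto simp: slab_def \<eta> \<zeta> dist_norm)
      have "hnorm (x - x', y - y', \<tau> - (\<tau>' + 2 * (x' \<bullet> y - x \<bullet> y'))) < r"
      proof (rule hnorm_lessI[OF r])
        show "(norm (x - x'))\<^sup>2 + (norm (y - y'))\<^sup>2 \<le> r\<^sup>2 / 2"
          using power_mono[OF xy(1), of 2] power_mono[OF xy(2), of 2] by (simp add: power_divide)
        show "\<bar>\<tau> - (\<tau>' + 2 * (x' \<bullet> y - x \<bullet> y'))\<bar> < r\<^sup>2 / 2"
          using t by (rule order_less_le_trans) (simp add: power_divide)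
      qed
      then show "\<zeta> \<in> hball \<eta> r" by (simp add: hball_def hdist_def \<eta> \<zeta> hmult_hinv)
    qed
    then have "emeasure lborel (slab \<eta> (r / 2) ((r / 2)\<^sup>2)) \<le> emeasure lborel (hball \<eta> r)"
      by (intro emeasure_mono) auto
    also have "emeasure lborel (slab \<eta> (r / 2) ((r / 2)\<^sup>2)) = ennreal (v * (1/2) powr hdim TYPE('n) * r powr hdim TYPE('n))"
    proof -
      have "(r / 2) powr hdim TYPE('n) = (1/2) powr hdim TYPE('n) * r powr hdim TYPE('n)"
        unfolding powr_mult[of "1/2" r "hdim TYPE('n)", symmetric] by (simp only: mult_1 times_divide_eq_left)
      then show ?thesis
        using emeasure_slab(2)[of "r / 2" "(r / 2)\<^sup>2" \<eta>] r2 by (simp only: pw[OF r2] mult.assoc less_imp_le zero_le_power2)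
    qed
    finally show "ennreal (v * (1/2) powr hdim TYPE('n) * r powr hdim TYPE('n)) \<le> emeasure lborel (hball \<eta> r)" .
  qed (use v in auto)
qed

section \<open>Potentials of uniformly locally finite measures\<close>

lemma ennreal_mult_mult: "0 \<le> b \<Longrightarrow> ennreal a * (ennreal b * M) = ennreal (a * b) * M"
  by (simp add: ennreal_mult'' mult.assoc)

lemma ennreal_mult_right: "0 \<le> b \<Longrightarrow> ennreal a * M * ennreal b = ennreal (a * b) * M"
  by (metis ennreal_mult_mult mult.assoc mult.commute)

lemma ennreal_mult_swap: "0 \<le> b \<Longrightarrow> ennreal a * (M * ennreal b) = ennreal (a * b) * M"
  by (simp only: mult.commute[of M] ennreal_mult_mult)

lemma hball_indicator_measurable [measurable]:
  assumes "f \<in> borel_measurable M" "g \<in> borel_measurable M"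
  shows "(\<lambda>x. indicator (hball (g x) r) (f x) :: ennreal) \<in> borel_measurable M"
  unfolding indicator_def using hball_pred_measurable[OF assms] by measurable

text \<open>The common setting of the three measures to which the kernel is applied: the initial
  measure, Lebesgue measure, and the source u(s)^p as a density. Sigma-finiteness is there for
  Tonelli's theorem.\<close>

locale uloc_measure =
  fixes \<nu> :: "'n::finite heis measure" and R :: real and M :: ennreal
  assumes sets_\<nu>: "sets \<nu> = sets borel" and sigma_finite_\<nu>: "sigma_finite_measure \<nu>"
    and R_pos: "0 < R" and uloc: "\<And>\<eta>. emeasure \<nu> (hball \<eta> R) \<le> M"
begin

lemmas sets_\<nu>_cong [measurable_cong] = sets_\<nu>

sublocale sigma_finite_measure \<nu> by (rule sigma_finite_\<nu>)

lemma Fubini_\<nu>: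
  assumes "case_prod f \<in> borel_measurable (\<nu> \<Otimes>\<^sub>M (lborel :: 'n heis measure))"
  shows "(\<integral>\<^sup>+\<zeta>. \<integral>\<^sup>+\<xi>. f \<zeta> \<xi> \<partial>lborel \<partial>\<nu>) = (\<integral>\<^sup>+\<xi>. \<integral>\<^sup>+\<zeta>. f \<zeta> \<xi> \<partial>\<nu> \<partial>lborel)"
proof -
  interpret pair_sigma_finite \<nu> "lborel :: 'n heis measure"
    by (intro pair_sigma_finite.intro sigma_finite_\<nu> lborel.sigma_finite_measure_axioms)
  show ?thesis by (rule Fubini'[OF assms, symmetric])
qed

lemma emeasure_hball_measurable [measurable]:
  "(\<lambda>\<xi>. emeasure \<nu> (hball \<xi> r)) \<in> borel_measurable borel"
proof -
  have "(\<lambda>\<xi>. \<integral>\<^sup>+\<zeta>. indicator (hball \<xi> r) \<zeta> \<partial>\<nu>) \<in> borel_measurable borel" by measurable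
  then show ?thesis using sets_\<nu> by simp
qed

end

text \<open>Averaging takes the place of a covering argument: |B(R)| nu(B(eta, rho)) is at most the
  integral of nu(B(xi, R)) over xi in B(eta, 8 rho), by Tonelli, because B(zeta, R) lies in that
  larger ball for each zeta in B(eta, rho).\<close>

lemma hball_growth:
  obtains c where "0 < c"
    "\<And>(\<nu> :: 'n::finite heis measure) R M \<eta> \<rho>. uloc_measure \<nu> R M \<Longrightarrow> R \<le> \<rho> \<Longrightarrow>
       emeasure \<nu> (hball \<eta> \<rho>) \<le> ennreal (c * (\<rho> / R) powr hdim TYPE('n)) * M"
proof -
  let ?Q = "hdim TYPE('n)"
  obtain v1 v2 where v: "0 < v1" "0 < v2"
    and vol1: "\<And>(\<eta> :: 'n heis) r. 0 < r \<Longrightarrow> ennreal (v1 * r powr ?Q) \<le> emeasure lborel (hball \<eta> r)"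
    and vol2: "\<And>(\<eta> :: 'n heis) r. 0 < r \<Longrightarrow> emeasure lborel (hball \<eta> r) \<le> ennreal (v2 * r powr ?Q)"
    using hball_volume by blast
  show thesis
  proof (rule that[of "v2 * 8 powr ?Q / v1"])
    fix \<nu> :: "'n heis measure" and R M \<eta> \<rho>
    assume "uloc_measure \<nu> R M" and \<rho>: "R \<le> \<rho>"
    then interpret uloc_measure \<nu> R M by simp
    have "ennreal (v1 * R powr ?Q) * emeasure \<nu> (hball \<eta> \<rho>)
        = (\<integral>\<^sup>+\<zeta>. ennreal (v1 * R powr ?Q) * indicator (hball \<eta> \<rho>) \<zeta> \<partial>\<nu>)"
      using sets_\<nu> by (simp add: nn_integral_cmult_indicator)
    also have "\<dots> \<le> (\<integral>\<^sup>+\<zeta>. \<integral>\<^sup>+\<xi>. indicator (hball \<eta> (8 * \<rho>)) \<xi> * indicator (hball \<xi> R) \<zeta> \<partial>lborel \<partial>\<nu>)"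
    proof (intro nn_integral_mono)
      fix \<zeta>
      show "ennreal (v1 * R powr ?Q) * indicator (hball \<eta> \<rho>) \<zeta>
          \<le> (\<integral>\<^sup>+\<xi>. indicator (hball \<eta> (8 * \<rho>)) \<xi> * indicator (hball \<xi> R) \<zeta> \<partial>lborel)"
      proof (cases "\<zeta> \<in> hball \<eta> \<rho>")
        case True
        have "hball \<zeta> R \<subseteq> hball \<eta> (8 * \<rho>)"
          using hball_triangle[OF True] hball_mono[of "4 * (\<rho> + R)" "8 * \<rho>" \<eta>] \<rho> by auto
        then have "(indicator (hball \<zeta> R) \<xi> :: ennreal) \<le> indicator (hball \<eta> (8 * \<rho>)) \<xi> * indicator (hball \<xi> R) \<zeta>" for \<xi>
          using hball_sym[of \<zeta> \<xi> R] by (auto split: split_indicator)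
        then have "(\<integral>\<^sup>+\<xi>. indicator (hball \<zeta> R) \<xi> \<partial>lborel)
            \<le> (\<integral>\<^sup>+\<xi>. indicator (hball \<eta> (8 * \<rho>)) \<xi> * indicator (hball \<xi> R) \<zeta> \<partial>lborel)"
          by (intro nn_integral_mono) auto
        then show ?thesis using True vol1[OF R_pos, of \<zeta>] by simp
      qed simp
    qed
    also have "\<dots> = (\<integral>\<^sup>+\<xi>. \<integral>\<^sup>+\<zeta>. indicator (hball \<eta> (8 * \<rho>)) \<xi> * indicator (hball \<xi> R) \<zeta> \<partial>\<nu> \<partial>lborel)"
      by (rule Fubini_\<nu>) measurable
    also have "\<dots> = (\<integral>\<^sup>+\<xi>. indicator (hball \<eta> (8 * \<rho>)) \<xi> * emeasure \<nu> (hball \<xi> R) \<partial>lborel)"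
      using sets_\<nu> by (intro nn_integral_cong nn_integral_cmult_indicator) auto
    also have "\<dots> \<le> (\<integral>\<^sup>+\<xi>. M * indicator (hball \<eta> (8 * \<rho>)) \<xi> \<partial>lborel)"
      using uloc by (intro nn_integral_mono) (auto split: split_indicator)
    also have "\<dots> = M * emeasure lborel (hball \<eta> (8 * \<rho>))"
      by (rule nn_integral_cmult_indicator) simp
    also have "\<dots> \<le> M * ennreal (v2 * (8 * \<rho>) powr ?Q)"
      using \<rho> R_pos by (intro mult_left_mono vol2) auto
    finally have *: "ennreal (v1 * R powr ?Q) * emeasure \<nu> (hball \<eta> \<rho>) \<le> M * ennreal (v2 * (8 * \<rho>) powr ?Q)" .
    have pos: "0 < v1 * R powr ?Q" using v R_pos by simp
    have "emeasure \<nu> (hball \<eta> \<rho>) = ennreal (1 / (v1 * R powr ?Q)) * (ennreal (v1 * R powr ?Q) * emeasure \<nu> (hball \<eta> \<rho>))"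
    proof -
      have "ennreal (1 / (v1 * R powr ?Q)) * ennreal (v1 * R powr ?Q) = ennreal (1 / (v1 * R powr ?Q) * (v1 * R powr ?Q))"
        using pos by (intro ennreal_mult''[symmetric]) (rule less_imp_le)
      also have "1 / (v1 * R powr ?Q) * (v1 * R powr ?Q) = 1"
      proof -
        have "1 / x * x = 1" if "x \<noteq> 0" for x :: real using that by simp
        from this[OF less_imp_neq[OF pos, symmetric]] show ?thesis .
      qed
      finally show ?thesis by (simp only: mult.assoc[symmetric] ennreal_1 mult_1_left)
    qed
    also have "\<dots> \<le> ennreal (1 / (v1 * R powr ?Q)) * (M * ennreal (v2 * (8 * \<rho>) powr ?Q))"
      by (intro mult_left_mono *) auto
    also have "\<dots> = ennreal (1 / (v1 * R powr ?Q) * (v2 * (8 * \<rho>) powr ?Q)) * M"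
      using v by (intro ennreal_mult_swap) auto
    also have "1 / (v1 * R powr ?Q) * (v2 * (8 * \<rho>) powr ?Q) = v2 * 8 powr ?Q / v1 * (\<rho> / R) powr ?Q"
      using \<rho> R_pos by (simp add: powr_mult powr_divide)
    finally show "emeasure \<nu> (hball \<eta> \<rho>) \<le> ennreal (v2 * 8 powr ?Q / v1 * (\<rho> / R) powr ?Q) * M" .
  qed (use v in auto)
qed

text \<open>For large radii this is growth times the volume of the ball. For small ones Tonelli is
  applied: each zeta is counted by the volume of B(zeta, rho), and only zeta in B(eta, 8 R) count.
  The radius R drops out of the bound in both cases.\<close>

lemma integral_hball_mass:
  obtains c where "0 < c"
    "\<And>(\<nu> :: 'n::finite heis measure) R M \<eta> \<rho>. uloc_measure \<nu> R M \<Longrightarrow> 0 < \<rho> \<Longrightarrow>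
       (\<integral>\<^sup>+\<xi>\<in>hball \<eta> R. emeasure \<nu> (hball \<xi> \<rho>) \<partial>lborel) \<le> ennreal (c * \<rho> powr hdim TYPE('n)) * M"
proof -
  let ?Q = "hdim TYPE('n)"
  obtain v1 v2 where v2: "0 < v2"
    and vol: "\<And>(\<eta> :: 'n heis) r. 0 < r \<Longrightarrow> emeasure lborel (hball \<eta> r) \<le> ennreal (v2 * r powr ?Q)"
    using hball_volume by metis
  obtain c where c: "0 < c" and growth: "\<And>(\<nu> :: 'n::finite heis measure) R M \<eta> \<rho>. uloc_measure \<nu> R M \<Longrightarrow> R \<le> \<rho> \<Longrightarrow>
       emeasure \<nu> (hball \<eta> \<rho>) \<le> ennreal (c * (\<rho> / R) powr ?Q) * M"
    using hball_growth by blast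
  have Q8: "1 \<le> (8::real) powr ?Q" by (simp add: hdim_def ge_one_powr_ge_zero)
  show thesis
  proof (rule that[of "c * v2 * 8 powr ?Q"])
    fix \<nu> :: "'n heis measure" and R M \<eta> and \<rho> :: real
    assume \<nu>: "uloc_measure \<nu> R M" and \<rho>: "0 < \<rho>"
    then interpret uloc_measure \<nu> R M by simp
    show "(\<integral>\<^sup>+\<xi>\<in>hball \<eta> R. emeasure \<nu> (hball \<xi> \<rho>) \<partial>lborel) \<le> ennreal (c * v2 * 8 powr ?Q * \<rho> powr ?Q) * M"
    proof (cases "R \<le> \<rho>")
      case True
      let ?K = "ennreal (c * (\<rho> / R) powr ?Q) * M"
      have "(\<integral>\<^sup>+\<xi>\<in>hball \<eta> R. emeasure \<nu> (hball \<xi> \<rho>) \<partial>lborel) \<le> (\<integral>\<^sup>+\<xi>. ?K * indicator (hball \<eta> R) \<xi> \<partial>lborel)"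
        using growth[OF \<nu> True] by (intro nn_integral_mono mult_right_mono) auto
      also have "\<dots> = ?K * emeasure lborel (hball \<eta> R)"
        by (rule nn_integral_cmult_indicator) simp
      also have "\<dots> \<le> ?K * ennreal (v2 * R powr ?Q)"
        by (intro mult_left_mono vol R_pos) auto
      also have "\<dots> = ennreal (c * (\<rho> / R) powr ?Q * (v2 * R powr ?Q)) * M"
        using v2 by (intro ennreal_mult_right) auto
      also have "c * (\<rho> / R) powr ?Q * (v2 * R powr ?Q) = c * v2 * 1 * \<rho> powr ?Q"
        using R_pos \<rho> by (simp add: powr_divide)
      also have "ennreal (c * v2 * 1 * \<rho> powr ?Q) * M \<le> ennreal (c * v2 * 8 powr ?Q * \<rho> powr ?Q) * M"
        using c v2 Q8 by (intro mult_right_mono ennreal_leI mult_left_mono) auto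
      finally show ?thesis .
    next
      case False
      then have R: "\<rho> \<le> R" by simp
      have "(\<integral>\<^sup>+\<xi>\<in>hball \<eta> R. emeasure \<nu> (hball \<xi> \<rho>) \<partial>lborel)
          = (\<integral>\<^sup>+\<xi>. \<integral>\<^sup>+\<zeta>. indicator (hball \<eta> R) \<xi> * indicator (hball \<xi> \<rho>) \<zeta> \<partial>\<nu> \<partial>lborel)"
      proof (intro nn_integral_cong)
        fix \<xi>
        have "(\<integral>\<^sup>+\<zeta>. indicator (hball \<eta> R) \<xi> * indicator (hball \<xi> \<rho>) \<zeta> \<partial>\<nu>) = indicator (hball \<eta> R) \<xi> * emeasure \<nu> (hball \<xi> \<rho>)"
          using sets_\<nu> by (intro nn_integral_cmult_indicator) auto
        then show "emeasure \<nu> (hball \<xi> \<rho>) * indicator (hball \<eta> R) \<xi>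
            = (\<integral>\<^sup>+\<zeta>. indicator (hball \<eta> R) \<xi> * indicator (hball \<xi> \<rho>) \<zeta> \<partial>\<nu>)"
          by (simp only: mult.commute)
      qed
      also have "\<dots> = (\<integral>\<^sup>+\<zeta>. \<integral>\<^sup>+\<xi>. indicator (hball \<eta> R) \<xi> * indicator (hball \<xi> \<rho>) \<zeta> \<partial>lborel \<partial>\<nu>)"
        by (rule Fubini_\<nu>[symmetric]) measurable
      also have "\<dots> \<le> (\<integral>\<^sup>+\<zeta>. ennreal (v2 * \<rho> powr ?Q) * indicator (hball \<eta> (8 * R)) \<zeta> \<partial>\<nu>)"
      proof (intro nn_integral_mono)
        fix \<zeta>
        show "(\<integral>\<^sup>+\<xi>. indicator (hball \<eta> R) \<xi> * indicator (hball \<xi> \<rho>) \<zeta> \<partial>lborel)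
            \<le> ennreal (v2 * \<rho> powr ?Q) * indicator (hball \<eta> (8 * R)) \<zeta>"
        proof (cases "\<zeta> \<in> hball \<eta> (8 * R)")
          case True
          have "(\<integral>\<^sup>+\<xi>. indicator (hball \<eta> R) \<xi> * indicator (hball \<xi> \<rho>) \<zeta> \<partial>lborel) \<le> (\<integral>\<^sup>+\<xi>. indicator (hball \<zeta> \<rho>) \<xi> \<partial>lborel)"
            using hball_sym[of \<zeta> _ \<rho>] by (intro nn_integral_mono) (auto split: split_indicator)
          then show ?thesis using True vol[OF \<rho>, of \<zeta>] by simp
        next
          case False
          then have "indicator (hball \<eta> R) \<xi> * indicator (hball \<xi> \<rho>) \<zeta> = (0 :: ennreal)" for \<xi>
            using hball_triangle[of \<xi> \<eta> R \<zeta> \<rho>] hball_mono[of "4 * (R + \<rho>)" "8 * R" \<eta>] R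
            by (auto split: split_indicator)
          then show ?thesis by (simp only: nn_integral_const mult_zero_left zero_le)
        qed
      qed
      also have "\<dots> = ennreal (v2 * \<rho> powr ?Q) * emeasure \<nu> (hball \<eta> (8 * R))"
        using sets_\<nu> by (intro nn_integral_cmult_indicator) auto
      also have "\<dots> \<le> ennreal (v2 * \<rho> powr ?Q) * (ennreal (c * (8 * R / R) powr ?Q) * M)"
        using R_pos by (intro mult_left_mono growth \<nu>) auto
      also have "\<dots> = ennreal (v2 * \<rho> powr ?Q * (c * (8 * R / R) powr ?Q)) * M"
        using c by (intro ennreal_mult_mult) auto
      also have "v2 * \<rho> powr ?Q * (c * (8 * R / R) powr ?Q) = c * v2 * 8 powr ?Q * \<rho> powr ?Q"
        using R_pos by simp
      finally show ?thesis .
    qed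
  qed (use c v2 in auto)
qed

text \<open>A dyadic majorant, up to constants, of r^(-Q) min(1, (hnorm/r)^(-Q-e)). The k-th ball
  has volume of order 2^(kQ) r^Q, so the k-th layer has mass of order 2^(-ke).\<close>

definition hprofile :: "real \<Rightarrow> real \<Rightarrow> 'n::finite heis \<Rightarrow> ennreal" where
  "hprofile e r \<eta> = (\<Sum>k. ennreal (r powr (- hdim TYPE('n)) * 2 powr (- (real k * (hdim TYPE('n) + e))))
      * indicator {\<xi>. hnorm \<xi> < 2 ^ k * r} \<eta>)"

lemma hprofile_eq:
  "hprofile e r (hmult (hinv \<zeta>) (\<eta> :: 'n::finite heis)) =
     (\<Sum>k. ennreal (r powr (- hdim TYPE('n)) * 2 powr (- (real k * (hdim TYPE('n) + e))))
      * indicator (hball \<eta> (2 ^ k * r)) \<zeta>)"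
  unfolding hprofile_def
  by (intro suminf_cong arg_cong2[where f = times]) (auto simp: hball_def hdist_def split: split_indicator)

lemma suminf_geometric_bound:
  fixes M :: ennreal
  assumes "0 < e" "0 \<le> x" "\<And>k. f k \<le> ennreal (x * 2 powr (- (real k * e))) * M"
  shows "(\<Sum>k. f k) \<le> ennreal (x / (1 - 2 powr (- e))) * M"
proof -
  let ?q = "2 powr (- e) :: real"
  have q: "0 \<le> ?q" "?q < 1" using assms by (auto simp: powr_less_one)
  have eq: "2 powr (- (real k * e)) = ?q ^ k" for k
    by (simp only: powr_realpow[symmetric] powr_gt_zero powr_powr) (simp add: mult.commute)
  have "(\<lambda>k. x * ?q ^ k) sums (x * (1 / (1 - ?q)))"
    using q by (intro sums_mult geometric_sums) auto
  then have s: "(\<Sum>k. ennreal (x * ?q ^ k)) = ennreal (x / (1 - ?q))"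
    using assms q by (intro suminf_ennreal_eq) auto
  have "(\<Sum>k. f k) \<le> (\<Sum>k. ennreal (x * ?q ^ k) * M)"
    using assms(3) unfolding eq by (intro suminf_le) auto
  also have "\<dots> = ennreal (x / (1 - ?q)) * M" by (simp add: s)
  finally show ?thesis .
qed

lemma (in uloc_measure) nn_integral_hprofile:
  "(\<integral>\<^sup>+\<zeta>. hprofile e r (hmult (hinv \<zeta>) \<eta>) \<partial>\<nu>) =
     (\<Sum>k. ennreal (r powr (- hdim TYPE('n)) * 2 powr (- (real k * (hdim TYPE('n) + e)))) * emeasure \<nu> (hball \<eta> (2 ^ k * r)))"
proof -
  let ?a = "\<lambda>k. ennreal (r powr (- hdim TYPE('n)) * 2 powr (- (real k * (hdim TYPE('n) + e))))"
  have "(\<integral>\<^sup>+\<zeta>. (\<Sum>k. ?a k * indicator (hball \<eta> (2 ^ k * r)) \<zeta>) \<partial>\<nu>)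
      = (\<Sum>k. \<integral>\<^sup>+\<zeta>. ?a k * indicator (hball \<eta> (2 ^ k * r)) \<zeta> \<partial>\<nu>)"
    by (rule nn_integral_suminf) measurable
  also have "\<dots> = (\<Sum>k. ?a k * emeasure \<nu> (hball \<eta> (2 ^ k * r)))"
    using sets_\<nu> by (intro suminf_cong nn_integral_cmult_indicator) simp
  finally show ?thesis unfolding hprofile_eq .
qed

text \<open>In both estimates ball masses grow like 2^(kQ), which the weights cancel up to the
  geometric factor 2^(-ke).\<close>

lemma hprofile_potential_bounds:
  assumes "0 < e"
  obtains C where "0 < C"
    "\<And>(\<nu> :: 'n::finite heis measure) R M \<eta> r. uloc_measure \<nu> R M \<Longrightarrow> 0 < r \<Longrightarrow> r \<le> R \<Longrightarrow>
       (\<integral>\<^sup>+\<zeta>. hprofile e r (hmult (hinv \<zeta>) \<eta>) \<partial>\<nu>) \<le> ennreal (C * r powr (- hdim TYPE('n))) * M"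
    "\<And>(\<nu> :: 'n::finite heis measure) R M \<eta> r. uloc_measure \<nu> R M \<Longrightarrow> 0 < r \<Longrightarrow> r \<le> R \<Longrightarrow>
       (\<integral>\<^sup>+\<xi>\<in>hball \<eta> R. (\<integral>\<^sup>+\<zeta>. hprofile e r (hmult (hinv \<zeta>) \<xi>) \<partial>\<nu>) \<partial>lborel) \<le> ennreal C * M"
proof -
  let ?Q = "hdim TYPE('n)"
  obtain c where c: "0 < c" and growth: "\<And>(\<nu> :: 'n::finite heis measure) R M \<eta> \<rho>. uloc_measure \<nu> R M \<Longrightarrow> R \<le> \<rho> \<Longrightarrow>
       emeasure \<nu> (hball \<eta> \<rho>) \<le> ennreal (c * (\<rho> / R) powr ?Q) * M"
    using hball_growth by blast
  obtain d where d: "0 < d" and mass: "\<And>(\<nu> :: 'n::finite heis measure) R M \<eta> \<rho>. uloc_measure \<nu> R M \<Longrightarrow> 0 < \<rho> \<Longrightarrow>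
       (\<integral>\<^sup>+\<xi>\<in>hball \<eta> R. emeasure \<nu> (hball \<xi> \<rho>) \<partial>lborel) \<le> ennreal (d * \<rho> powr ?Q) * M"
    using integral_hball_mass by blast
  define q where "q = 1 - 2 powr (- e)"
  have q: "0 < q" using assms by (simp add: q_def powr_less_one)
  have pw: "2 powr (- (real k * (?Q + e))) * (2 ^ k) powr ?Q = 2 powr (- (real k * e))" for k
  proof -
    have "(2 ^ k :: real) = 2 powr real k" by (simp add: powr_realpow)
    then have "(2 ^ k :: real) powr ?Q = 2 powr (real k * ?Q)" by (simp only: powr_powr)
    then show ?thesis by (simp only: powr_add[symmetric]) (simp add: algebra_simps)
  qed
  show thesis
  proof (rule that[of "(c + d) / q"])
    show "0 < (c + d) / q" using c d q by simp
    fix \<nu> :: "'n heis measure" and R M \<eta> and r :: real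
    assume \<nu>: "uloc_measure \<nu> R M" and r: "0 < r" "r \<le> R"
    then interpret uloc_measure \<nu> R M by simp
    let ?a = "\<lambda>k. r powr (- ?Q) * 2 powr (- (real k * (?Q + e)))"
    have "(\<integral>\<^sup>+\<zeta>. hprofile e r (hmult (hinv \<zeta>) \<eta>) \<partial>\<nu>) \<le> ennreal (c * r powr (- ?Q) / (1 - 2 powr (- e))) * M"
      unfolding nn_integral_hprofile
    proof (rule suminf_geometric_bound[OF assms])
      fix k
      \<comment> \<open>Radii below R are not covered by the growth lemma, so r is first enlarged to
        R; only r^(-Q) in front remembers r.\<close>
      have "emeasure \<nu> (hball \<eta> (2 ^ k * r)) \<le> emeasure \<nu> (hball \<eta> (2 ^ k * R))"
        using r sets_\<nu> by (intro emeasure_mono hball_mono mult_left_mono) auto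
      also have "\<dots> \<le> ennreal (c * (2 ^ k * R / R) powr ?Q) * M"
        using R_pos by (intro growth \<nu>) auto
      finally have "ennreal (?a k) * emeasure \<nu> (hball \<eta> (2 ^ k * r)) \<le> ennreal (?a k) * (ennreal (c * (2 ^ k) powr ?Q) * M)"
        using R_pos by (intro mult_left_mono) auto
      also have "\<dots> = ennreal (?a k * (c * (2 ^ k) powr ?Q)) * M"
        using c by (intro ennreal_mult_mult) auto
      also have "?a k * (c * (2 ^ k) powr ?Q) = c * r powr (- ?Q) * (2 powr (- (real k * (?Q + e))) * (2 ^ k) powr ?Q)"
        by (simp only: mult_ac)
      finally show "ennreal (?a k) * emeasure \<nu> (hball \<eta> (2 ^ k * r)) \<le> ennreal (c * r powr (- ?Q) * 2 powr (- (real k * e))) * M"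
        unfolding pw .
    qed (use c in auto)
    also have "\<dots> \<le> ennreal ((c + d) / q * r powr (- ?Q)) * M"
      unfolding q_def[symmetric] using c d q
      by (intro mult_right_mono ennreal_leI) (auto simp: divide_right_mono mult_right_mono)
    finally show "(\<integral>\<^sup>+\<zeta>. hprofile e r (hmult (hinv \<zeta>) \<eta>) \<partial>\<nu>) \<le> ennreal ((c + d) / q * r powr (- ?Q)) * M" .
    have "(\<integral>\<^sup>+\<xi>\<in>hball \<eta> R. (\<integral>\<^sup>+\<zeta>. hprofile e r (hmult (hinv \<zeta>) \<xi>) \<partial>\<nu>) \<partial>lborel)
        = (\<integral>\<^sup>+\<xi>. (\<Sum>k. ennreal (?a k) * (emeasure \<nu> (hball \<xi> (2 ^ k * r)) * indicator (hball \<eta> R) \<xi>)) \<partial>lborel)"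
      unfolding nn_integral_hprofile by (simp only: ennreal_suminf_multc[symmetric] mult.assoc)
    also have "\<dots> = (\<Sum>k. ennreal (?a k) * (\<integral>\<^sup>+\<xi>\<in>hball \<eta> R. emeasure \<nu> (hball \<xi> (2 ^ k * r)) \<partial>lborel))"
    proof (subst nn_integral_suminf)
      show "(\<lambda>\<xi>. ennreal (?a k) * (emeasure \<nu> (hball \<xi> (2 ^ k * r)) * indicator (hball \<eta> R) \<xi>)) \<in> borel_measurable lborel" for k
        by measurable
      show "(\<Sum>k. \<integral>\<^sup>+\<xi>. ennreal (?a k) * (emeasure \<nu> (hball \<xi> (2 ^ k * r)) * indicator (hball \<eta> R) \<xi>) \<partial>lborel)
        = (\<Sum>k. ennreal (?a k) * (\<integral>\<^sup>+\<xi>\<in>hball \<eta> R. emeasure \<nu> (hball \<xi> (2 ^ k * r)) \<partial>lborel))"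
        by (intro suminf_cong nn_integral_cmult) measurable
    qed
    also have "\<dots> \<le> ennreal (d / (1 - 2 powr (- e))) * M"
    proof (rule suminf_geometric_bound[OF assms])
      fix k
      have "ennreal (?a k) * (\<integral>\<^sup>+\<xi>\<in>hball \<eta> R. emeasure \<nu> (hball \<xi> (2 ^ k * r)) \<partial>lborel)
          \<le> ennreal (?a k) * (ennreal (d * (2 ^ k * r) powr ?Q) * M)"
        using r by (intro mult_left_mono mass \<nu>) auto
      also have "\<dots> = ennreal (?a k * (d * (2 ^ k * r) powr ?Q)) * M"
        using d by (intro ennreal_mult_mult) auto
      also have "?a k * (d * (2 ^ k * r) powr ?Q) = d * (r powr (- ?Q) * r powr ?Q) * (2 powr (- (real k * (?Q + e))) * (2 ^ k) powr ?Q)"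
        unfolding powr_mult[of "2 ^ k" r] by (simp only: mult_ac)
      also have "r powr (- ?Q) * r powr ?Q = 1" using r by (simp flip: powr_add)
      finally show "ennreal (?a k) * (\<integral>\<^sup>+\<xi>\<in>hball \<eta> R. emeasure \<nu> (hball \<xi> (2 ^ k * r)) \<partial>lborel)
          \<le> ennreal (d * 2 powr (- (real k * e))) * M"
        unfolding pw by simp
    qed (use d in auto)
    also have "\<dots> \<le> ennreal ((c + d) / q) * M"
      unfolding q_def[symmetric] using c d q
      by (intro mult_right_mono ennreal_leI) (auto simp: divide_right_mono)
    finally show "(\<integral>\<^sup>+\<xi>\<in>hball \<eta> R. (\<integral>\<^sup>+\<zeta>. hprofile e r (hmult (hinv \<zeta>) \<xi>) \<partial>\<nu>) \<partial>lborel) \<le> ennreal ((c + d) / q) * M" .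
  qed
qed

text \<open>A single term of the series suffices, that of the first dyadic ball containing the
  point. If it is not the innermost one, the point lies outside the preceding ball and the far bound
  applies there, one dyadic step costing the factor 2^(Q+e) in \<open>D\<close>.\<close>

lemma G_le_hprofile:
  assumes "0 < \<alpha>" "\<alpha> \<le> 2"
  obtains C where "0 < C"
    "\<And>(\<eta> :: 'n::finite heis) t. 0 < t \<Longrightarrow> ennreal (G \<alpha> \<eta> t) \<le> ennreal C * hprofile (\<alpha> / 2) (t powr (1 / \<alpha>)) \<eta>"
proof -
  let ?Q = "hdim TYPE('n)"
  let ?e = "\<alpha> / 2"
  have Q: "0 < ?Q" by (simp add: hdim_def add_pos_nonneg)
  obtain C where C: "0 < C"
    and near: "\<And>(\<eta> :: 'n heis) t. 0 < t \<Longrightarrow> \<bar>G \<alpha> \<eta> t\<bar> \<le> C * t powr (- (?Q / \<alpha>))"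
    and far: "\<And>(\<eta> :: 'n heis) t. 0 < t \<Longrightarrow> 0 < hnorm \<eta> \<Longrightarrow>
        \<bar>G \<alpha> \<eta> t\<bar> \<le> C * hnorm \<eta> powr (- (?Q + ?e)) * t powr (1 / 2)"
    using G_bound[OF assms] by blast
  define D where "D = C * 2 powr (?Q + ?e)"
  have CD: "C \<le> D" using C Q assms by (simp add: D_def ge_one_powr_ge_zero)
  have D: "0 < D" using C by (simp add: D_def)
  show thesis
  proof (rule that[OF D])
    fix \<eta> :: "'n heis" and t :: real assume t: "0 < t"
    define r where "r = t powr (1 / \<alpha>)"
    have r: "0 < r" using t by (simp add: r_def)
    let ?a = "\<lambda>k. r powr (- ?Q) * 2 powr (- (real k * (?Q + ?e)))"
    obtain k0 where "hnorm \<eta> / r < 2 ^ k0" using real_arch_pow[of 2] by auto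
    then have ex: "hnorm \<eta> < 2 ^ k0 * r" using r by (simp add: field_simps)
    define k where "k = (LEAST k. hnorm \<eta> < 2 ^ k * r)"
    have k: "hnorm \<eta> < 2 ^ k * r" unfolding k_def by (rule LeastI[of _ k0]) (rule ex)
    have "\<bar>G \<alpha> \<eta> t\<bar> \<le> D * ?a k"
    proof (cases k)
      case 0
      have "t powr (- (?Q / \<alpha>)) = r powr (- ?Q)" by (simp add: r_def powr_powr)
      then show ?thesis using near[OF t, of \<eta>] CD 0
        by (simp add: order_trans[OF _ mult_right_mono[OF CD]])
    next
      case (Suc j)
      have "\<not> hnorm \<eta> < 2 ^ j * r" using not_less_Least[of j "\<lambda>k. hnorm \<eta> < 2 ^ k * r"] Suc by (simp add: k_def)
      then have j: "2 ^ j * r \<le> hnorm \<eta>" by simp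
      have pos: "0 < 2 ^ j * r" using r by simp
      have "hnorm \<eta> powr (- (?Q + ?e)) \<le> (2 ^ j * r) powr (- (?Q + ?e))"
        using j pos Q assms by (intro powr_mono2') auto
      also have "\<dots> = 2 powr (- (real j * (?Q + ?e))) * r powr (- (?Q + ?e))"
      proof -
        have "(2 ^ j :: real) = 2 powr real j" by (simp add: powr_realpow)
        then show ?thesis unfolding powr_mult by (simp only: powr_powr mult_minus_right)
      qed
      also have "r powr (- (?Q + ?e)) = r powr (- ?Q) * r powr (- ?e)"
        unfolding powr_add[symmetric] by simp
      also have "r powr (- ?e) = t powr (- (1 / 2))" using assms by (simp add: r_def powr_powr)
      also have "2 powr (- (real j * (?Q + ?e))) = 2 powr (?Q + ?e) * 2 powr (- (real k * (?Q + ?e)))"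
      proof -
        have "- (real j * (?Q + ?e)) = (?Q + ?e) + - (real k * (?Q + ?e))"
          unfolding Suc of_nat_Suc distrib_right by simp
        then show ?thesis by (simp only: powr_add)
      qed
      finally have "hnorm \<eta> powr (- (?Q + ?e)) \<le> 2 powr (?Q + ?e) * 2 powr (- (real k * (?Q + ?e))) * (r powr (- ?Q) * t powr (- (1 / 2)))" .
      then have "C * hnorm \<eta> powr (- (?Q + ?e)) * t powr (1 / 2)
          \<le> C * (2 powr (?Q + ?e) * 2 powr (- (real k * (?Q + ?e))) * (r powr (- ?Q) * t powr (- (1 / 2)))) * t powr (1 / 2)"
        using C by (intro mult_right_mono mult_left_mono) auto
      also have "\<dots> = D * ?a k * (t powr (- (1 / 2)) * t powr (1 / 2))" unfolding D_def by (simp only: mult_ac)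
      also have "t powr (- (1 / 2)) * t powr (1 / 2) = 1" unfolding powr_add[symmetric] using t by simp
      finally show ?thesis using far[OF t, of \<eta>] j pos by simp
    qed
    then have "ennreal (G \<alpha> \<eta> t) \<le> ennreal (D * ?a k)" by (intro ennreal_leI) simp
    also have "\<dots> = ennreal D * (ennreal (?a k) * indicator {\<xi>. hnorm \<xi> < 2 ^ k * r} \<eta>)"
      using k D by (simp add: ennreal_mult)
    also have "\<dots> \<le> ennreal D * hprofile ?e r \<eta>"
    proof (intro mult_left_mono)
      define g where "g k = ennreal (?a k) * indicator {\<xi>. hnorm \<xi> < 2 ^ k * r} \<eta>" for k
      have "sum g {k} \<le> suminf g" by (rule sum_le_suminf) auto
      then show "ennreal (?a k) * indicator {\<xi>. hnorm \<xi> < 2 ^ k * r} \<eta> \<le> hprofile ?e r \<eta>"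
        unfolding hprofile_def g_def[symmetric] by simp
    qed simp
    finally show "ennreal (G \<alpha> \<eta> t) \<le> ennreal D * hprofile ?e (t powr (1 / \<alpha>)) \<eta>"
      unfolding r_def .
  qed
qed

section \<open>Joint measurability of the kernels, and their potentials\<close>

lemma borel_measurable_fst' [measurable (raw)]:
  fixes f :: "'a \<Rightarrow> 'b::second_countable_topology \<times> 'c::second_countable_topology"
  shows "f \<in> borel_measurable M \<Longrightarrow> (\<lambda>x. fst (f x)) \<in> borel_measurable M"
  by (rule measurable_compose[of f M borel]) (auto intro!: borel_measurable_continuous_onI continuous_intros)

lemma borel_measurable_snd' [measurable (raw)]:
  fixes f :: "'a \<Rightarrow> 'b::second_countable_topology \<times> 'c::second_countable_topology"
  shows "f \<in> borel_measurable M \<Longrightarrow> (\<lambda>x. snd (f x)) \<in> borel_measurable M"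
  by (rule measurable_compose[of f M borel]) (auto intro!: borel_measurable_continuous_onI continuous_intros)

lemma heat_kernel_measurable [measurable (raw)]:
  assumes [measurable]: "f \<in> borel_measurable M" "g \<in> borel_measurable M"
  shows "(\<lambda>x. heat_kernel (f x :: 'n::finite heis) (g x)) \<in> borel_measurable M"
proof -
  have eq: "heat_kernel \<eta> t = (1 / (2 * pi)) * (LINT l|lborel. cos (l * snd (snd \<eta>)) * (l / (pi * sinh (4 * l * t))) ^ CARD('n)
        * exp (- (l * cosh (4 * l * t) / sinh (4 * l * t)) * (norm (fst \<eta>) ^ 2 + norm (fst (snd \<eta>)) ^ 2)))"
    for \<eta> :: "'n heis" and t by (cases \<eta>) (simp add: heat_kernel_def)
  show ?thesis unfolding eq by measurable
qed

lemma stable_density_measurable [measurable (raw)]: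
  assumes [measurable]: "f \<in> borel_measurable M" "g \<in> borel_measurable M"
  shows "(\<lambda>x. stable_density \<sigma> (f x) (g x)) \<in> borel_measurable M"
  unfolding stable_density_def set_lebesgue_integral_def by measurable

lemma G_measurable [measurable (raw)]:
  assumes [measurable]: "f \<in> borel_measurable M" "g \<in> borel_measurable M"
  shows "(\<lambda>x. G \<alpha> (f x :: 'n::finite heis) (g x)) \<in> borel_measurable M"
proof (cases "\<alpha> = 2")
  case True
  then show ?thesis by (simp add: G_def)
next
  case False
  have "(\<lambda>x. LINT s|lborel. indicator {0<..} s *\<^sub>R (stable_density (\<alpha> / 2) (g x) s * heat_kernel (f x) s)) \<in> borel_measurable M"
    by measurable
  then show ?thesis using False by (simp add: G_def set_lebesgue_integral_def)
qed

text \<open>The bounds of the profile at scale r = t^(1/alpha). The third comes from the first: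
  Lebesgue measure is uniformly locally finite at that very scale with M of order t^(Q/alpha), which
  cancels the power of t.\<close>

lemma G_potential_bounds:
  assumes "0 < \<alpha>" "\<alpha> \<le> 2"
  obtains C where "0 < C"
    "\<And>(\<nu> :: 'n::finite heis measure) R M \<eta> t. uloc_measure \<nu> R M \<Longrightarrow> 0 < t \<Longrightarrow> t powr (1 / \<alpha>) \<le> R \<Longrightarrow>
       (\<integral>\<^sup>+\<zeta>. ennreal (G \<alpha> (hmult (hinv \<zeta>) \<eta>) t) \<partial>\<nu>) \<le> ennreal (C * t powr (- (hdim TYPE('n) / \<alpha>))) * M"
    "\<And>(\<nu> :: 'n::finite heis measure) R M \<eta> t. uloc_measure \<nu> R M \<Longrightarrow> 0 < t \<Longrightarrow> t powr (1 / \<alpha>) \<le> R \<Longrightarrow>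
       (\<integral>\<^sup>+\<xi>\<in>hball \<eta> R. (\<integral>\<^sup>+\<zeta>. ennreal (G \<alpha> (hmult (hinv \<zeta>) \<xi>) t) \<partial>\<nu>) \<partial>lborel) \<le> ennreal C * M"
    "\<And>(\<eta> :: 'n heis) t. 0 < t \<Longrightarrow> (\<integral>\<^sup>+\<zeta>. ennreal (G \<alpha> (hmult (hinv \<zeta>) \<eta>) t) \<partial>lborel) \<le> ennreal C"
proof -
  let ?Q = "hdim TYPE('n)"
  obtain C where C: "0 < C" and le: "\<And>(\<eta> :: 'n::finite heis) t. 0 < t \<Longrightarrow>
      ennreal (G \<alpha> \<eta> t) \<le> ennreal C * hprofile (\<alpha> / 2) (t powr (1 / \<alpha>)) \<eta>"
    using G_le_hprofile[OF assms] by blast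
  have e: "0 < \<alpha> / 2" using assms by simp
  obtain D where D: "0 < D"
    and pt: "\<And>(\<nu> :: 'n::finite heis measure) R M \<eta> r. uloc_measure \<nu> R M \<Longrightarrow> 0 < r \<Longrightarrow> r \<le> R \<Longrightarrow>
       (\<integral>\<^sup>+\<zeta>. hprofile (\<alpha> / 2) r (hmult (hinv \<zeta>) \<eta>) \<partial>\<nu>) \<le> ennreal (D * r powr (- ?Q)) * M"
    and mass: "\<And>(\<nu> :: 'n::finite heis measure) R M \<eta> r. uloc_measure \<nu> R M \<Longrightarrow> 0 < r \<Longrightarrow> r \<le> R \<Longrightarrow>
       (\<integral>\<^sup>+\<xi>\<in>hball \<eta> R. (\<integral>\<^sup>+\<zeta>. hprofile (\<alpha> / 2) r (hmult (hinv \<zeta>) \<xi>) \<partial>\<nu>) \<partial>lborel) \<le> ennreal D * M"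
    using hprofile_potential_bounds[OF e] by blast
  obtain v1 v2 where v2: "0 < v2"
    and vol: "\<And>(\<eta> :: 'n heis) r. 0 < r \<Longrightarrow> emeasure lborel (hball \<eta> r) \<le> ennreal (v2 * r powr ?Q)"
    using hball_volume by metis
  have prof: "(\<integral>\<^sup>+\<zeta>. ennreal (G \<alpha> (hmult (hinv \<zeta>) \<eta>) t) \<partial>\<nu>)
      \<le> ennreal C * (\<integral>\<^sup>+\<zeta>. hprofile (\<alpha> / 2) (t powr (1 / \<alpha>)) (hmult (hinv \<zeta>) \<eta>) \<partial>\<nu>)"
    if \<nu>: "uloc_measure \<nu> R M" and t: "0 < t" for \<nu> :: "'n heis measure" and R M \<eta> t
  proof -
    interpret uloc_measure \<nu> R M by fact
    have "(\<integral>\<^sup>+\<zeta>. ennreal (G \<alpha> (hmult (hinv \<zeta>) \<eta>) t) \<partial>\<nu>)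
      \<le> (\<integral>\<^sup>+\<zeta>. ennreal C * hprofile (\<alpha> / 2) (t powr (1 / \<alpha>)) (hmult (hinv \<zeta>) \<eta>) \<partial>\<nu>)"
      by (intro nn_integral_mono le t)
    also have "\<dots> = ennreal C * (\<integral>\<^sup>+\<zeta>. hprofile (\<alpha> / 2) (t powr (1 / \<alpha>)) (hmult (hinv \<zeta>) \<eta>) \<partial>\<nu>)"
      unfolding hprofile_eq by (rule nn_integral_cmult) measurable
    finally show ?thesis .
  qed
  have I: "(\<integral>\<^sup>+\<zeta>. ennreal (G \<alpha> (hmult (hinv \<zeta>) \<eta>) t) \<partial>\<nu>) \<le> ennreal (C * D * t powr (- (?Q / \<alpha>))) * M"
    if \<nu>: "uloc_measure \<nu> R M" and t: "0 < t" "t powr (1 / \<alpha>) \<le> R" for \<nu> :: "'n heis measure" and R M \<eta> t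
  proof -
    have "(\<integral>\<^sup>+\<zeta>. ennreal (G \<alpha> (hmult (hinv \<zeta>) \<eta>) t) \<partial>\<nu>)
      \<le> ennreal C * (ennreal (D * (t powr (1 / \<alpha>)) powr (- ?Q)) * M)"
      using t by (intro order_trans[OF prof[OF \<nu>]] mult_left_mono pt[OF \<nu>]) auto
    also have "\<dots> = ennreal (C * (D * (t powr (1 / \<alpha>)) powr (- ?Q))) * M"
      using D by (intro ennreal_mult_mult) auto
    finally show ?thesis by (simp add: powr_powr mult.assoc)
  qed
  have II: "(\<integral>\<^sup>+\<xi>\<in>hball \<eta> R. (\<integral>\<^sup>+\<zeta>. ennreal (G \<alpha> (hmult (hinv \<zeta>) \<xi>) t) \<partial>\<nu>) \<partial>lborel) \<le> ennreal (C * D) * M"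
    if \<nu>: "uloc_measure \<nu> R M" and t: "0 < t" "t powr (1 / \<alpha>) \<le> R" for \<nu> :: "'n heis measure" and R M \<eta> t
  proof -
    interpret uloc_measure \<nu> R M by fact
    let ?P = "\<lambda>\<xi>. \<integral>\<^sup>+\<zeta>. hprofile (\<alpha> / 2) (t powr (1 / \<alpha>)) (hmult (hinv \<zeta>) \<xi>) \<partial>\<nu>"
    have "(\<integral>\<^sup>+\<xi>\<in>hball \<eta> R. (\<integral>\<^sup>+\<zeta>. ennreal (G \<alpha> (hmult (hinv \<zeta>) \<xi>) t) \<partial>\<nu>) \<partial>lborel)
      \<le> (\<integral>\<^sup>+\<xi>. ennreal C * (?P \<xi> * indicator (hball \<eta> R) \<xi>) \<partial>lborel)"
      using prof[OF \<nu> t(1)] by (intro nn_integral_mono) (auto split: split_indicator)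
    also have "\<dots> = ennreal C * (\<integral>\<^sup>+\<xi>\<in>hball \<eta> R. ?P \<xi> \<partial>lborel)"
      unfolding nn_integral_hprofile by (rule nn_integral_cmult) measurable
    also have "\<dots> \<le> ennreal C * (ennreal D * M)"
      using t by (intro mult_left_mono mass \<nu>) auto
    also have "\<dots> = ennreal (C * D) * M" using D by (intro ennreal_mult_mult) auto
    finally show ?thesis .
  qed
  have III: "(\<integral>\<^sup>+\<zeta>. ennreal (G \<alpha> (hmult (hinv \<zeta>) \<eta>) t) \<partial>lborel) \<le> ennreal (C * D * v2)"
    if t: "0 < t" for \<eta> :: "'n heis" and t
  proof -
    let ?r = "t powr (1 / \<alpha>)"
    have r: "0 < ?r" using t by simp
    have "uloc_measure (lborel :: 'n heis measure) ?r (ennreal (v2 * ?r powr ?Q))"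
      using r vol by (intro uloc_measure.intro lborel.sigma_finite_measure_axioms) auto
    from I[OF this t] have "(\<integral>\<^sup>+\<zeta>. ennreal (G \<alpha> (hmult (hinv \<zeta>) \<eta>) t) \<partial>lborel)
        \<le> ennreal (C * D * t powr (- (?Q / \<alpha>))) * ennreal (v2 * ?r powr ?Q)" by simp
    also have "\<dots> = ennreal (C * D * t powr (- (?Q / \<alpha>)) * (v2 * ?r powr ?Q))"
      using v2 by (intro ennreal_mult''[symmetric]) auto
    also have "C * D * t powr (- (?Q / \<alpha>)) * (v2 * ?r powr ?Q) = C * D * v2 * (t powr (- (?Q / \<alpha>)) * t powr (?Q / \<alpha>))"
      by (simp add: powr_powr)
    also have "t powr (- (?Q / \<alpha>)) * t powr (?Q / \<alpha>) = 1"
      unfolding powr_add[symmetric] using t by simp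
    finally show ?thesis by simp
  qed
  define K where "K = C * D + C * D * v2"
  have K: "0 < K" "C * D \<le> K" "C * D * v2 \<le> K" using C D v2 by (auto simp: K_def intro!: add_pos_pos)
  show thesis
  proof (rule that[OF K(1)])
    fix \<nu> :: "'n heis measure" and R M \<eta> t
    assume a: "uloc_measure \<nu> R M" "0 < t" "t powr (1 / \<alpha>) \<le> R"
    show "(\<integral>\<^sup>+\<zeta>. ennreal (G \<alpha> (hmult (hinv \<zeta>) \<eta>) t) \<partial>\<nu>) \<le> ennreal (K * t powr (- (?Q / \<alpha>))) * M"
      by (rule order_trans[OF I[OF a]]) (intro mult_right_mono ennreal_leI K, auto)
    show "(\<integral>\<^sup>+\<xi>\<in>hball \<eta> R. (\<integral>\<^sup>+\<zeta>. ennreal (G \<alpha> (hmult (hinv \<zeta>) \<xi>) t) \<partial>\<nu>) \<partial>lborel) \<le> ennreal K * M"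
      by (rule order_trans[OF II[OF a]]) (intro mult_right_mono ennreal_leI K, auto)
  next
    fix \<eta> :: "'n heis" and t :: real assume "0 < t"
    then show "(\<integral>\<^sup>+\<zeta>. ennreal (G \<alpha> (hmult (hinv \<zeta>) \<eta>) t) \<partial>lborel) \<le> ennreal K"
      by (intro order_trans[OF III] ennreal_leI K)
  qed
qed

section \<open>The Duhamel operator and the Picard iteration\<close>

text \<open>Values in \<open>ennreal\<close> make every iterate meaningful before it is known to be
  finite. The power is taken through \<open>enn2real\<close>, which sends infinity to 0, so
  statements about this operator carry finiteness hypotheses.\<close>

definition duhamel :: "real \<Rightarrow> real \<Rightarrow> ('n::finite heis \<Rightarrow> real \<Rightarrow> ennreal) \<Rightarrow> 'n heis \<Rightarrow> real \<Rightarrow> ennreal" where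
  "duhamel \<alpha> p f \<eta> t = (\<integral>\<^sup>+ s\<in>{0<..<t}. (\<integral>\<^sup>+ \<zeta>.
      ennreal (G \<alpha> (hmult (hinv \<zeta>) \<eta>) (t - s) * enn2real (f \<zeta> s) powr p) \<partial>lborel) \<partial>lborel)"

lemma indicator_greaterThanLessThan_measurable [measurable (raw)]:
  fixes f g h :: "'a \<Rightarrow> real"
  assumes [measurable]: "f \<in> borel_measurable M" "g \<in> borel_measurable M" "h \<in> borel_measurable M"
  shows "(\<lambda>x. indicator {f x<..<g x} (h x) :: ennreal) \<in> borel_measurable M"
  unfolding indicator_def greaterThanLessThan_iff by measurable

lemma duhamel_integrand_measurable:
  assumes [measurable]: "(\<lambda>z. f (fst z) (snd z)) \<in> borel_measurable (borel :: ('n::finite heis \<times> real) measure)"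
    and "a \<in> borel_measurable M" "b \<in> borel_measurable M" "c \<in> borel_measurable M" "d \<in> borel_measurable M"
  shows "(\<lambda>x. ennreal (G \<alpha> (hmult (hinv (a x)) (b x)) (c x) * enn2real (f (a x) (d x)) powr p)) \<in> borel_measurable M"
proof -
  note [measurable] = assms
  have "(\<lambda>x. (a x, d x)) \<in> borel_measurable M" by measurable
  from measurable_compose[OF this assms(1)] have [measurable]: "(\<lambda>x. f (a x) (d x)) \<in> borel_measurable M" by simp
  show ?thesis by measurable
qed

lemma duhamel_measurable:
  assumes f: "(\<lambda>z. f (fst z) (snd z)) \<in> borel_measurable (borel :: ('n::finite heis \<times> real) measure)"
    and [measurable]: "a \<in> borel_measurable M" "b \<in> borel_measurable M"
  shows "(\<lambda>x. duhamel \<alpha> p f (a x) (b x)) \<in> borel_measurable M"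
proof -
  have "(\<lambda>w. ennreal (G \<alpha> (hmult (hinv (snd w)) (a (fst (fst w)))) (b (fst (fst w)) - snd (fst w))
      * enn2real (f (snd w) (snd (fst w))) powr p)) \<in> borel_measurable ((M \<Otimes>\<^sub>M lborel) \<Otimes>\<^sub>M lborel)"
    by (rule duhamel_integrand_measurable[OF f]) measurable
  then have "(\<lambda>v. \<integral>\<^sup>+ \<zeta>. ennreal (G \<alpha> (hmult (hinv \<zeta>) (a (fst v))) (b (fst v) - snd v)
      * enn2real (f \<zeta> (snd v)) powr p) \<partial>lborel) \<in> borel_measurable (M \<Otimes>\<^sub>M lborel)"
    by (intro lborel.borel_measurable_nn_integral) (simp add: case_prod_beta')
  then have "(\<lambda>v. (\<integral>\<^sup>+ \<zeta>. ennreal (G \<alpha> (hmult (hinv \<zeta>) (a (fst v))) (b (fst v) - snd v)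
      * enn2real (f \<zeta> (snd v)) powr p) \<partial>lborel) * indicator {0<..<b (fst v)} (snd v)) \<in> borel_measurable (M \<Otimes>\<^sub>M lborel)"
    by measurable
  then show ?thesis unfolding duhamel_def
    by (intro lborel.borel_measurable_nn_integral) (simp add: case_prod_beta')
qed

lemma nn_integral_powr_0:
  assumes "\<beta> < 1" "0 < t" "0 \<le> K"
  shows "(\<integral>\<^sup>+ s\<in>{0<..<t}. ennreal (K * s powr (- \<beta>)) \<partial>lborel) \<le> ennreal (K / (1 - \<beta>) * t powr (1 - \<beta>))"
proof -
  have "(\<integral>\<^sup>+ s\<in>{0<..<t}. ennreal (K * s powr (- \<beta>)) \<partial>lborel) \<le> (\<integral>\<^sup>+ s\<in>{0..t}. ennreal (K * s powr (- \<beta>)) \<partial>lborel)"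
    by (intro nn_integral_mono) (auto split: split_indicator)
  also have "\<dots> = ennreal (K * (t powr (- \<beta> + 1) / (- \<beta> + 1)))"
    using assms by (intro nn_integral_has_integral_lebesgue' has_integral_mult_right has_integral_powr_from_0) auto
  also have "K * (t powr (- \<beta> + 1) / (- \<beta> + 1)) = K / (1 - \<beta>) * t powr (1 - \<beta>)" by simp
  finally show ?thesis .
qed

text \<open>Writing f^p \<le> (sup f)^(p-1) f shows that the source at time s has local mass at most
  A^p s^(-beta), with beta = q (p - 1) < 1. For s \<le> t/2 this mass is smoothed by the kernel, at
  a cost of order t^(-q). For s > t/2 the sup bound of the source is used with the bounded mass of
  the kernel, and s^(-q) is of order t^(-q). Both halves have the integrable factor
  s^(-beta).\<close>

lemma duhamel_bounds:
  assumes \<alpha>: "0 < \<alpha>" "\<alpha> \<le> 2" and p: "1 < p" "p < 1 + \<alpha> / hdim TYPE('n::finite)"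
  defines "q \<equiv> hdim TYPE('n) / \<alpha>"
  obtains K where "0 < K"
    "\<And>f A T (\<eta> :: 'n heis) t. (\<lambda>z. f (fst z) (snd z)) \<in> borel_measurable (borel :: ('n heis \<times> real) measure) \<Longrightarrow>
      0 < A \<Longrightarrow> (\<And>\<zeta> s. 0 < s \<Longrightarrow> s < T \<Longrightarrow> f \<zeta> s \<le> ennreal (A * s powr (- q))) \<Longrightarrow>
      (\<And>\<eta> s. 0 < s \<Longrightarrow> s < T \<Longrightarrow> (\<integral>\<^sup>+\<xi>\<in>hball \<eta> (T powr (1 / \<alpha>)). f \<xi> s \<partial>lborel) \<le> ennreal A) \<Longrightarrow> 0 < t \<Longrightarrow> t < T \<Longrightarrow>
      duhamel \<alpha> p f \<eta> t \<le> ennreal (K * A powr p * T powr (1 - q * (p - 1)) * t powr (- q)) \<and>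
      (\<integral>\<^sup>+\<xi>\<in>hball \<eta> (T powr (1 / \<alpha>)). duhamel \<alpha> p f \<xi> t \<partial>lborel) \<le> ennreal (K * A powr p * T powr (1 - q * (p - 1)))"
proof -
  obtain C where C: "0 < C"
    and C1: "\<And>(\<nu> :: 'n::finite heis measure) R M \<eta> t. uloc_measure \<nu> R M \<Longrightarrow> 0 < t \<Longrightarrow> t powr (1 / \<alpha>) \<le> R \<Longrightarrow>
       (\<integral>\<^sup>+\<zeta>. ennreal (G \<alpha> (hmult (hinv \<zeta>) \<eta>) t) \<partial>\<nu>) \<le> ennreal (C * t powr (- q)) * M"
    and C2: "\<And>(\<nu> :: 'n::finite heis measure) R M \<eta> t. uloc_measure \<nu> R M \<Longrightarrow> 0 < t \<Longrightarrow> t powr (1 / \<alpha>) \<le> R \<Longrightarrow>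
       (\<integral>\<^sup>+\<xi>\<in>hball \<eta> R. (\<integral>\<^sup>+\<zeta>. ennreal (G \<alpha> (hmult (hinv \<zeta>) \<xi>) t) \<partial>\<nu>) \<partial>lborel) \<le> ennreal C * M"
    and C3: "\<And>(\<eta> :: 'n heis) t. 0 < t \<Longrightarrow> (\<integral>\<^sup>+\<zeta>. ennreal (G \<alpha> (hmult (hinv \<zeta>) \<eta>) t) \<partial>lborel) \<le> ennreal C"
    using G_potential_bounds[OF \<alpha>] unfolding q_def by blast
  define \<beta> where "\<beta> = q * (p - 1)"
  have Q: "0 < hdim TYPE('n)" by (simp add: hdim_def add_pos_nonneg)
  have q: "0 < q" using Q \<alpha> by (simp add: q_def)
  have \<beta>: "\<beta> < 1" using p(2) Q \<alpha> by (simp add: \<beta>_def q_def field_simps)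
  have q2: "1 \<le> (2::real) powr q" using q by (simp add: ge_one_powr_ge_zero)
  define K where "K = C * 2 powr q / (1 - \<beta>)"
  show thesis
  proof (rule that[of K])
    show "0 < K" using C \<beta> by (simp add: K_def)
    fix f A T and \<eta> :: "'n heis" and t :: real
    assume f: "(\<lambda>z. f (fst z) (snd z)) \<in> borel_measurable (borel :: ('n heis \<times> real) measure)"
      and A: "0 < A" and sup: "\<And>\<zeta> s. 0 < s \<Longrightarrow> s < T \<Longrightarrow> f \<zeta> s \<le> ennreal (A * s powr (- q))"
      and mass: "\<And>\<eta> s. 0 < s \<Longrightarrow> s < T \<Longrightarrow> (\<integral>\<^sup>+\<xi>\<in>hball \<eta> (T powr (1 / \<alpha>)). f \<xi> s \<partial>lborel) \<le> ennreal A"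
      and t: "0 < t" "t < T"
    define R where "R = T powr (1 / \<alpha>)"
    have R: "0 < R" using t by (simp add: R_def)
    define w where "w \<zeta> s = enn2real (f \<zeta> s) powr p" for \<zeta> s
    have gw: "ennreal (g * w \<zeta> s) = ennreal (w \<zeta> s) * ennreal g" for g \<zeta> s
      using ennreal_mult''[of "w \<zeta> s" g] mult.commute[of "ennreal g"] by (simp add: w_def)
    define I where "I \<xi> s = (\<integral>\<^sup>+ \<zeta>. ennreal (G \<alpha> (hmult (hinv \<zeta>) \<xi>) (t - s) * w \<zeta> s) \<partial>lborel)" for \<xi> s
    have fs [measurable]: "(\<lambda>\<zeta>. f \<zeta> s) \<in> borel_measurable borel" for s
      using measurable_compose[OF _ f, of "\<lambda>\<zeta>. (\<zeta>, s)" borel]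
      by (auto intro!: borel_measurable_continuous_onI continuous_intros)
    then have [measurable]: "(\<lambda>\<zeta>. w \<zeta> s) \<in> borel_measurable borel" for s
      unfolding w_def by measurable
    have wle: "w \<zeta> s \<le> (A * s powr (- q)) powr p" "ennreal (w \<zeta> s) \<le> ennreal ((A * s powr (- q)) powr (p - 1)) * f \<zeta> s"
      if s: "0 < s" "s < T" for \<zeta> s
    proof -
      let ?b = "A * s powr (- q)"
      have "f \<zeta> s < top" by (rule order_le_less_trans[OF sup[OF s] ennreal_less_top])
      then obtain x where x: "0 \<le> x" "f \<zeta> s = ennreal x" by (cases "f \<zeta> s") auto
      have xb: "x \<le> ?b" using sup[OF s, of \<zeta>] A unfolding x(2) by (subst (asm) ennreal_le_iff) auto
      show "w \<zeta> s \<le> ?b powr p" using x xb p by (simp add: w_def powr_mono2)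
      have "w \<zeta> s = x powr (p - 1 + 1)" using x by (simp add: w_def)
      also have "\<dots> = x powr (p - 1) * x" unfolding powr_add using x by simp
      also have "\<dots> \<le> ?b powr (p - 1) * x" using x xb p by (intro mult_right_mono powr_mono2) auto
      finally show "ennreal (w \<zeta> s) \<le> ennreal (?b powr (p - 1)) * f \<zeta> s"
        unfolding x(2) using x by (subst ennreal_mult''[symmetric]) (auto intro: ennreal_leI)
    qed
    have pw: "(A * s powr (- q)) powr (p - 1) * A = A powr p * s powr (- \<beta>)"
      "(A * s powr (- q)) powr p = A powr p * s powr (- \<beta>) * s powr (- q)" if "0 < s" for s
    proof -
      have "A powr (p - 1) * A = A powr (p - 1) * A powr 1" using A by simp
      also have "\<dots> = A powr p" unfolding powr_add[symmetric] by simp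
      finally have Ap: "A powr (p - 1) * A = A powr p" .
      have "(A * s powr (- q)) powr (p - 1) * A = (A powr (p - 1) * A) * s powr (- \<beta>)"
        unfolding powr_mult by (simp add: powr_powr \<beta>_def)
      then show "(A * s powr (- q)) powr (p - 1) * A = A powr p * s powr (- \<beta>)" unfolding Ap .
      have "- q * p = - \<beta> + - q" by (simp add: \<beta>_def algebra_simps)
      then have "(s powr (- q)) powr p = s powr (- \<beta>) * s powr (- q)"
        unfolding powr_powr by (simp only: powr_add)
      then show "(A * s powr (- q)) powr p = A powr p * s powr (- \<beta>) * s powr (- q)"
        unfolding powr_mult by (simp only: mult.assoc)
    qed
    \<comment> \<open>The source becomes a measure, so that the potential estimates apply to it as
      they do to the initial data.\<close>
    have uloc: "uloc_measure (density lborel (\<lambda>\<zeta>. ennreal (w \<zeta> s))) R (ennreal (A powr p * s powr (- \<beta>)))"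
      if s: "0 < s" "s < T" for s
    proof (rule uloc_measure.intro)
      show "sigma_finite_measure (density lborel (\<lambda>\<zeta>. ennreal (w \<zeta> s)))"
        by (subst sigma_finite_measure.sigma_finite_iff_density_finite[OF lborel.sigma_finite_measure_axioms]) auto
      fix \<eta>
      have "emeasure (density lborel (\<lambda>\<zeta>. ennreal (w \<zeta> s))) (hball \<eta> R) = (\<integral>\<^sup>+\<zeta>\<in>hball \<eta> R. ennreal (w \<zeta> s) \<partial>lborel)"
        by (rule emeasure_density) auto
      also have "\<dots> \<le> (\<integral>\<^sup>+\<zeta>. ennreal ((A * s powr (- q)) powr (p - 1)) * (f \<zeta> s * indicator (hball \<eta> R) \<zeta>) \<partial>lborel)"
        unfolding mult.assoc[symmetric] by (intro nn_integral_mono mult_right_mono wle(2) s) auto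
      also have "\<dots> = ennreal ((A * s powr (- q)) powr (p - 1)) * (\<integral>\<^sup>+\<zeta>\<in>hball \<eta> R. f \<zeta> s \<partial>lborel)"
        by (rule nn_integral_cmult) measurable
      also have "\<dots> \<le> ennreal ((A * s powr (- q)) powr (p - 1)) * ennreal A"
        unfolding R_def by (intro mult_left_mono mass s) auto
      also have "\<dots> = ennreal (A powr p * s powr (- \<beta>))"
        using A pw(1)[OF s(1)] by (subst ennreal_mult''[symmetric]) auto
      finally show "emeasure (density lborel (\<lambda>\<zeta>. ennreal (w \<zeta> s))) (hball \<eta> R) \<le> ennreal (A powr p * s powr (- \<beta>))" .
    qed (auto simp: R)
    have I_eq: "I \<xi> s = (\<integral>\<^sup>+ \<zeta>. ennreal (G \<alpha> (hmult (hinv \<zeta>) \<xi>) (t - s)) \<partial>density lborel (\<lambda>\<zeta>. ennreal (w \<zeta> s)))" for \<xi> s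
    proof -
      have "(\<integral>\<^sup>+ \<zeta>. ennreal (G \<alpha> (hmult (hinv \<zeta>) \<xi>) (t - s)) \<partial>density lborel (\<lambda>\<zeta>. ennreal (w \<zeta> s)))
          = (\<integral>\<^sup>+ \<zeta>. ennreal (w \<zeta> s) * ennreal (G \<alpha> (hmult (hinv \<zeta>) \<xi>) (t - s)) \<partial>lborel)"
        by (rule nn_integral_density) measurable
      also have "\<dots> = I \<xi> s"
        unfolding I_def by (simp only: gw)
      finally show ?thesis by simp
    qed
    have le_R: "0 < t - s" "(t - s) powr (1 / \<alpha>) \<le> R" if "0 < s" "s < t" for s
      using that t \<alpha> unfolding R_def by (auto intro!: powr_mono2)
    have half: "x powr (- q) \<le> 2 powr q * t powr (- q)" if "t / 2 \<le> x" for x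
    proof -
      have "x powr (- q) \<le> (t / 2) powr (- q)" using that t q by (intro powr_mono2') auto
      also have "\<dots> = 2 powr q * t powr (- q)" using t by (simp add: powr_divide powr_minus field_simps)
      finally show ?thesis .
    qed
    have I_sup: "I \<xi> s \<le> ennreal (C * 2 powr q * A powr p * t powr (- q) * s powr (- \<beta>))" if s: "0 < s" "s < t" for \<xi> s
    proof (cases "s \<le> t / 2")
      case True
      have sT: "s < T" using s t by simp
      have "I \<xi> s \<le> ennreal (C * (t - s) powr (- q)) * ennreal (A powr p * s powr (- \<beta>))"
        unfolding I_eq by (rule C1[OF uloc[OF s(1) sT] le_R[OF s]])
      also have "\<dots> = ennreal (C * (t - s) powr (- q) * (A powr p * s powr (- \<beta>)))"
        by (rule ennreal_mult''[symmetric]) simp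
      also have "\<dots> \<le> ennreal (C * (2 powr q * t powr (- q)) * (A powr p * s powr (- \<beta>)))"
        using C True s by (intro ennreal_leI mult_right_mono mult_left_mono half) auto
      finally show ?thesis by (simp only: mult_ac)
    next
      case False
      have "I \<xi> s \<le> (\<integral>\<^sup>+ \<zeta>. ennreal ((A * s powr (- q)) powr p) * ennreal (G \<alpha> (hmult (hinv \<zeta>) \<xi>) (t - s)) \<partial>lborel)"
        unfolding I_def
      proof (intro nn_integral_mono)
        fix \<zeta>
        have "ennreal (G \<alpha> (hmult (hinv \<zeta>) \<xi>) (t - s) * w \<zeta> s) = ennreal (w \<zeta> s) * ennreal (G \<alpha> (hmult (hinv \<zeta>) \<xi>) (t - s))"
          by (rule gw)
        also have "\<dots> \<le> ennreal ((A * s powr (- q)) powr p) * ennreal (G \<alpha> (hmult (hinv \<zeta>) \<xi>) (t - s))"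
          using s t by (intro mult_right_mono ennreal_leI wle(1)) auto
        finally show "ennreal (G \<alpha> (hmult (hinv \<zeta>) \<xi>) (t - s) * w \<zeta> s) \<le> \<dots>" .
      qed
      also have "\<dots> = ennreal ((A * s powr (- q)) powr p) * (\<integral>\<^sup>+ \<zeta>. ennreal (G \<alpha> (hmult (hinv \<zeta>) \<xi>) (t - s)) \<partial>lborel)"
        by (rule nn_integral_cmult) measurable
      also have "\<dots> \<le> ennreal ((A * s powr (- q)) powr p) * ennreal C"
        by (intro mult_left_mono C3 le_R(1) s) auto
      also have "\<dots> = ennreal (A powr p * s powr (- \<beta>) * s powr (- q) * C)"
        using C pw(2)[OF s(1)] by (subst ennreal_mult''[symmetric]) auto
      also have "\<dots> \<le> ennreal (A powr p * s powr (- \<beta>) * (2 powr q * t powr (- q)) * C)"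
        using C False by (intro ennreal_leI mult_right_mono mult_left_mono half) auto
      finally show ?thesis by (simp only: mult_ac)
    qed
    have d: "duhamel \<alpha> p f \<xi> t = (\<integral>\<^sup>+ s\<in>{0<..<t}. I \<xi> s \<partial>lborel)" for \<xi>
      unfolding duhamel_def I_def w_def ..
    have tT: "t powr (1 - \<beta>) \<le> T powr (1 - \<beta>)" using t \<beta> by (intro powr_mono2) auto
    have "duhamel \<alpha> p f \<eta> t \<le> (\<integral>\<^sup>+ s\<in>{0<..<t}. ennreal (C * 2 powr q * A powr p * t powr (- q) * s powr (- \<beta>)) \<partial>lborel)"
      unfolding d using I_sup by (intro nn_integral_mono) (auto split: split_indicator)
    also have "\<dots> \<le> ennreal (C * 2 powr q * A powr p * t powr (- q) / (1 - \<beta>) * t powr (1 - \<beta>))"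
      using C t \<beta> by (intro nn_integral_powr_0) auto
    also have "\<dots> \<le> ennreal (C * 2 powr q * A powr p * t powr (- q) / (1 - \<beta>) * T powr (1 - \<beta>))"
      using C \<beta> tT by (intro ennreal_leI mult_left_mono) auto
    also have "C * 2 powr q * A powr p * t powr (- q) / (1 - \<beta>) * T powr (1 - \<beta>)
        = K * A powr p * T powr (1 - q * (p - 1)) * t powr (- q)"
      unfolding K_def \<beta>_def[symmetric] by (simp add: mult_ac)
    finally have 1: "duhamel \<alpha> p f \<eta> t \<le> ennreal (K * A powr p * T powr (1 - q * (p - 1)) * t powr (- q))" .
    have I_meas: "(\<lambda>v. I (fst v) (snd v)) \<in> borel_measurable (lborel \<Otimes>\<^sub>M lborel)"
      unfolding I_def w_def
    proof (rule lborel.borel_measurable_nn_integral)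
      have "(\<lambda>x. ennreal (G \<alpha> (hmult (hinv (snd x)) (fst (fst x))) (t - snd (fst x)) * enn2real (f (snd x) (snd (fst x))) powr p))
          \<in> borel_measurable ((lborel \<Otimes>\<^sub>M lborel) \<Otimes>\<^sub>M lborel)"
        by (rule duhamel_integrand_measurable[OF f]) measurable
      then show "(\<lambda>(v, \<zeta>). ennreal (G \<alpha> (hmult (hinv \<zeta>) (fst v)) (t - snd v) * enn2real (f \<zeta> (snd v)) powr p))
          \<in> borel_measurable ((lborel \<Otimes>\<^sub>M lborel) \<Otimes>\<^sub>M lborel)"
        by (simp add: case_prod_beta')
    qed
    have [measurable]: "(\<lambda>x. I (a x) (b x)) \<in> borel_measurable L" if "a \<in> borel_measurable L" "b \<in> borel_measurable L" for a b L
      using measurable_compose[OF measurable_Pair[of a L lborel b lborel] I_meas] that by simp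
    have "(\<integral>\<^sup>+\<xi>\<in>hball \<eta> R. duhamel \<alpha> p f \<xi> t \<partial>lborel)
        = (\<integral>\<^sup>+\<xi>. \<integral>\<^sup>+s. I \<xi> s * indicator {0<..<t} s * indicator (hball \<eta> R) \<xi> \<partial>lborel \<partial>lborel)"
      unfolding d by (intro nn_integral_cong nn_integral_multc[symmetric]) measurable
    also have "\<dots> = (\<integral>\<^sup>+s. \<integral>\<^sup>+\<xi>. I \<xi> s * indicator {0<..<t} s * indicator (hball \<eta> R) \<xi> \<partial>lborel \<partial>lborel)"
      by (rule lborel_pair.Fubini'[symmetric]) measurable
    also have "\<dots> \<le> (\<integral>\<^sup>+ s\<in>{0<..<t}. ennreal (C * A powr p * s powr (- \<beta>)) \<partial>lborel)"
    proof (intro nn_integral_mono)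
      fix s
      show "(\<integral>\<^sup>+\<xi>. I \<xi> s * indicator {0<..<t} s * indicator (hball \<eta> R) \<xi> \<partial>lborel)
          \<le> ennreal (C * A powr p * s powr (- \<beta>)) * indicator {0<..<t} s"
      proof (cases "0 < s \<and> s < t")
        case True
        then have s: "0 < s" "s < t" "s < T" using t by auto
        have "(\<integral>\<^sup>+\<xi>\<in>hball \<eta> R. I \<xi> s \<partial>lborel) \<le> ennreal C * ennreal (A powr p * s powr (- \<beta>))"
          unfolding I_eq by (rule C2[OF uloc[OF s(1,3)] le_R[OF s(1,2)]])
        also have "\<dots> = ennreal (C * (A powr p * s powr (- \<beta>)))"
          by (rule ennreal_mult''[symmetric]) simp
        finally show ?thesis using True by (simp add: mult.assoc)
      qed (auto split: split_indicator)
    qed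
    also have "\<dots> \<le> ennreal (C * A powr p / (1 - \<beta>) * t powr (1 - \<beta>))"
      using C t \<beta> by (intro nn_integral_powr_0) auto
    \<comment> \<open>The local mass estimate needs no cut at t/2; the harmless factor 2^q is
      inserted to have one constant \<open>K\<close> for both bounds.\<close>
    also have "\<dots> \<le> ennreal (2 powr q * (C * A powr p / (1 - \<beta>)) * T powr (1 - \<beta>))"
    proof (intro ennreal_leI mult_mono tT)
      have "0 \<le> C * A powr p / (1 - \<beta>)" using C \<beta> by simp
      from mult_right_mono[OF q2 this] show "C * A powr p / (1 - \<beta>) \<le> 2 powr q * (C * A powr p / (1 - \<beta>))" by simp
    qed (use C \<beta> in auto)
    also have "2 powr q * (C * A powr p / (1 - \<beta>)) * T powr (1 - \<beta>) = K * A powr p * T powr (1 - q * (p - 1))"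
      unfolding K_def \<beta>_def[symmetric] by (simp add: mult_ac)
    finally have 2: "(\<integral>\<^sup>+\<xi>\<in>hball \<eta> (T powr (1 / \<alpha>)). duhamel \<alpha> p f \<xi> t \<partial>lborel) \<le> ennreal (K * A powr p * T powr (1 - q * (p - 1)))"
      unfolding R_def .
    from 1 2 show "duhamel \<alpha> p f \<eta> t \<le> ennreal (K * A powr p * T powr (1 - q * (p - 1)) * t powr (- q)) \<and>
      (\<integral>\<^sup>+\<xi>\<in>hball \<eta> (T powr (1 / \<alpha>)). duhamel \<alpha> p f \<xi> t \<partial>lborel) \<le> ennreal (K * A powr p * T powr (1 - q * (p - 1)))" ..
  qed
qed

text \<open>The larger function must be finite, since \<open>enn2real\<close> would send an infinite
  value to 0. As the power is nonnegative, the product splits and the kernel enters through its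
  positive part.\<close>

lemma duhamel_mono:
  assumes "\<And>\<zeta> s. f \<zeta> s \<le> g \<zeta> s" "\<And>\<zeta> s. g \<zeta> s < top" "0 < p"
  shows "duhamel \<alpha> p f \<eta> t \<le> duhamel \<alpha> p g \<eta> t"
  unfolding duhamel_def
proof (intro nn_integral_mono mult_right_mono)
  fix \<zeta> :: "'a heis" and s
  have "enn2real (f \<zeta> s) powr p \<le> enn2real (g \<zeta> s) powr p"
    using assms by (intro powr_mono2 enn2real_mono) auto
  then show "ennreal (G \<alpha> (hmult (hinv \<zeta>) \<eta>) (t - s) * enn2real (f \<zeta> s) powr p)
      \<le> ennreal (G \<alpha> (hmult (hinv \<zeta>) \<eta>) (t - s) * enn2real (g \<zeta> s) powr p)"
    unfolding ennreal_mult''[OF powr_ge_zero] by (intro mult_left_mono ennreal_leI) auto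
qed auto

text \<open>Both sides are limits of the same increasing sequence; finiteness of the supremum makes
  \<open>enn2real\<close> continuous there.\<close>

lemma SUP_ennreal_powr:
  fixes a :: "nat \<Rightarrow> ennreal"
  assumes "incseq a" "(SUP n. a n) < top" "0 < p"
  shows "(SUP n. ennreal (enn2real (a n) powr p)) = ennreal (enn2real (SUP n. a n) powr p)"
proof (rule LIMSEQ_unique)
  have fin: "a n < top" for n using assms(2) by (rule order_le_less_trans[OF SUP_upper[OF UNIV_I]])
  have "incseq (\<lambda>n. ennreal (enn2real (a n) powr p))"
    using assms fin by (intro incseq_SucI ennreal_leI powr_mono2 enn2real_mono) (auto dest: incseq_SucD)
  then show "(\<lambda>n. ennreal (enn2real (a n) powr p)) \<longlonglongrightarrow> (SUP n. ennreal (enn2real (a n) powr p))"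
    by (rule LIMSEQ_SUP)
  have "a \<longlonglongrightarrow> ennreal (enn2real (SUP n. a n))"
    using LIMSEQ_SUP[OF assms(1)] assms(2) by simp
  then have "(\<lambda>n. enn2real (a n)) \<longlonglongrightarrow> enn2real (SUP n. a n)"
    by (rule tendsto_enn2real) simp
  then show "(\<lambda>n. ennreal (enn2real (a n) powr p)) \<longlonglongrightarrow> ennreal (enn2real (SUP n. a n) powr p)"
    using assms(3) by (intro tendsto_ennrealI tendsto_powr2 tendsto_const) auto
qed

text \<open>Monotone convergence, applied once in space and once in time, after the supremum has
  been moved through the power and the kernel.\<close>

lemma duhamel_SUP:
  assumes f: "\<And>n. (\<lambda>z. f n (fst z) (snd z)) \<in> borel_measurable (borel :: ('n::finite heis \<times> real) measure)"
    and mono: "\<And>n \<zeta> s. f n \<zeta> s \<le> f (Suc n) \<zeta> s" and fin: "\<And>\<zeta> s. (SUP n. f n \<zeta> s) < top" and "0 < p"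
  shows "duhamel \<alpha> p (\<lambda>\<zeta> s. SUP n. f n \<zeta> s) \<eta> t = (SUP n. duhamel \<alpha> p (f n) \<eta> t)"
proof -
  have inc: "incseq (\<lambda>n. f n \<zeta> s)" for \<zeta> s by (intro incseq_SucI mono)
  have fin': "f n \<zeta> s < top" for n \<zeta> s using fin by (rule order_le_less_trans[OF SUP_upper[OF UNIV_I]])
  let ?F = "\<lambda>n s \<zeta>. ennreal (G \<alpha> (hmult (hinv \<zeta>) \<eta>) (t - s) * enn2real (f n \<zeta> s) powr p)"
  have Fmono: "?F n s \<zeta> \<le> ?F (Suc n) s \<zeta>" for n s \<zeta>
    unfolding ennreal_mult''[OF powr_ge_zero]
    using fin' mono assms(4) by (intro mult_left_mono ennreal_leI powr_mono2 enn2real_mono) auto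
  have Fmeas: "(\<lambda>x. ?F n (a x) (b x)) \<in> borel_measurable L" if "a \<in> borel_measurable L" "b \<in> borel_measurable L" for n a b L
    by (rule duhamel_integrand_measurable[OF f]) (use that in measurable)
  have inner: "(\<lambda>s. \<integral>\<^sup>+\<zeta>. ?F n s \<zeta> \<partial>lborel) \<in> borel_measurable lborel" for n
    by (rule lborel.borel_measurable_nn_integral) (simp add: case_prod_beta' Fmeas)
  have "duhamel \<alpha> p (\<lambda>\<zeta> s. SUP n. f n \<zeta> s) \<eta> t = (\<integral>\<^sup>+ s\<in>{0<..<t}. (\<integral>\<^sup>+ \<zeta>. (SUP n. ?F n s \<zeta>) \<partial>lborel) \<partial>lborel)"
    unfolding duhamel_def ennreal_mult''[OF powr_ge_zero]
    by (simp only: SUP_ennreal_powr[OF inc fin assms(4), symmetric] SUP_mult_left_ennreal)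
  also have "\<dots> = (\<integral>\<^sup>+ s\<in>{0<..<t}. (SUP n. \<integral>\<^sup>+ \<zeta>. ?F n s \<zeta> \<partial>lborel) \<partial>lborel)"
  proof (intro nn_integral_cong arg_cong2[where f = times] nn_integral_monotone_convergence_SUP)
    show "incseq (\<lambda>n. ?F n s)" for s by (intro incseq_SucI le_funI Fmono)
    show "?F n s \<in> borel_measurable lborel" for n s by (rule Fmeas) auto
  qed simp
  also have "\<dots> = (\<integral>\<^sup>+ s. (SUP n. (\<integral>\<^sup>+ \<zeta>. ?F n s \<zeta> \<partial>lborel) * indicator {0<..<t} s) \<partial>lborel)"
    by (simp only: SUP_mult_right_ennreal)
  also have "\<dots> = (SUP n. \<integral>\<^sup>+ s. (\<integral>\<^sup>+ \<zeta>. ?F n s \<zeta> \<partial>lborel) * indicator {0<..<t} s \<partial>lborel)"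
  proof (rule nn_integral_monotone_convergence_SUP)
    show "incseq (\<lambda>n s. (\<integral>\<^sup>+ \<zeta>. ?F n s \<zeta> \<partial>lborel) * indicator {0<..<t} s)"
      by (intro incseq_SucI le_funI mult_right_mono nn_integral_mono Fmono) auto
    show "(\<lambda>s. (\<integral>\<^sup>+ \<zeta>. ?F n s \<zeta> \<partial>lborel) * indicator {0<..<t} s) \<in> borel_measurable lborel" for n
      using inner[of n] by measurable
  qed
  finally show ?thesis unfolding duhamel_def .
qed

section \<open>The monotone iteration and its limit\<close>

definition free_evolution :: "real \<Rightarrow> 'n::finite heis measure \<Rightarrow> 'n heis \<Rightarrow> real \<Rightarrow> ennreal" where
  "free_evolution \<alpha> \<mu> \<eta> t = (\<integral>\<^sup>+\<zeta>. ennreal (G \<alpha> (hmult (hinv \<zeta>) \<eta>) t) \<partial>\<mu>)"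

lemma free_evolution_measurable:
  assumes [measurable_cong]: "sets \<mu> = sets borel" and "sigma_finite_measure \<mu>"
    and [measurable]: "a \<in> borel_measurable M" "b \<in> borel_measurable M"
  shows "(\<lambda>x. free_evolution \<alpha> \<mu> (a x) (b x)) \<in> borel_measurable M"
proof -
  interpret sigma_finite_measure \<mu> by fact
  show ?thesis unfolding free_evolution_def by measurable
qed

text \<open>The cut-off to (0,T) makes the iterates vanish at all other times, so they are finite
  everywhere, as the monotonicity and limit lemmas for \<open>duhamel\<close> require.\<close>

primrec picard :: "real \<Rightarrow> real \<Rightarrow> 'n::finite heis measure \<Rightarrow> real \<Rightarrow> nat \<Rightarrow> 'n heis \<Rightarrow> real \<Rightarrow> ennreal" where
  "picard \<alpha> p \<mu> T 0 = (\<lambda>\<eta> t. 0)"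
| "picard \<alpha> p \<mu> T (Suc n) = (\<lambda>\<eta> t. (free_evolution \<alpha> \<mu> \<eta> t + duhamel \<alpha> p (picard \<alpha> p \<mu> T n) \<eta> t) * indicator {0<..<T} t)"

lemma picard_measurable:
  assumes "sets \<mu> = sets borel" "sigma_finite_measure \<mu>"
  shows "(\<lambda>z. picard \<alpha> p \<mu> T n (fst z) (snd z)) \<in> borel_measurable (borel :: ('n::finite heis \<times> real) measure)"
proof (induction n)
  case (Suc n)
  have [measurable]: "(\<lambda>z. free_evolution \<alpha> \<mu> (fst z) (snd z)) \<in> borel_measurable (borel :: ('n heis \<times> real) measure)"
    "(\<lambda>z. duhamel \<alpha> p (picard \<alpha> p \<mu> T n) (fst z) (snd z)) \<in> borel_measurable (borel :: ('n heis \<times> real) measure)"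
    by (rule free_evolution_measurable[OF assms] duhamel_measurable[OF Suc]; measurable)+
  show ?case by simp
qed simp

text \<open>Exhaustion by closed Euclidean balls, which are compact.\<close>

lemma radon_measure_sigma_finite:
  assumes "radon_measure (\<mu> :: 'n::finite heis measure)"
  shows "sigma_finite_measure \<mu>"
proof
  have s: "sets \<mu> = sets borel" and k: "\<And>K. compact K \<Longrightarrow> emeasure \<mu> K < \<infinity>"
    using assms by (auto simp: radon_measure_def)
  let ?A = "range (\<lambda>n. cball (0 :: 'n heis) (real n))"
  have "\<exists>n. x \<in> cball 0 (real n)" for x :: "'n heis"
    using real_arch_simple[of "norm x"] by (auto simp: dist_norm)
  then have "\<Union>?A = space \<mu>" using sets_eq_imp_space_eq[OF s] by auto
  moreover have "emeasure \<mu> a \<noteq> \<infinity>" if "a \<in> ?A" for a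
    using k[of a] that by (auto simp: compact_cball)
  ultimately show "\<exists>A. countable A \<and> A \<subseteq> sets \<mu> \<and> \<Union>A = space \<mu> \<and> (\<forall>a\<in>A. emeasure \<mu> a \<noteq> \<infinity>)"
    using s by (intro exI[of _ ?A]) auto
qed

lemma picard_mono:
  assumes "0 < p" "\<And>n \<zeta> s. picard \<alpha> p \<mu> T n \<zeta> s < top"
  shows "picard \<alpha> p \<mu> T n \<eta> t \<le> picard \<alpha> p \<mu> T (Suc n) \<eta> t"
proof (induction n arbitrary: \<eta> t)
  case (Suc n)
  have "duhamel \<alpha> p (picard \<alpha> p \<mu> T n) \<eta> t \<le> duhamel \<alpha> p (picard \<alpha> p \<mu> T (Suc n)) \<eta> t"
    by (intro duhamel_mono Suc assms)
  then show ?case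
    unfolding picard.simps(2)[of \<alpha> p \<mu> T n] picard.simps(2)[of \<alpha> p \<mu> T "Suc n"]
    by (intro mult_right_mono add_left_mono) auto
qed simp

theorem theorem1p3:
  fixes \<alpha> p :: real
  assumes "0 < \<alpha>" "\<alpha> \<le> 2"
    and "1 < p" "p < 1 + \<alpha> / hdim TYPE('n::finite)"
  shows "\<exists>\<gamma>>0. \<forall>(\<mu> :: 'n heis measure) (T :: real).
           radon_measure \<mu> \<and> 0 < T \<and>
           (\<forall>\<eta>. emeasure \<mu> (hball \<eta> (T powr (1 / \<alpha>)))
                  \<le> ennreal (\<gamma> * T powr (hdim TYPE('n) / \<alpha> - 1 / (p - 1))))
           \<longrightarrow> (\<exists>u. is_solution_init \<alpha> p \<mu> T u)"
proof -
  define q where "q = hdim TYPE('n) / \<alpha>"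
  obtain C where C: "0 < C"
    and C1: "\<And>(\<nu> :: 'n::finite heis measure) R M \<eta> t. uloc_measure \<nu> R M \<Longrightarrow> 0 < t \<Longrightarrow> t powr (1 / \<alpha>) \<le> R \<Longrightarrow>
       free_evolution \<alpha> \<nu> \<eta> t \<le> ennreal (C * t powr (- q)) * M"
    and C2: "\<And>(\<nu> :: 'n::finite heis measure) R M \<eta> t. uloc_measure \<nu> R M \<Longrightarrow> 0 < t \<Longrightarrow> t powr (1 / \<alpha>) \<le> R \<Longrightarrow>
       (\<integral>\<^sup>+\<xi>\<in>hball \<eta> R. free_evolution \<alpha> \<nu> \<xi> t \<partial>lborel) \<le> ennreal C * M"
    and C3: "\<And>(\<eta> :: 'n heis) t. 0 < t \<Longrightarrow> (\<integral>\<^sup>+\<zeta>. ennreal (G \<alpha> (hmult (hinv \<zeta>) \<eta>) t) \<partial>lborel) \<le> ennreal C"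
    using G_potential_bounds[OF assms(1,2)] unfolding q_def free_evolution_def by blast
  obtain K where K: "0 < K" and duh:
    "\<And>f A T (\<eta> :: 'n heis) t. (\<lambda>z. f (fst z) (snd z)) \<in> borel_measurable (borel :: ('n heis \<times> real) measure) \<Longrightarrow>
      0 < A \<Longrightarrow> (\<And>\<zeta> s. 0 < s \<Longrightarrow> s < T \<Longrightarrow> f \<zeta> s \<le> ennreal (A * s powr (- q))) \<Longrightarrow>
      (\<And>\<eta> s. 0 < s \<Longrightarrow> s < T \<Longrightarrow> (\<integral>\<^sup>+\<xi>\<in>hball \<eta> (T powr (1 / \<alpha>)). f \<xi> s \<partial>lborel) \<le> ennreal A) \<Longrightarrow> 0 < t \<Longrightarrow> t < T \<Longrightarrow>
      duhamel \<alpha> p f \<eta> t \<le> ennreal (K * A powr p * T powr (1 - q * (p - 1)) * t powr (- q)) \<and>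
      (\<integral>\<^sup>+\<xi>\<in>hball \<eta> (T powr (1 / \<alpha>)). duhamel \<alpha> p f \<xi> t \<partial>lborel) \<le> ennreal (K * A powr p * T powr (1 - q * (p - 1)))"
    using duhamel_bounds[OF assms] unfolding q_def by blast
  \<comment> \<open>The solution of K (2C)^p gamma^(p-1) = C, which makes the bound for the Duhamel
    term equal to the one for the free evolution.\<close>
  define \<gamma> where "\<gamma> = (C / (K * (2 * C) powr p)) powr (1 / (p - 1))"
  have \<gamma>: "0 < \<gamma>" using C K by (simp add: \<gamma>_def)
  have \<gamma>_pow: "K * (2 * C) powr p * \<gamma> powr (p - 1) = C"
    using C K assms by (simp add: \<gamma>_def powr_powr)
  show ?thesis
  proof (intro exI[of _ \<gamma>] conjI \<gamma> allI impI)
    fix \<mu> :: "'n heis measure" and T :: real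
    assume a: "radon_measure \<mu> \<and> 0 < T \<and> (\<forall>\<eta>. emeasure \<mu> (hball \<eta> (T powr (1 / \<alpha>)))
       \<le> ennreal (\<gamma> * T powr (hdim TYPE('n) / \<alpha> - 1 / (p - 1))))"
    then have T: "0 < T" and s\<mu>: "sets \<mu> = sets borel" by (auto simp: radon_measure_def)
    have sf: "sigma_finite_measure \<mu>" using a by (intro radon_measure_sigma_finite) auto
    define R where "R = T powr (1 / \<alpha>)"
    define M where "M = \<gamma> * T powr (q - 1 / (p - 1))"
    have M: "0 < M" using \<gamma> T by (simp add: M_def)
    \<comment> \<open>Twice the bound C M of the free evolution: one half for each term of the
      integral equation.\<close>
    define A where "A = 2 * C * M"
    have A: "0 < A" using C M by (simp add: A_def)
    have \<mu>: "uloc_measure \<mu> R (ennreal M)"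
      using a T s\<mu> sf by (intro uloc_measure.intro) (auto simp: R_def M_def q_def)
    \<comment> \<open>M^(p-1) carries T^(q(p-1) - 1), exactly the inverse of the power of T produced
      by the Duhamel estimate, so only the equation for gamma remains.\<close>
    have small: "K * A powr p * T powr (1 - q * (p - 1)) = C * M"
    proof -
      have "(q - 1 / (p - 1)) * (p - 1) = q * (p - 1) - 1" using assms by (simp add: field_simps)
      then have "M powr (p - 1) = \<gamma> powr (p - 1) * T powr (q * (p - 1) - 1)"
        unfolding M_def powr_mult powr_powr by simp
      then have Mp: "M powr (p - 1) * T powr (1 - q * (p - 1)) = \<gamma> powr (p - 1) * (T powr (q * (p - 1) - 1) * T powr (1 - q * (p - 1)))"
        by (simp only: mult.assoc)
      also have "T powr (q * (p - 1) - 1) * T powr (1 - q * (p - 1)) = 1"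
        unfolding powr_add[symmetric] using T by simp
      finally have Mp: "M powr (p - 1) * T powr (1 - q * (p - 1)) = \<gamma> powr (p - 1)" by simp
      have "A powr p = (2 * C) powr p * M powr (p - 1 + 1)" by (simp add: A_def powr_mult)
      also have "M powr (p - 1 + 1) = M powr (p - 1) * M" unfolding powr_add using M by simp
      finally have "K * A powr p * T powr (1 - q * (p - 1))
          = K * (2 * C) powr p * (M powr (p - 1) * T powr (1 - q * (p - 1))) * M"
        by (simp only: mult_ac)
      then show ?thesis unfolding Mp \<gamma>_pow .
    qed
    let ?U = "picard \<alpha> p \<mu> T"
    note U_meas = picard_measurable[OF s\<mu> sf, of \<alpha> p T]
    have le_R: "t powr (1 / \<alpha>) \<le> R" if "0 < t" "t < T" for t
      using that assms unfolding R_def by (intro powr_mono2) auto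
    \<comment> \<open>The two bounds must be propagated together, because the Duhamel estimate uses
      both the sup bound and the local mass of the previous iterate.\<close>
    have bounds: "(\<forall>\<eta> t. 0 < t \<longrightarrow> t < T \<longrightarrow> ?U n \<eta> t \<le> ennreal (A * t powr (- q))) \<and>
        (\<forall>\<eta> t. 0 < t \<longrightarrow> t < T \<longrightarrow> (\<integral>\<^sup>+\<xi>\<in>hball \<eta> R. ?U n \<xi> t \<partial>lborel) \<le> ennreal A)" for n
    proof (induction n)
      case (Suc n)
      have D: "duhamel \<alpha> p (?U n) \<eta> t \<le> ennreal (C * M * t powr (- q))"
        "(\<integral>\<^sup>+\<xi>\<in>hball \<eta> R. duhamel \<alpha> p (?U n) \<xi> t \<partial>lborel) \<le> ennreal (C * M)" if "0 < t" "t < T" for \<eta> t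
        using duh[OF U_meas A, of T n t \<eta>] Suc that unfolding small R_def by blast+
      have L: "free_evolution \<alpha> \<mu> \<eta> t \<le> ennreal (C * M * t powr (- q))"
        "(\<integral>\<^sup>+\<xi>\<in>hball \<eta> R. free_evolution \<alpha> \<mu> \<xi> t \<partial>lborel) \<le> ennreal (C * M)" if "0 < t" "t < T" for \<eta> t
      proof -
        have "ennreal (C * t powr (- q)) * ennreal M = ennreal (C * M * t powr (- q))"
          using M by (subst ennreal_mult''[symmetric]) (auto simp: mult_ac)
        then show "free_evolution \<alpha> \<mu> \<eta> t \<le> ennreal (C * M * t powr (- q))"
          using C1[OF \<mu> that(1) le_R[OF that], of \<eta>] by simp
        have "ennreal C * ennreal M = ennreal (C * M)"
          using M by (subst ennreal_mult''[symmetric]) auto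
        then show "(\<integral>\<^sup>+\<xi>\<in>hball \<eta> R. free_evolution \<alpha> \<mu> \<xi> t \<partial>lborel) \<le> ennreal (C * M)"
          using C2[OF \<mu> that(1) le_R[OF that], of \<eta>] by simp
      qed
      have U: "?U (Suc n) \<eta> t = free_evolution \<alpha> \<mu> \<eta> t + duhamel \<alpha> p (?U n) \<eta> t" if "0 < t" "t < T" for \<eta> t
        using that by simp
      show ?case
      proof (intro conjI allI impI)
        fix \<eta> t assume t: "0 < t" "t < T"
        have "?U (Suc n) \<eta> t \<le> ennreal (C * M * t powr (- q)) + ennreal (C * M * t powr (- q))"
          unfolding U[OF t] by (intro add_mono L D t)
        also have "\<dots> = ennreal (A * t powr (- q))"
          using C M by (subst ennreal_plus[symmetric]) (auto simp: A_def)
        finally show "?U (Suc n) \<eta> t \<le> ennreal (A * t powr (- q))" .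
        have [measurable]: "(\<lambda>\<xi>. free_evolution \<alpha> \<mu> \<xi> t) \<in> borel_measurable lborel"
          by (rule free_evolution_measurable[OF s\<mu> sf]) auto
        have [measurable]: "(\<lambda>\<xi>. duhamel \<alpha> p (?U n) \<xi> t) \<in> borel_measurable lborel"
          by (rule duhamel_measurable[OF U_meas]) auto
        have "(\<integral>\<^sup>+\<xi>\<in>hball \<eta> R. ?U (Suc n) \<xi> t \<partial>lborel)
            = (\<integral>\<^sup>+\<xi>\<in>hball \<eta> R. free_evolution \<alpha> \<mu> \<xi> t \<partial>lborel) + (\<integral>\<^sup>+\<xi>\<in>hball \<eta> R. duhamel \<alpha> p (?U n) \<xi> t \<partial>lborel)"
          unfolding U[OF t] distrib_right by (rule nn_integral_add) measurable
        also have "\<dots> \<le> ennreal (C * M) + ennreal (C * M)" by (intro add_mono L D t)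
        also have "\<dots> = ennreal A" using C M by (subst ennreal_plus[symmetric]) (auto simp: A_def)
        finally show "(\<integral>\<^sup>+\<xi>\<in>hball \<eta> R. ?U (Suc n) \<xi> t \<partial>lborel) \<le> ennreal A" .
      qed
    qed simp
    have U_le: "?U n \<eta> t \<le> ennreal (A * t powr (- q)) * indicator {0<..<T} t" for n \<eta> t
    proof (cases "t \<in> {0<..<T}")
      case False
      then show ?thesis by (cases n) auto
    next
      case True
      then have t: "0 < t" "t < T" by auto
      show ?thesis using bounds[of n, THEN conjunct1, rule_format, OF t, of \<eta>] True by simp
    qed
    define V where "V \<eta> t = (SUP n. ?U n \<eta> t)" for \<eta> t
    have V_fin: "V \<eta> t < top" for \<eta> t
    proof -
      have "V \<eta> t \<le> ennreal (A * t powr (- q)) * indicator {0<..<T} t"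
        unfolding V_def by (intro SUP_least U_le)
      also have "\<dots> < top" by (simp add: ennreal_mult_less_top split: split_indicator)
      finally show ?thesis .
    qed
    have U_fin: "?U n \<eta> t < top" for n \<eta> t
      using V_fin[of \<eta> t] unfolding V_def by (rule order_le_less_trans[OF SUP_upper[OF UNIV_I]])
    have p0: "0 < p" using assms by simp
    have U_mono: "?U n \<eta> t \<le> ?U (Suc n) \<eta> t" for n \<eta> t
      by (rule picard_mono[OF p0 U_fin])
    \<comment> \<open>The shifted iterates converge both to \<open>V\<close> and to the right-hand
      side; uniqueness of limits gives the equation at every point, hence almost everywhere.\<close>
    have V_eq: "V \<eta> t = free_evolution \<alpha> \<mu> \<eta> t + duhamel \<alpha> p V \<eta> t" if t: "0 < t" "t < T" for \<eta> t
    proof -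
      have "(\<lambda>n. ?U n \<eta> t) \<longlonglongrightarrow> V \<eta> t"
        unfolding V_def by (intro LIMSEQ_SUP incseq_SucI U_mono)
      then have "(\<lambda>n. ?U (Suc n) \<eta> t) \<longlonglongrightarrow> V \<eta> t" by (rule LIMSEQ_Suc)
      moreover have "(\<lambda>n. duhamel \<alpha> p (?U n) \<eta> t) \<longlonglongrightarrow> duhamel \<alpha> p V \<eta> t"
      proof -
        have "duhamel \<alpha> p V \<eta> t = (SUP n. duhamel \<alpha> p (?U n) \<eta> t)"
          unfolding V_def[abs_def]
          by (rule duhamel_SUP[where f = ?U]) (rule U_meas U_mono p0 V_fin[unfolded V_def])+
        then show ?thesis
          by (simp only:) (intro LIMSEQ_SUP incseq_SucI duhamel_mono U_mono U_fin p0)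
      qed
      then have "(\<lambda>n. free_evolution \<alpha> \<mu> \<eta> t + duhamel \<alpha> p (?U n) \<eta> t) \<longlonglongrightarrow> free_evolution \<alpha> \<mu> \<eta> t + duhamel \<alpha> p V \<eta> t"
        by (intro tendsto_add tendsto_const)
      ultimately show ?thesis using t by (intro LIMSEQ_unique) auto
    qed
    show "\<exists>u. is_solution_init \<alpha> p \<mu> T u"
    \<comment> \<open>\<open>V\<close> is finite everywhere, so passing to real values loses
      nothing.\<close>
    proof (intro exI[of _ "\<lambda>\<eta> t. enn2real (V \<eta> t)"])
      have "(\<lambda>z. V (fst z) (snd z)) \<in> borel_measurable (borel :: ('n heis \<times> real) measure)"
        unfolding V_def using U_meas by measurable
      then have "(\<lambda>z. enn2real (V (fst z) (snd z))) \<in> borel_measurable lborel" by simp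
      then have "(\<lambda>z. enn2real (V (fst z) (snd z))) \<in> borel_measurable (lebesgue :: ('n heis \<times> real) measure)"
        by (rule measurable_completion)
      then have "(\<lambda>z. enn2real (V (fst z) (snd z))) \<in> borel_measurable (restrict_space lebesgue (UNIV \<times> {0<..<T}))"
        by (rule measurable_restrict_space1)
      moreover have "ennreal (enn2real (V \<eta> t)) = free_evolution \<alpha> \<mu> \<eta> t + duhamel \<alpha> p V \<eta> t" if "t \<in> {0<..<T}" for \<eta> t
        using V_fin[of \<eta> t] V_eq[of t \<eta>] that by simp
      ultimately show "is_solution_init \<alpha> p \<mu> T (\<lambda>\<eta> t. enn2real (V \<eta> t))"
        unfolding is_solution_init_def free_evolution_def duhamel_def by auto
    qed
  qed
qed

end
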